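(* Let $\mathcal{C}$ be a slightly degenerate braided fusion category over $\Bbbk$ and let $\hat{\mathcal{C}}$ be the associated monoidal supercategory. The braiding of $\mathcal{C}$, i.e. the family of morphisms $c_{X,Y}\in\mathrm{Hom}_{\mathcal{C}}(X\otimes Y,Y\otimes X)$ regarded as even morphisms of $\hat{\mathcal{C}}$, endows $\hat{\mathcal{C}}$ with the structure of a braided monoidal supercategory.
   Context: $\Bbbk$ is an algebraically closed field of characteristic $0$. $\mathrm{sVect}$ is the symmetric monoidal category of finite-dimensional superspaces ($\mathbb{Z}/2$-graded spaces) and even maps, with braiding $v\otimes w\mapsto(-1)^{|v||w|}w\otimes v$. A braided fusion category $\mathcal{C}$ is slightly degenerate if its symmetric center (the full subcategory of all $X$ with $c_{Y,X}c_{X,Y}=\mathrm{id}$ for all $Y$) is equivalent to $\mathrm{sVect}$ as a braided category; $\varepsilon$ denotes the non-unit simple object of the symmetric center, and an isomorphism $\xi\colon\varepsilon\otimes\varepsilon\to\mathbf 1$ is fixed. Associativity constraints are suppressed. A supercategory is an $\mathrm{sVect}$-enriched category, a superfunctor is an $\mathrm{sVect}$-enriched functor. For supercategories $\mathcal{A},\mathcal{B}$, $\mathcal{A}\boxtimes\mathcal{B}$ has pairs as objects, Hom superspaces $\mathrm{Hom}_{\mathcal{A}}\otimes\mathrm{Hom}_{\mathcal{B}}$, and composition $(g\otimes g')\circ(f\otimes f')=(-1)^{|g'||f|}(g\circ f)\otimes(g'\circ f')$. A monoidal supercategory is a supercategory with a superfunctor $\otimes\colon\mathcal{A}\boxtimes\mathcal{A}\to\mathcal{A}$,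 a unit object, and even supernatural associativity and unit isomorphisms satisfying the usual axioms. A braiding on a monoidal supercategory $\mathcal{A}$ is an even supernatural isomorphism $c\colon-\otimes-\to\tau$ satisfying the usual hexagon axioms, where $\tau\colon\mathcal{A}\boxtimes\mathcal{A}\to\mathcal{A}$ sends $(X,Y)$ to $Y\otimes X$ and $f\otimes g$ to $(-1)^{|f||g|}g\otimes f$; thus supernaturality means $c_{X',Y'}\circ(f\otimes g)=(-1)^{|f||g|}(g\otimes f)\circ c_{X,Y}$ for homogeneous $f\colon X\to X'$, $g\colon Y\to Y'$. The supercategory $\hat{\mathcal{C}}$ has the same objects as $\mathcal{C}$, with $\mathrm{Hom}_{\hat{\mathcal{C}}}(X,Y)_0=\mathrm{Hom}_{\mathcal{C}}(X,Y)$ and $\mathrm{Hom}_{\hat{\mathcal{C}}}(X,Y)_1=\mathrm{Hom}_{\mathcal{C}}(X,\varepsilon\otimes Y)$. Composition of $f\colon X\to Y$ and $g\colon Y\to Z$ is the obvious one ($g\circ f$ or $(\mathrm{id}_\varepsilon\otimes g)\circ f$ in $\mathcal{C}$) unless both are odd, in which case it is $(\xi\otimes\mathrm{id}_Z)\circ(\mathrm{id}_\varepsilon\otimes g)\circ f$. The tensor product of objects is that of $\mathcal{C}$; for homogeneous $f\colon X\to Y$, $f'\colon X'\to Y'$, $f\hat\otimes f'$ is: $f\otimes f'$ if both are even, or if $f$ is odd and $f'$ even; $(c_{Y,\varepsilon}\otimes\mathrm{id}_{Y'})\circ(f\otimes f')$ if $f$ is even and $f'$ odd; $(-\xi\otimes\mathrm{id}_{Y\otimes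 Y'})\circ(\mathrm{id}_\varepsilon\otimes c_{Y,\varepsilon}\otimes\mathrm{id}_{Y'})\circ(f\otimes f')$ if both are odd. With these, $\hat{\mathcal{C}}$ is a monoidal supercategory. *)

theory Defs
  imports
    "HOL-Library.Z2"
    "HOL-Library.Function_Algebras"
    "HOL-Computational_Algebra.Polynomial"
begin

section \<open>Arrows and monoidal data\<close>

text \<open>
  An arrow carries its source and target, so that composition and tensor product of arrows need no
  object arguments. Each Hom space is a subspace of one ambient vector space, of which the
  component \<open>val\<close> is an element; every small linear category has this form up to isomorphism
  (take the direct sum of all its Hom spaces as ambient space). Arrows of a supercategory also carry
  a parity, an element of the two-element field \<^typ>\<open>bit\<close>.
\<close>

datatype ('o, 'v) arr = Arr (src: 'o) (trg: 'o) (val: 'v)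

datatype ('o, 'v) sarr = SArr (par: bit) (ssrc: 'o) (strg: 'o) (sval: 'v)

text \<open>
  The inverse \<open>iassoc\<close> of the associator \<open>assoc M X Y Z\<close>, from \<open>(X \<odot> Y) \<odot> Z\<close> to \<open>X \<odot> (Y \<odot> Z)\<close>,
  is part of the data. Composition is in applicative order: \<open>g \<cdot> f\<close> is \<open>f\<close> followed by \<open>g\<close>.
\<close>

record ('o, 'a) monoidal_data =
  obj :: "'o set"
  idt :: "'o \<Rightarrow> 'a"
  cmp :: "'a \<Rightarrow> 'a \<Rightarrow> 'a"  (infixr "\<cdot>\<index>" 60)
  tensor_obj :: "'o \<Rightarrow> 'o \<Rightarrow> 'o"  (infixr "\<odot>\<index>" 75)
  tensor :: "'a \<Rightarrow> 'a \<Rightarrow> 'a"  (infixr "\<otimes>\<index>" 70)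
  tunit :: "'o"  ("\<one>\<index>")
  assoc :: "'o \<Rightarrow> 'o \<Rightarrow> 'o \<Rightarrow> 'a"
  iassoc :: "'o \<Rightarrow> 'o \<Rightarrow> 'o \<Rightarrow> 'a"
  lunit :: "'o \<Rightarrow> 'a"
  runit :: "'o \<Rightarrow> 'a"

record ('o, 'v, 'k) linear_monoidal_data = "('o, ('o, 'v) arr) monoidal_data" +
  homspace :: "'o \<Rightarrow> 'o \<Rightarrow> 'v set"
  scl :: "'k \<Rightarrow> 'v \<Rightarrow> 'v"

record ('o, 'v, 'k) super_monoidal_data = "('o, ('o, 'v) sarr) monoidal_data" +
  shomspace :: "bit \<Rightarrow> 'o \<Rightarrow> 'o \<Rightarrow> 'v set"
  sscl :: "'k \<Rightarrow> 'v \<Rightarrow> 'v"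

definition Hom :: "('o, 'v, 'k, 'z) linear_monoidal_data_scheme \<Rightarrow> 'o \<Rightarrow> 'o \<Rightarrow> ('o, 'v) arr set"
  where "Hom C X Y = Arr X Y ` homspace C X Y"

definition SHom ::
    "('o, 'v, 'k, 'z) super_monoidal_data_scheme \<Rightarrow> bit \<Rightarrow> 'o \<Rightarrow> 'o \<Rightarrow> ('o, 'v) sarr set"
  where "SHom S p X Y = SArr p X Y ` shomspace S p X Y"

text \<open>
  The conditions below make sense for linear categories and for supercategories alike: only even
  structural arrows and identities occur in them. The argument \<open>H\<close> is the family of sets
  of (even) arrows.
\<close>

definition isomorphism ::
    "('o, 'a, 'z) monoidal_data_scheme \<Rightarrow> ('o \<Rightarrow> 'o \<Rightarrow> 'a set) \<Rightarrow> 'o \<Rightarrow> 'o \<Rightarrow> 'a \<Rightarrow> bool"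
  where "isomorphism M H X Y f \<longleftrightarrow>
    f \<in> H X Y \<and> (\<exists>g \<in> H Y X. g \<cdot>\<^bsub>M\<^esub> f = idt M X \<and> f \<cdot>\<^bsub>M\<^esub> g = idt M Y)"

definition pentagon :: "('o, 'a, 'z) monoidal_data_scheme \<Rightarrow> bool"
  where "pentagon M \<longleftrightarrow> (\<forall>W \<in> obj M. \<forall>X \<in> obj M. \<forall>Y \<in> obj M. \<forall>Z \<in> obj M.
    assoc M W X (Y \<odot>\<^bsub>M\<^esub> Z) \<cdot>\<^bsub>M\<^esub> assoc M (W \<odot>\<^bsub>M\<^esub> X) Y Z =
    (idt M W \<otimes>\<^bsub>M\<^esub> assoc M X Y Z) \<cdot>\<^bsub>M\<^esub> assoc M W (X \<odot>\<^bsub>M\<^esub> Y) Z \<cdot>\<^bsub>M\<^esub> (assoc M W X Y \<otimes>\<^bsub>M\<^esub> idt M Z))"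

definition triangle :: "('o, 'a, 'z) monoidal_data_scheme \<Rightarrow> bool"
  where "triangle M \<longleftrightarrow> (\<forall>X \<in> obj M. \<forall>Y \<in> obj M.
    (idt M X \<otimes>\<^bsub>M\<^esub> lunit M Y) \<cdot>\<^bsub>M\<^esub> assoc M X \<one>\<^bsub>M\<^esub> Y = runit M X \<otimes>\<^bsub>M\<^esub> idt M Y)"

definition hexagons :: "('o, 'a, 'z) monoidal_data_scheme \<Rightarrow> ('o \<Rightarrow> 'o \<Rightarrow> 'a) \<Rightarrow> bool"
  where "hexagons M c \<longleftrightarrow> (\<forall>X \<in> obj M. \<forall>Y \<in> obj M. \<forall>Z \<in> obj M.
    assoc M Y Z X \<cdot>\<^bsub>M\<^esub> c X (Y \<odot>\<^bsub>M\<^esub> Z) \<cdot>\<^bsub>M\<^esub> assoc M X Y Z =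
      (idt M Y \<otimes>\<^bsub>M\<^esub> c X Z) \<cdot>\<^bsub>M\<^esub> assoc M Y X Z \<cdot>\<^bsub>M\<^esub> (c X Y \<otimes>\<^bsub>M\<^esub> idt M Z) \<and>
    iassoc M Z X Y \<cdot>\<^bsub>M\<^esub> c (X \<odot>\<^bsub>M\<^esub> Y) Z \<cdot>\<^bsub>M\<^esub> iassoc M X Y Z =
      (c X Z \<otimes>\<^bsub>M\<^esub> idt M Y) \<cdot>\<^bsub>M\<^esub> iassoc M X Z Y \<cdot>\<^bsub>M\<^esub> (idt M X \<otimes>\<^bsub>M\<^esub> c Y Z))"

definition linear_on ::
    "('k \<Rightarrow> 'v \<Rightarrow> 'v) \<Rightarrow> ('k \<Rightarrow> 'w \<Rightarrow> 'w) \<Rightarrow> 'v::plus set \<Rightarrow> ('v \<Rightarrow> 'w::plus) \<Rightarrow> bool"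
  where "linear_on s t V f \<longleftrightarrow>
    (\<forall>v \<in> V. \<forall>w \<in> V. f (v + w) = f v + f w) \<and> (\<forall>a. \<forall>v \<in> V. f (s a v) = t a (f v))"


section \<open>Linear monoidal categories\<close>

locale linear_category = vector_space "scl C"
  for C :: "('o, 'v::ab_group_add, 'k::field, 'z) linear_monoidal_data_scheme" (structure) +
  assumes subspace_homspace: "\<lbrakk>X \<in> obj C; Y \<in> obj C\<rbrakk> \<Longrightarrow> subspace (homspace C X Y)"
    and idt_in_Hom: "X \<in> obj C \<Longrightarrow> idt C X \<in> Hom C X X"
    and cmp_in_Hom: "\<lbrakk>X \<in> obj C; Y \<in> obj C; Z \<in> obj C; f \<in> Hom C X Y; g \<in> Hom C Y Z\<rbrakk>
      \<Longrightarrow> g \<cdot> f \<in> Hom C X Z"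
    and idt_left: "\<lbrakk>X \<in> obj C; Y \<in> obj C; f \<in> Hom C X Y\<rbrakk> \<Longrightarrow> idt C Y \<cdot> f = f"
    and idt_right: "\<lbrakk>X \<in> obj C; Y \<in> obj C; f \<in> Hom C X Y\<rbrakk> \<Longrightarrow> f \<cdot> idt C X = f"
    and cmp_assoc: "\<lbrakk>W \<in> obj C; X \<in> obj C; Y \<in> obj C; Z \<in> obj C;
        f \<in> Hom C W X; g \<in> Hom C X Y; h \<in> Hom C Y Z\<rbrakk> \<Longrightarrow> (h \<cdot> g) \<cdot> f = h \<cdot> (g \<cdot> f)"
    and cmp_linear_right: "\<lbrakk>X \<in> obj C; Y \<in> obj C; Z \<in> obj C; g \<in> Hom C Y Z\<rbrakk>
      \<Longrightarrow> linear_on (scl C) (scl C) (homspace C X Y) (\<lambda>v. val (g \<cdot> Arr X Y v))"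
    and cmp_linear_left: "\<lbrakk>X \<in> obj C; Y \<in> obj C; Z \<in> obj C; f \<in> Hom C X Y\<rbrakk>
      \<Longrightarrow> linear_on (scl C) (scl C) (homspace C Y Z) (\<lambda>v. val (Arr Y Z v \<cdot> f))"

locale linear_monoidal_category = linear_category +
  assumes tunit_obj: "\<one> \<in> obj C"
    and tensor_obj_obj: "\<lbrakk>X \<in> obj C; Y \<in> obj C\<rbrakk> \<Longrightarrow> X \<odot> Y \<in> obj C"
    and tensor_in_Hom: "\<lbrakk>X \<in> obj C; Y \<in> obj C; X' \<in> obj C; Y' \<in> obj C;
        f \<in> Hom C X Y; f' \<in> Hom C X' Y'\<rbrakk> \<Longrightarrow> f \<otimes> f' \<in> Hom C (X \<odot> X') (Y \<odot> Y')"
    and tensor_idt: "\<lbrakk>X \<in> obj C; Y \<in> obj C\<rbrakk> \<Longrightarrow> idt C X \<otimes> idt C Y = idt C (X \<odot> Y)"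
    and interchange: "\<lbrakk>X \<in> obj C; Y \<in> obj C; Z \<in> obj C; X' \<in> obj C; Y' \<in> obj C; Z' \<in> obj C;
        f \<in> Hom C X Y; g \<in> Hom C Y Z; f' \<in> Hom C X' Y'; g' \<in> Hom C Y' Z'\<rbrakk>
      \<Longrightarrow> (g \<otimes> g') \<cdot> (f \<otimes> f') = (g \<cdot> f) \<otimes> (g' \<cdot> f')"
    and tensor_linear_right: "\<lbrakk>X \<in> obj C; Y \<in> obj C; X' \<in> obj C; Y' \<in> obj C; f \<in> Hom C X Y\<rbrakk>
      \<Longrightarrow> linear_on (scl C) (scl C) (homspace C X' Y') (\<lambda>v. val (f \<otimes> Arr X' Y' v))"
    and tensor_linear_left: "\<lbrakk>X \<in> obj C; Y \<in> obj C; X' \<in> obj C; Y' \<in> obj C; f' \<in> Hom C X' Y'\<rbrakk>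
      \<Longrightarrow> linear_on (scl C) (scl C) (homspace C X Y) (\<lambda>v. val (Arr X Y v \<otimes> f'))"
    and assoc_in_Hom: "\<lbrakk>X \<in> obj C; Y \<in> obj C; Z \<in> obj C\<rbrakk>
      \<Longrightarrow> assoc C X Y Z \<in> Hom C ((X \<odot> Y) \<odot> Z) (X \<odot> (Y \<odot> Z))"
    and iassoc_in_Hom: "\<lbrakk>X \<in> obj C; Y \<in> obj C; Z \<in> obj C\<rbrakk>
      \<Longrightarrow> iassoc C X Y Z \<in> Hom C (X \<odot> (Y \<odot> Z)) ((X \<odot> Y) \<odot> Z)"
    and iassoc_assoc: "\<lbrakk>X \<in> obj C; Y \<in> obj C; Z \<in> obj C\<rbrakk>
      \<Longrightarrow> iassoc C X Y Z \<cdot> assoc C X Y Z = idt C ((X \<odot> Y) \<odot> Z)"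
    and assoc_iassoc: "\<lbrakk>X \<in> obj C; Y \<in> obj C; Z \<in> obj C\<rbrakk>
      \<Longrightarrow> assoc C X Y Z \<cdot> iassoc C X Y Z = idt C (X \<odot> (Y \<odot> Z))"
    and assoc_natural: "\<lbrakk>X \<in> obj C; Y \<in> obj C; Z \<in> obj C; X' \<in> obj C; Y' \<in> obj C; Z' \<in> obj C;
        f \<in> Hom C X X'; g \<in> Hom C Y Y'; h \<in> Hom C Z Z'\<rbrakk>
      \<Longrightarrow> assoc C X' Y' Z' \<cdot> ((f \<otimes> g) \<otimes> h) = (f \<otimes> (g \<otimes> h)) \<cdot> assoc C X Y Z"
    and lunit_iso: "X \<in> obj C \<Longrightarrow> isomorphism C (Hom C) (\<one> \<odot> X) X (lunit C X)"
    and lunit_natural: "\<lbrakk>X \<in> obj C; Y \<in> obj C; f \<in> Hom C X Y\<rbrakk>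
      \<Longrightarrow> lunit C Y \<cdot> (idt C \<one> \<otimes> f) = f \<cdot> lunit C X"
    and runit_iso: "X \<in> obj C \<Longrightarrow> isomorphism C (Hom C) (X \<odot> \<one>) X (runit C X)"
    and runit_natural: "\<lbrakk>X \<in> obj C; Y \<in> obj C; f \<in> Hom C X Y\<rbrakk>
      \<Longrightarrow> runit C Y \<cdot> (f \<otimes> idt C \<one>) = f \<cdot> runit C X"
    and pentagon: "pentagon C"
    and triangle: "triangle C"


section \<open>Fusion categories\<close>

definition zero_arr :: "'o \<Rightarrow> 'o \<Rightarrow> ('o, 'v::zero) arr"
  where "zero_arr X Y = Arr X Y 0"

definition isomorphic :: "('o, 'v, 'k, 'z) linear_monoidal_data_scheme \<Rightarrow> 'o \<Rightarrow> 'o \<Rightarrow> bool"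
  where "isomorphic C X Y \<longleftrightarrow> (\<exists>f. isomorphism C (Hom C) X Y f)"

definition monic :: "('o, 'v, 'k, 'z) linear_monoidal_data_scheme \<Rightarrow> 'o \<Rightarrow> 'o \<Rightarrow> ('o, 'v) arr \<Rightarrow> bool"
  where "monic C X Y f \<longleftrightarrow> f \<in> Hom C X Y \<and>
    (\<forall>W \<in> obj C. \<forall>g \<in> Hom C W X. \<forall>h \<in> Hom C W X. f \<cdot>\<^bsub>C\<^esub> g = f \<cdot>\<^bsub>C\<^esub> h \<longrightarrow> g = h)"

definition epic :: "('o, 'v, 'k, 'z) linear_monoidal_data_scheme \<Rightarrow> 'o \<Rightarrow> 'o \<Rightarrow> ('o, 'v) arr \<Rightarrow> bool"
  where "epic C X Y f \<longleftrightarrow> f \<in> Hom C X Y \<and>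
    (\<forall>Z \<in> obj C. \<forall>g \<in> Hom C Y Z. \<forall>h \<in> Hom C Y Z. g \<cdot>\<^bsub>C\<^esub> f = h \<cdot>\<^bsub>C\<^esub> f \<longrightarrow> g = h)"

definition is_kernel ::
    "('o, 'v::zero, 'k, 'z) linear_monoidal_data_scheme \<Rightarrow> 'o \<Rightarrow> 'o \<Rightarrow> ('o, 'v) arr \<Rightarrow> 'o \<Rightarrow> ('o, 'v) arr \<Rightarrow> bool"
  where "is_kernel C X Y f K k \<longleftrightarrow> k \<in> Hom C K X \<and> f \<cdot>\<^bsub>C\<^esub> k = zero_arr K Y \<and>
    (\<forall>W \<in> obj C. \<forall>g \<in> Hom C W X. f \<cdot>\<^bsub>C\<^esub> g = zero_arr W Y \<longrightarrow> (\<exists>!u. u \<in> Hom C W K \<and> k \<cdot>\<^bsub>C\<^esub> u = g))"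

definition is_cokernel ::
    "('o, 'v::zero, 'k, 'z) linear_monoidal_data_scheme \<Rightarrow> 'o \<Rightarrow> 'o \<Rightarrow> ('o, 'v) arr \<Rightarrow> 'o \<Rightarrow> ('o, 'v) arr \<Rightarrow> bool"
  where "is_cokernel C X Y f Q q \<longleftrightarrow> q \<in> Hom C Y Q \<and> q \<cdot>\<^bsub>C\<^esub> f = zero_arr X Q \<and>
    (\<forall>Z \<in> obj C. \<forall>g \<in> Hom C Y Z. g \<cdot>\<^bsub>C\<^esub> f = zero_arr X Z \<longrightarrow> (\<exists>!u. u \<in> Hom C Q Z \<and> u \<cdot>\<^bsub>C\<^esub> q = g))"

text \<open>\<open>X\<close> is the direct sum of \<open>S 0, \<dots>, S (n - 1)\<close>; for \<open>n = 0\<close> this says that \<open>X\<close> is a zero object.\<close>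

definition is_direct_sum ::
    "('o, 'v::comm_monoid_add, 'k, 'z) linear_monoidal_data_scheme \<Rightarrow> 'o \<Rightarrow> nat \<Rightarrow> (nat \<Rightarrow> 'o)
      \<Rightarrow> (nat \<Rightarrow> ('o, 'v) arr) \<Rightarrow> (nat \<Rightarrow> ('o, 'v) arr) \<Rightarrow> bool"
  where "is_direct_sum C X n S i p \<longleftrightarrow>
    (\<forall>j<n. i j \<in> Hom C (S j) X \<and> p j \<in> Hom C X (S j)) \<and>
    (\<forall>j<n. \<forall>k<n. p j \<cdot>\<^bsub>C\<^esub> i k = (if j = k then idt C (S j) else zero_arr (S k) (S j))) \<and>
    (\<Sum>j<n. val (i j \<cdot>\<^bsub>C\<^esub> p j)) = val (idt C X)"

definition simple_object :: "('o, 'v::zero, 'k, 'z) linear_monoidal_data_scheme \<Rightarrow> 'o \<Rightarrow> bool"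
  where "simple_object C X \<longleftrightarrow> X \<in> obj C \<and> idt C X \<noteq> zero_arr X X \<and>
    (\<forall>W \<in> obj C. \<forall>f. monic C W X f \<longrightarrow> f = zero_arr W X \<or> isomorphism C (Hom C) W X f)"

definition is_left_dual :: "('o, 'v, 'k, 'z) linear_monoidal_data_scheme \<Rightarrow> 'o \<Rightarrow> 'o \<Rightarrow> bool"
  where "is_left_dual C X' X \<longleftrightarrow>
    (\<exists>ev \<in> Hom C (X' \<odot>\<^bsub>C\<^esub> X) \<one>\<^bsub>C\<^esub>. \<exists>coev \<in> Hom C \<one>\<^bsub>C\<^esub> (X \<odot>\<^bsub>C\<^esub> X').
      runit C X \<cdot>\<^bsub>C\<^esub> (idt C X \<otimes>\<^bsub>C\<^esub> ev) \<cdot>\<^bsub>C\<^esub> assoc C X X' X \<cdot>\<^bsub>C\<^esub> (coev \<otimes>\<^bsub>C\<^esub> idt C X) = lunit C X \<and>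
      lunit C X' \<cdot>\<^bsub>C\<^esub> (ev \<otimes>\<^bsub>C\<^esub> idt C X') \<cdot>\<^bsub>C\<^esub> iassoc C X' X X' \<cdot>\<^bsub>C\<^esub> (idt C X' \<otimes>\<^bsub>C\<^esub> coev) = runit C X')"

locale fusion_category = linear_monoidal_category +
  assumes direct_sums: "(\<And>j. j < n \<Longrightarrow> S j \<in> obj C) \<Longrightarrow> \<exists>X \<in> obj C. \<exists>i p. is_direct_sum C X n S i p"
    and kernels: "\<lbrakk>X \<in> obj C; Y \<in> obj C; f \<in> Hom C X Y\<rbrakk> \<Longrightarrow> \<exists>K \<in> obj C. \<exists>k. is_kernel C X Y f K k"
    and cokernels: "\<lbrakk>X \<in> obj C; Y \<in> obj C; f \<in> Hom C X Y\<rbrakk> \<Longrightarrow> \<exists>Q \<in> obj C. \<exists>q. is_cokernel C X Y f Q q"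
    and monic_normal: "\<lbrakk>X \<in> obj C; Y \<in> obj C; monic C X Y f\<rbrakk>
      \<Longrightarrow> \<exists>Z \<in> obj C. \<exists>g \<in> Hom C Y Z. is_kernel C Y Z g X f"
    and epic_normal: "\<lbrakk>X \<in> obj C; Y \<in> obj C; epic C X Y f\<rbrakk>
      \<Longrightarrow> \<exists>W \<in> obj C. \<exists>g \<in> Hom C W X. is_cokernel C W X g Y f"
    and semisimple: "X \<in> obj C
      \<Longrightarrow> \<exists>n S i p. (\<forall>j<n. simple_object C (S j)) \<and> is_direct_sum C X n S i p"
    and finitely_many_simples: "\<exists>I. finite I \<and> I \<subseteq> {X. simple_object C X} \<and>
      (\<forall>X. simple_object C X \<longrightarrow> (\<exists>Y \<in> I. isomorphic C X Y))"
    and finite_dimensional: "\<lbrakk>X \<in> obj C; Y \<in> obj C\<rbrakk> \<Longrightarrow> \<exists>B. finite B \<and> homspace C X Y = span B"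
    and left_dual: "X \<in> obj C \<Longrightarrow> \<exists>X' \<in> obj C. is_left_dual C X' X"
    and right_dual: "X \<in> obj C \<Longrightarrow> \<exists>X' \<in> obj C. is_left_dual C X X'"
    and End_tunit: "idt C \<one> \<noteq> zero_arr \<one> \<one>" "homspace C \<one> \<one> = range (\<lambda>a. scl C a (val (idt C \<one>)))"

locale braided_fusion_category = fusion_category +
  fixes c :: "'a \<Rightarrow> 'a \<Rightarrow> ('a, 'b) arr"
  assumes braiding_iso: "\<lbrakk>X \<in> obj C; Y \<in> obj C\<rbrakk> \<Longrightarrow> isomorphism C (Hom C) (X \<odot> Y) (Y \<odot> X) (c X Y)"
    and braiding_natural: "\<lbrakk>X \<in> obj C; Y \<in> obj C; X' \<in> obj C; Y' \<in> obj C;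
        f \<in> Hom C X X'; g \<in> Hom C Y Y'\<rbrakk> \<Longrightarrow> c X' Y' \<cdot> (f \<otimes> g) = (g \<otimes> f) \<cdot> c X Y"
    and braiding_hexagons: "hexagons C c"


section \<open>Braided equivalences and the symmetric center\<close>

definition full_subcategory ::
    "('o, 'v, 'k, 'z) linear_monoidal_data_scheme \<Rightarrow> 'o set \<Rightarrow> ('o, 'v, 'k, 'z) linear_monoidal_data_scheme"
  where "full_subcategory C A = C\<lparr>obj := A\<rparr>"

definition symmetric_center ::
    "('o, 'v, 'k, 'z) linear_monoidal_data_scheme \<Rightarrow> ('o \<Rightarrow> 'o \<Rightarrow> ('o, 'v) arr)
      \<Rightarrow> ('o, 'v, 'k, 'z) linear_monoidal_data_scheme"
  where "symmetric_center C c = full_subcategory C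
    {X \<in> obj C. \<forall>Y \<in> obj C. c Y X \<cdot>\<^bsub>C\<^esub> c X Y = idt C (X \<odot>\<^bsub>C\<^esub> Y)}"

locale linear_functor =
  fixes C :: "('o, 'v::ab_group_add, 'k::field, 'z) linear_monoidal_data_scheme"
    and D :: "('p, 'w::ab_group_add, 'k, 'y) linear_monoidal_data_scheme"
    and F\<^sub>0 :: "'o \<Rightarrow> 'p" and F :: "('o, 'v) arr \<Rightarrow> ('p, 'w) arr"
  assumes functor_obj: "X \<in> obj C \<Longrightarrow> F\<^sub>0 X \<in> obj D"
    and functor_in_Hom: "\<lbrakk>X \<in> obj C; Y \<in> obj C; f \<in> Hom C X Y\<rbrakk> \<Longrightarrow> F f \<in> Hom D (F\<^sub>0 X) (F\<^sub>0 Y)"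
    and functor_idt: "X \<in> obj C \<Longrightarrow> F (idt C X) = idt D (F\<^sub>0 X)"
    and functor_cmp: "\<lbrakk>X \<in> obj C; Y \<in> obj C; Z \<in> obj C; f \<in> Hom C X Y; g \<in> Hom C Y Z\<rbrakk>
      \<Longrightarrow> F (g \<cdot>\<^bsub>C\<^esub> f) = F g \<cdot>\<^bsub>D\<^esub> F f"
    and functor_linear: "\<lbrakk>X \<in> obj C; Y \<in> obj C\<rbrakk>
      \<Longrightarrow> linear_on (scl C) (scl D) (homspace C X Y) (\<lambda>v. val (F (Arr X Y v)))"

text \<open>\<open>J\<close> and \<open>\<phi>\<close> are the monoidal structure of the functor \<open>F\<close>.\<close>

locale braided_equivalence = linear_functor C D F\<^sub>0 F
  for C :: "('o, 'v::ab_group_add, 'k::field, 'z) linear_monoidal_data_scheme"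
    and c :: "'o \<Rightarrow> 'o \<Rightarrow> ('o, 'v) arr"
    and D :: "('p, 'w::ab_group_add, 'k, 'y) linear_monoidal_data_scheme"
    and d :: "'p \<Rightarrow> 'p \<Rightarrow> ('p, 'w) arr"
    and F\<^sub>0 :: "'o \<Rightarrow> 'p" and F :: "('o, 'v) arr \<Rightarrow> ('p, 'w) arr"
    and J :: "'o \<Rightarrow> 'o \<Rightarrow> ('p, 'w) arr" and \<phi> :: "('p, 'w) arr" +
  assumes fully_faithful: "\<lbrakk>X \<in> obj C; Y \<in> obj C\<rbrakk> \<Longrightarrow> bij_betw F (Hom C X Y) (Hom D (F\<^sub>0 X) (F\<^sub>0 Y))"
    and essentially_surjective: "U \<in> obj D \<Longrightarrow> \<exists>X \<in> obj C. isomorphic D (F\<^sub>0 X) U"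
    and J_iso: "\<lbrakk>X \<in> obj C; Y \<in> obj C\<rbrakk>
      \<Longrightarrow> isomorphism D (Hom D) (F\<^sub>0 X \<odot>\<^bsub>D\<^esub> F\<^sub>0 Y) (F\<^sub>0 (X \<odot>\<^bsub>C\<^esub> Y)) (J X Y)"
    and J_natural: "\<lbrakk>X \<in> obj C; Y \<in> obj C; X' \<in> obj C; Y' \<in> obj C; f \<in> Hom C X X'; g \<in> Hom C Y Y'\<rbrakk>
      \<Longrightarrow> J X' Y' \<cdot>\<^bsub>D\<^esub> (F f \<otimes>\<^bsub>D\<^esub> F g) = F (f \<otimes>\<^bsub>C\<^esub> g) \<cdot>\<^bsub>D\<^esub> J X Y"
    and phi_iso: "isomorphism D (Hom D) \<one>\<^bsub>D\<^esub> (F\<^sub>0 \<one>\<^bsub>C\<^esub>) \<phi>"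
    and functor_assoc: "\<lbrakk>X \<in> obj C; Y \<in> obj C; Z \<in> obj C\<rbrakk>
      \<Longrightarrow> F (assoc C X Y Z) \<cdot>\<^bsub>D\<^esub> J (X \<odot>\<^bsub>C\<^esub> Y) Z \<cdot>\<^bsub>D\<^esub> (J X Y \<otimes>\<^bsub>D\<^esub> idt D (F\<^sub>0 Z)) =
        J X (Y \<odot>\<^bsub>C\<^esub> Z) \<cdot>\<^bsub>D\<^esub> (idt D (F\<^sub>0 X) \<otimes>\<^bsub>D\<^esub> J Y Z) \<cdot>\<^bsub>D\<^esub> assoc D (F\<^sub>0 X) (F\<^sub>0 Y) (F\<^sub>0 Z)"
    and functor_lunit: "X \<in> obj C
      \<Longrightarrow> F (lunit C X) \<cdot>\<^bsub>D\<^esub> J \<one>\<^bsub>C\<^esub> X \<cdot>\<^bsub>D\<^esub> (\<phi> \<otimes>\<^bsub>D\<^esub> idt D (F\<^sub>0 X)) = lunit D (F\<^sub>0 X)"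
    and functor_runit: "X \<in> obj C
      \<Longrightarrow> F (runit C X) \<cdot>\<^bsub>D\<^esub> J X \<one>\<^bsub>C\<^esub> \<cdot>\<^bsub>D\<^esub> (idt D (F\<^sub>0 X) \<otimes>\<^bsub>D\<^esub> \<phi>) = runit D (F\<^sub>0 X)"
    and functor_braiding: "\<lbrakk>X \<in> obj C; Y \<in> obj C\<rbrakk>
      \<Longrightarrow> F (c X Y) \<cdot>\<^bsub>D\<^esub> J X Y = J Y X \<cdot>\<^bsub>D\<^esub> d (F\<^sub>0 X) (F\<^sub>0 Y)"


section \<open>Finite-dimensional superspaces\<close>

text \<open>
  All superspaces live in the space of functions from \<open>ix\<close> to the ground field. Since
  \<open>ix\<close> is infinite, every finite-dimensional space embeds into it; since \<open>ix\<close> is closed under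
  pairing, the span of the vectors \<open>vtensor v w\<close> with \<open>v\<close> in \<open>V\<close> and \<open>w\<close> in \<open>W\<close> is again in it, and
  is a tensor product of \<open>V\<close> and \<open>W\<close>.
\<close>

datatype ix = Pt nat | Pair ix ix

type_synonym 'k vec = "ix \<Rightarrow> 'k"

type_synonym 'k sspace = "bit \<Rightarrow> 'k vec set"

type_synonym 'k smap = "'k vec \<Rightarrow> 'k vec"

definition vscale :: "'k::times \<Rightarrow> 'k vec \<Rightarrow> 'k vec"
  where "vscale a v = (\<lambda>i. a * v i)"

definition vtensor :: "'k::{zero,times} vec \<Rightarrow> 'k vec \<Rightarrow> 'k vec"
  where "vtensor v w = (\<lambda>n. case n of Pt _ \<Rightarrow> 0 | Pair i j \<Rightarrow> v i * w j)"

definition unit_vec :: "'k::{zero,one} vec"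
  where "unit_vec = (\<lambda>n. if n = Pt 0 then 1 else 0)"

text \<open>The superspace \<open>V\<close> is the internal direct sum of \<open>V 0\<close> and \<open>V 1\<close>.\<close>

definition superspaces :: "'k::field sspace set"
  where "superspaces = {V. (\<forall>p. \<exists>B. finite B \<and> V p = module.span vscale B) \<and> V 0 \<inter> V 1 = {0}}"

definition total :: "'k::field sspace \<Rightarrow> 'k vec set"
  where "total V = {v + w |v w. v \<in> V 0 \<and> w \<in> V 1}"

text \<open>The value outside \<open>total V\<close> is fixed, so that two maps are equal if they agree on \<open>total V\<close>.\<close>

definition even_maps :: "'k::field sspace \<Rightarrow> 'k sspace \<Rightarrow> 'k smap set"
  where "even_maps V W = {f. linear_on vscale vscale (total V) f \<and> (\<forall>p. f ` V p \<subseteq> W p) \<and>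
    (\<forall>v. v \<notin> total V \<longrightarrow> f v = 0)}"

definition the_even_map ::
    "'k::field sspace \<Rightarrow> 'k sspace \<Rightarrow> ('k smap \<Rightarrow> bool) \<Rightarrow> ('k sspace, 'k smap) arr"
  where "the_even_map V W P = Arr V W (THE h. h \<in> even_maps V W \<and> P h)"

definition sspace_tensor :: "'k::field sspace \<Rightarrow> 'k sspace \<Rightarrow> 'k sspace"
  where "sspace_tensor V W = (\<lambda>r. module.span vscale
    {vtensor v w |v w. \<exists>p q. p + q = r \<and> v \<in> V p \<and> w \<in> W q})"

definition sspace_unit :: "'k::field sspace"
  where "sspace_unit = (\<lambda>p. if p = 0 then module.span vscale {unit_vec} else {0})"

definition sVect :: "('k::field sspace, 'k smap, 'k) linear_monoidal_data"
  where "sVect = \<lparr>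
    obj = superspaces,
    idt = (\<lambda>V. Arr V V (\<lambda>v. if v \<in> total V then v else 0)),
    cmp = (\<lambda>g f. Arr (src f) (trg g) (val g \<circ> val f)),
    tensor_obj = sspace_tensor,
    tensor = (\<lambda>f g. the_even_map (sspace_tensor (src f) (src g)) (sspace_tensor (trg f) (trg g))
      (\<lambda>h. \<forall>v \<in> total (src f). \<forall>w \<in> total (src g). h (vtensor v w) = vtensor (val f v) (val g w))),
    tunit = sspace_unit,
    assoc = (\<lambda>U V W. the_even_map
      (sspace_tensor (sspace_tensor U V) W) (sspace_tensor U (sspace_tensor V W))
      (\<lambda>h. \<forall>u \<in> total U. \<forall>v \<in> total V. \<forall>w \<in> total W.
        h (vtensor (vtensor u v) w) = vtensor u (vtensor v w))),
    iassoc = (\<lambda>U V W. the_even_map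
      (sspace_tensor U (sspace_tensor V W)) (sspace_tensor (sspace_tensor U V) W)
      (\<lambda>h. \<forall>u \<in> total U. \<forall>v \<in> total V. \<forall>w \<in> total W.
        h (vtensor u (vtensor v w)) = vtensor (vtensor u v) w)),
    lunit = (\<lambda>V. the_even_map (sspace_tensor sspace_unit V) V
      (\<lambda>h. \<forall>v \<in> total V. h (vtensor unit_vec v) = v)),
    runit = (\<lambda>V. the_even_map (sspace_tensor V sspace_unit) V
      (\<lambda>h. \<forall>v \<in> total V. h (vtensor v unit_vec) = v)),
    homspace = even_maps,
    scl = (\<lambda>a f v. vscale a (f v))\<rparr>"

definition sVect_braiding ::
    "'k::field sspace \<Rightarrow> 'k sspace \<Rightarrow> ('k sspace, 'k smap) arr"
  where "sVect_braiding V W = the_even_map (sspace_tensor V W) (sspace_tensor W V)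
    (\<lambda>h. \<forall>p q. \<forall>v \<in> V p. \<forall>w \<in> W q.
      h (vtensor v w) = (if p = 1 \<and> q = 1 then - vtensor w v else vtensor w v))"

locale slightly_degenerate_braided_fusion_category = braided_fusion_category +
  assumes center_equivalent_sVect:
    "\<exists>F\<^sub>0 F J \<phi>. braided_equivalence (symmetric_center C c) c sVect sVect_braiding F\<^sub>0 F J \<phi>"


section \<open>Monoidal supercategories\<close>

text \<open>
  Hom superspaces are given by their even and odd parts, and a bilinear even map on a tensor product
  of superspaces by bilinear maps on homogeneous parts. In particular a superfunctor out of the
  product of \<open>S\<close> with itself is a functor on pairs of homogeneous arrows, bilinear, additive in the
  parities, and satisfying the interchange law with sign.
\<close>

definition sgn_twist :: "bit \<Rightarrow> bit \<Rightarrow> ('o, 'v::ab_group_add) sarr \<Rightarrow> ('o, 'v) sarr"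
  where "sgn_twist p q f =
    (if p = 1 \<and> q = 1 then SArr (par f) (ssrc f) (strg f) (- sval f) else f)"

locale supercategory = vector_space "sscl S"
  for S :: "('o, 'v::ab_group_add, 'k::field, 'z) super_monoidal_data_scheme" (structure) +
  assumes subspace_shomspace: "\<lbrakk>X \<in> obj S; Y \<in> obj S\<rbrakk> \<Longrightarrow> subspace (shomspace S p X Y)"
    and finite_dimensional: "\<lbrakk>X \<in> obj S; Y \<in> obj S\<rbrakk> \<Longrightarrow> \<exists>B. finite B \<and> shomspace S p X Y = span B"
    and idt_in_SHom: "X \<in> obj S \<Longrightarrow> idt S X \<in> SHom S 0 X X"
    and cmp_in_SHom: "\<lbrakk>X \<in> obj S; Y \<in> obj S; Z \<in> obj S; f \<in> SHom S p X Y; g \<in> SHom S q Y Z\<rbrakk>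
      \<Longrightarrow> g \<cdot> f \<in> SHom S (q + p) X Z"
    and idt_left: "\<lbrakk>X \<in> obj S; Y \<in> obj S; f \<in> SHom S p X Y\<rbrakk> \<Longrightarrow> idt S Y \<cdot> f = f"
    and idt_right: "\<lbrakk>X \<in> obj S; Y \<in> obj S; f \<in> SHom S p X Y\<rbrakk> \<Longrightarrow> f \<cdot> idt S X = f"
    and cmp_assoc: "\<lbrakk>W \<in> obj S; X \<in> obj S; Y \<in> obj S; Z \<in> obj S;
        f \<in> SHom S p W X; g \<in> SHom S q X Y; h \<in> SHom S r Y Z\<rbrakk> \<Longrightarrow> (h \<cdot> g) \<cdot> f = h \<cdot> (g \<cdot> f)"
    and cmp_linear_right: "\<lbrakk>X \<in> obj S; Y \<in> obj S; Z \<in> obj S; g \<in> SHom S q Y Z\<rbrakk>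
      \<Longrightarrow> linear_on (sscl S) (sscl S) (shomspace S p X Y) (\<lambda>v. sval (g \<cdot> SArr p X Y v))"
    and cmp_linear_left: "\<lbrakk>X \<in> obj S; Y \<in> obj S; Z \<in> obj S; f \<in> SHom S p X Y\<rbrakk>
      \<Longrightarrow> linear_on (sscl S) (sscl S) (shomspace S q Y Z) (\<lambda>v. sval (SArr q Y Z v \<cdot> f))"

locale monoidal_supercategory = supercategory +
  assumes tunit_obj: "\<one> \<in> obj S"
    and tensor_obj_obj: "\<lbrakk>X \<in> obj S; Y \<in> obj S\<rbrakk> \<Longrightarrow> X \<odot> Y \<in> obj S"
    and tensor_in_SHom: "\<lbrakk>X \<in> obj S; Y \<in> obj S; X' \<in> obj S; Y' \<in> obj S;
        f \<in> SHom S p X Y; f' \<in> SHom S p' X' Y'\<rbrakk> \<Longrightarrow> f \<otimes> f' \<in> SHom S (p + p') (X \<odot> X') (Y \<odot> Y')"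
    and tensor_idt: "\<lbrakk>X \<in> obj S; Y \<in> obj S\<rbrakk> \<Longrightarrow> idt S X \<otimes> idt S Y = idt S (X \<odot> Y)"
    and super_interchange:
      "\<lbrakk>X \<in> obj S; Y \<in> obj S; Z \<in> obj S; X' \<in> obj S; Y' \<in> obj S; Z' \<in> obj S;
        f \<in> SHom S p X Y; g \<in> SHom S q Y Z; f' \<in> SHom S p' X' Y'; g' \<in> SHom S q' Y' Z'\<rbrakk>
      \<Longrightarrow> (g \<otimes> g') \<cdot> (f \<otimes> f') = sgn_twist q' p ((g \<cdot> f) \<otimes> (g' \<cdot> f'))"
    and tensor_linear_right: "\<lbrakk>X \<in> obj S; Y \<in> obj S; X' \<in> obj S; Y' \<in> obj S; f \<in> SHom S p X Y\<rbrakk>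
      \<Longrightarrow> linear_on (sscl S) (sscl S) (shomspace S q X' Y') (\<lambda>v. sval (f \<otimes> SArr q X' Y' v))"
    and tensor_linear_left: "\<lbrakk>X \<in> obj S; Y \<in> obj S; X' \<in> obj S; Y' \<in> obj S; f' \<in> SHom S q X' Y'\<rbrakk>
      \<Longrightarrow> linear_on (sscl S) (sscl S) (shomspace S p X Y) (\<lambda>v. sval (SArr p X Y v \<otimes> f'))"
    and assoc_in_SHom: "\<lbrakk>X \<in> obj S; Y \<in> obj S; Z \<in> obj S\<rbrakk>
      \<Longrightarrow> assoc S X Y Z \<in> SHom S 0 ((X \<odot> Y) \<odot> Z) (X \<odot> (Y \<odot> Z))"
    and iassoc_in_SHom: "\<lbrakk>X \<in> obj S; Y \<in> obj S; Z \<in> obj S\<rbrakk>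
      \<Longrightarrow> iassoc S X Y Z \<in> SHom S 0 (X \<odot> (Y \<odot> Z)) ((X \<odot> Y) \<odot> Z)"
    and iassoc_assoc: "\<lbrakk>X \<in> obj S; Y \<in> obj S; Z \<in> obj S\<rbrakk>
      \<Longrightarrow> iassoc S X Y Z \<cdot> assoc S X Y Z = idt S ((X \<odot> Y) \<odot> Z)"
    and assoc_iassoc: "\<lbrakk>X \<in> obj S; Y \<in> obj S; Z \<in> obj S\<rbrakk>
      \<Longrightarrow> assoc S X Y Z \<cdot> iassoc S X Y Z = idt S (X \<odot> (Y \<odot> Z))"
    and assoc_supernatural:
      "\<lbrakk>X \<in> obj S; Y \<in> obj S; Z \<in> obj S; X' \<in> obj S; Y' \<in> obj S; Z' \<in> obj S;
        f \<in> SHom S p X X'; g \<in> SHom S q Y Y'; h \<in> SHom S r Z Z'\<rbrakk>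
      \<Longrightarrow> assoc S X' Y' Z' \<cdot> ((f \<otimes> g) \<otimes> h) = (f \<otimes> (g \<otimes> h)) \<cdot> assoc S X Y Z"
    and lunit_iso: "X \<in> obj S \<Longrightarrow> isomorphism S (SHom S 0) (\<one> \<odot> X) X (lunit S X)"
    and lunit_supernatural: "\<lbrakk>X \<in> obj S; Y \<in> obj S; f \<in> SHom S p X Y\<rbrakk>
      \<Longrightarrow> lunit S Y \<cdot> (idt S \<one> \<otimes> f) = f \<cdot> lunit S X"
    and runit_iso: "X \<in> obj S \<Longrightarrow> isomorphism S (SHom S 0) (X \<odot> \<one>) X (runit S X)"
    and runit_supernatural: "\<lbrakk>X \<in> obj S; Y \<in> obj S; f \<in> SHom S p X Y\<rbrakk>
      \<Longrightarrow> runit S Y \<cdot> (f \<otimes> idt S \<one>) = f \<cdot> runit S X"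
    and pentagon: "pentagon S"
    and triangle: "triangle S"

locale braided_monoidal_supercategory = monoidal_supercategory +
  fixes c :: "'a \<Rightarrow> 'a \<Rightarrow> ('a, 'b) sarr"
  assumes braiding_even_iso: "\<lbrakk>X \<in> obj S; Y \<in> obj S\<rbrakk>
      \<Longrightarrow> isomorphism S (SHom S 0) (X \<odot> Y) (Y \<odot> X) (c X Y)"
    and braiding_supernatural: "\<lbrakk>X \<in> obj S; Y \<in> obj S; X' \<in> obj S; Y' \<in> obj S;
        f \<in> SHom S p X X'; g \<in> SHom S q Y Y'\<rbrakk>
      \<Longrightarrow> c X' Y' \<cdot> (f \<otimes> g) = sgn_twist p q ((g \<otimes> f) \<cdot> c X Y)"
    and braiding_hexagons: "hexagons S c"


section \<open>The monoidal supercategory associated with a slightly degenerate category\<close>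

definition even_arr :: "('o, 'v) arr \<Rightarrow> ('o, 'v) sarr"
  where "even_arr f = SArr 0 (src f) (trg f) (val f)"

definition neg_arr :: "('o, 'v::ab_group_add) arr \<Rightarrow> ('o, 'v) arr"
  where "neg_arr f = Arr (src f) (trg f) (- val f)"

text \<open>The arrow of \<open>C\<close> that represents an arrow of the associated supercategory.\<close>

definition repr ::
    "('o, 'v, 'k, 'z) linear_monoidal_data_scheme \<Rightarrow> 'o \<Rightarrow> ('o, 'v) sarr \<Rightarrow> ('o, 'v) arr"
  where "repr C \<epsilon> f = Arr (ssrc f) (if par f = 0 then strg f else \<epsilon> \<odot>\<^bsub>C\<^esub> strg f) (sval f)"

text \<open>
  \<open>contract C \<epsilon> \<xi> Z\<close> is \<open>\<xi> \<otimes> id\<close>, with associators and unitors inserted, as an arrow from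
  \<open>\<epsilon> \<odot> (\<epsilon> \<odot> Z)\<close> to \<open>Z\<close>; and \<open>move_eps C c \<epsilon> Y Z\<close> is \<open>c Y \<epsilon> \<otimes> id\<close> as an arrow
  from \<open>Y \<odot> (\<epsilon> \<odot> Z)\<close> to \<open>\<epsilon> \<odot> (Y \<odot> Z)\<close>.
\<close>

definition contract ::
    "('o, 'v, 'k, 'z) linear_monoidal_data_scheme \<Rightarrow> 'o \<Rightarrow> ('o, 'v) arr \<Rightarrow> 'o \<Rightarrow> ('o, 'v) arr"
  where "contract C \<epsilon> \<xi> Z = lunit C Z \<cdot>\<^bsub>C\<^esub> (\<xi> \<otimes>\<^bsub>C\<^esub> idt C Z) \<cdot>\<^bsub>C\<^esub> iassoc C \<epsilon> \<epsilon> Z"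

definition move_eps ::
    "('o, 'v, 'k, 'z) linear_monoidal_data_scheme \<Rightarrow> ('o \<Rightarrow> 'o \<Rightarrow> ('o, 'v) arr)
      \<Rightarrow> 'o \<Rightarrow> 'o \<Rightarrow> 'o \<Rightarrow> ('o, 'v) arr"
  where "move_eps C c \<epsilon> Y Z =
    assoc C \<epsilon> Y Z \<cdot>\<^bsub>C\<^esub> (c Y \<epsilon> \<otimes>\<^bsub>C\<^esub> idt C Z) \<cdot>\<^bsub>C\<^esub> iassoc C Y \<epsilon> Z"

definition hat_cmp ::
    "('o, 'v, 'k, 'z) linear_monoidal_data_scheme \<Rightarrow> 'o \<Rightarrow> ('o, 'v) arr
      \<Rightarrow> ('o, 'v) sarr \<Rightarrow> ('o, 'v) sarr \<Rightarrow> ('o, 'v) sarr"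
  where "hat_cmp C \<epsilon> \<xi> g f = SArr (par g + par f) (ssrc f) (strg g) (val
    (if par f = 0 then repr C \<epsilon> g \<cdot>\<^bsub>C\<^esub> repr C \<epsilon> f
     else if par g = 0 then (idt C \<epsilon> \<otimes>\<^bsub>C\<^esub> repr C \<epsilon> g) \<cdot>\<^bsub>C\<^esub> repr C \<epsilon> f
     else contract C \<epsilon> \<xi> (strg g) \<cdot>\<^bsub>C\<^esub> (idt C \<epsilon> \<otimes>\<^bsub>C\<^esub> repr C \<epsilon> g) \<cdot>\<^bsub>C\<^esub> repr C \<epsilon> f))"

definition hat_tensor ::
    "('o, 'v::ab_group_add, 'k, 'z) linear_monoidal_data_scheme \<Rightarrow> ('o \<Rightarrow> 'o \<Rightarrow> ('o, 'v) arr)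
      \<Rightarrow> 'o \<Rightarrow> ('o, 'v) arr \<Rightarrow> ('o, 'v) sarr \<Rightarrow> ('o, 'v) sarr \<Rightarrow> ('o, 'v) sarr"
  where "hat_tensor C c \<epsilon> \<xi> f f' =
    SArr (par f + par f') (ssrc f \<odot>\<^bsub>C\<^esub> ssrc f') (strg f \<odot>\<^bsub>C\<^esub> strg f') (val
      (let Y = strg f; Y' = strg f'; h = repr C \<epsilon> f \<otimes>\<^bsub>C\<^esub> repr C \<epsilon> f' in
        if par f = 0 \<and> par f' = 0 then h
        else if par f' = 0 then assoc C \<epsilon> Y Y' \<cdot>\<^bsub>C\<^esub> h
        else if par f = 0 then move_eps C c \<epsilon> Y Y' \<cdot>\<^bsub>C\<^esub> h
        else contract C \<epsilon> (neg_arr \<xi>) (Y \<odot>\<^bsub>C\<^esub> Y') \<cdot>\<^bsub>C\<^esub> (idt C \<epsilon> \<otimes>\<^bsub>C\<^esub> move_eps C c \<epsilon> Y Y')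
          \<cdot>\<^bsub>C\<^esub> assoc C \<epsilon> Y (\<epsilon> \<odot>\<^bsub>C\<^esub> Y') \<cdot>\<^bsub>C\<^esub> h))"

definition hat ::
    "('o, 'v::ab_group_add, 'k) linear_monoidal_data \<Rightarrow> ('o \<Rightarrow> 'o \<Rightarrow> ('o, 'v) arr)
      \<Rightarrow> 'o \<Rightarrow> ('o, 'v) arr \<Rightarrow> ('o, 'v, 'k) super_monoidal_data"
  where "hat C c \<epsilon> \<xi> = \<lparr>
    obj = obj C,
    idt = (\<lambda>X. even_arr (idt C X)),
    cmp = hat_cmp C \<epsilon> \<xi>,
    tensor_obj = tensor_obj C,
    tensor = hat_tensor C c \<epsilon> \<xi>,
    tunit = tunit C,
    assoc = (\<lambda>X Y Z. even_arr (assoc C X Y Z)),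
    iassoc = (\<lambda>X Y Z. even_arr (iassoc C X Y Z)),
    lunit = (\<lambda>X. even_arr (lunit C X)),
    runit = (\<lambda>X. even_arr (runit C X)),
    shomspace = (\<lambda>p X Y. if p = 0 then homspace C X Y else homspace C X (\<epsilon> \<odot>\<^bsub>C\<^esub> Y)),
    sscl = scl C\<rparr>"

end

(*
Write T for tensoring on the left with epsilon. An odd arrow from X to Y is an arrow X -> T Y;
composition and tensor product of such arrows are built from mu : T T Z -> Z (contraction with xi),
the associator T Y (x) Z -> T (Y (x) Z) and the half braiding Y (x) T Z -> T (Y (x) Z). Everything
rests on the equation c epsilon epsilon = - id. It makes mu associative, since the braiding of
epsilon with epsilon (x) epsilon is then the identity up to associators, and it makes the two ways
of pulling both copies of epsilon out of T Y (x) T Z differ by a sign, which is the sign of the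
super interchange law and of supernaturality. Both laws need only be checked for f (x) id and id (x)
f, because f (x) g = (f (x) id) o (id (x) g).

The equation itself comes from the equivalence F of the symmetric center with sVect. As epsilon (x)
epsilon is the unit, F epsilon is a line. It is not even, because then epsilon would be the unit, so
it is odd, and the braiding of an odd line with itself is - id.
*)
theory Submission
  imports Defs
begin

section \<open>Coherence in linear monoidal categories\<close>

text \<open>Associators are kept, so every law for odd arrows is a chain of coherence moves, and a
  naive proof would repeat it for each combination of parities. Parity is therefore a variable:
  \<open>T\<close>, \<open>M\<close>, \<open>L\<close>, \<open>R\<close> are trivial in even degree,
  case distinctions are confined to the laws between them, and each law of arrows is proved once for
  all parities. The minus in front of \<xi> in the tensor product of two odd arrows is forced by the
  splitting of f (x) g: in (f (x) id) o (id (x) g) the right copy of \<epsilon> is pulled out before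
  the left one, whereas the definition pulls out the left one first. In (id (x) g) o (f (x) id) the
  copies leave in the order of the definition, so there the minus survives as a twist, and braiding
  turns the first composite into the second. Transparency of \<epsilon> enters in naturality of the
  braiding in its first argument: there \<epsilon> is braided past an object and pulled back by the
  half braiding, which together is a double braiding.\<close>

context linear_category
begin

text \<open>The axioms take every object as an argument. With one predicate on the arrow itself, the
  typing conditions of a composite become equations between \<open>src\<close> and
  \<open>trg\<close>, which the simplifier settles.\<close>

definition arrow :: "('o, 'v) arr \<Rightarrow> bool"
  where "arrow f \<longleftrightarrow> src f \<in> obj C \<and> trg f \<in> obj C \<and> f \<in> Hom C (src f) (trg f)"

lemma src_trg_Hom: "f \<in> Hom C X Y \<Longrightarrow> src f = X \<and> trg f = Y"
  by (auto simp: Hom_def)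

lemma Hom_iff_arrow: "\<lbrakk>X \<in> obj C; Y \<in> obj C\<rbrakk> \<Longrightarrow> f \<in> Hom C X Y \<longleftrightarrow> arrow f \<and> src f = X \<and> trg f = Y"
  by (auto simp: arrow_def dest: src_trg_Hom)

lemma arrow_Arr: "arrow (Arr X Y v) \<longleftrightarrow> X \<in> obj C \<and> Y \<in> obj C \<and> v \<in> homspace C X Y"
  by (auto simp: arrow_def Hom_def)

lemma arrow_obj [simp]: "arrow f \<Longrightarrow> src f \<in> obj C" "arrow f \<Longrightarrow> trg f \<in> obj C"
  by (auto simp: arrow_def)

lemma arrow_val [simp]: "arrow f \<Longrightarrow> val f \<in> homspace C (src f) (trg f)"
  by (cases f) (simp add: arrow_Arr)

lemma arr_idt [simp]:
  assumes "X \<in> obj C"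
  shows "arrow (idt C X)" "src (idt C X) = X" "trg (idt C X) = X"
  using Hom_iff_arrow[OF assms assms] idt_in_Hom[OF assms] by auto

lemma arr_cmp [simp]:
  assumes "arrow f" "arrow g" "src g = trg f"
  shows "arrow (g \<cdot> f)" "src (g \<cdot> f) = src f" "trg (g \<cdot> f) = trg g"
proof -
  have "g \<cdot> f \<in> Hom C (src f) (trg g)"
    using cmp_in_Hom[of "src f" "trg f" "trg g" f g] assms by (simp add: Hom_iff_arrow)
  then show "arrow (g \<cdot> f)" "src (g \<cdot> f) = src f" "trg (g \<cdot> f) = trg g"
    using assms by (simp_all add: Hom_iff_arrow)
qed

lemma idt_cmp [simp]: "\<lbrakk>arrow f; X = trg f\<rbrakk> \<Longrightarrow> idt C X \<cdot> f = f"
  using idt_left[of "src f" "trg f" f] by (simp add: Hom_iff_arrow)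

lemma cmp_idt [simp]: "\<lbrakk>arrow f; X = src f\<rbrakk> \<Longrightarrow> f \<cdot> idt C X = f"
  using idt_right[of "src f" "trg f" f] by (simp add: Hom_iff_arrow)

lemma arr_cmp_assoc [simp]:
  "\<lbrakk>arrow f; arrow g; arrow h; src h = trg g; src g = trg f\<rbrakk> \<Longrightarrow> (h \<cdot> g) \<cdot> f = h \<cdot> g \<cdot> f"
  using cmp_assoc[of "src f" "trg f" "trg g" "trg h" f g h] by (simp add: Hom_iff_arrow)

text \<open>Composites are normalised by nesting to the right, so an equation for
  \<open>g \<cdot> f\<close> no longer matches when something precedes it. This is its form inside a
  longer composite.\<close>

lemma cmp_extend:
  "\<lbrakk>g \<cdot> f = k; arrow f; arrow g; arrow h; src g = trg f; src f = trg h\<rbrakk> \<Longrightarrow> g \<cdot> f \<cdot> h = k \<cdot> h"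
  by (metis arr_cmp_assoc)

section \<open>Invertible arrows and cancellation\<close>

definition iso :: "('o, 'v) arr \<Rightarrow> bool"
  where "iso f \<longleftrightarrow> arrow f \<and> (\<exists>g. arrow g \<and> src g = trg f \<and> trg g = src f \<and>
    g \<cdot> f = idt C (src f) \<and> f \<cdot> g = idt C (trg f))"

lemma iso_of_isomorphism:
  assumes "X \<in> obj C" "Y \<in> obj C" "isomorphism C (Hom C) X Y f"
  shows "iso f" "arrow f" "src f = X" "trg f = Y"
  using assms unfolding isomorphism_def iso_def by (auto simp: Hom_iff_arrow)

lemma iso_arrow: "iso f \<Longrightarrow> arrow f"
  by (simp add: iso_def)

text \<open>Most coherence identities below are checked after composing with associators, where the
  pentagon or a hexagon applies. This lemma and the next remove the associators again.\<close>

lemma iso_cancel_right: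
  assumes "iso a" "arrow f" "arrow g" "src f = trg a" "src g = trg a" "f \<cdot> a = g \<cdot> a"
  shows "f = g"
proof -
  obtain b where b: "arrow b" "src b = trg a" "trg b = src a" "a \<cdot> b = idt C (trg a)"
    using assms(1) by (auto simp: iso_def)
  have "(f \<cdot> a) \<cdot> b = (g \<cdot> a) \<cdot> b"
    by (simp only: assms(6))
  moreover have "(f \<cdot> a) \<cdot> b = f" "(g \<cdot> a) \<cdot> b = g"
    using assms(2-5) b iso_arrow[OF assms(1)] by simp_all
  ultimately show ?thesis by simp
qed

lemma iso_cancel_left:
  assumes "iso a" "arrow f" "arrow g" "src a = trg f" "src a = trg g" "a \<cdot> f = a \<cdot> g"
  shows "f = g"
proof -
  obtain b where b: "arrow b" "src b = trg a" "trg b = src a" "b \<cdot> a = idt C (src a)"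
    using assms(1) by (auto simp: iso_def)
  have "b \<cdot> (a \<cdot> f) = b \<cdot> (a \<cdot> g)"
    by (simp only: assms(6))
  moreover have "b \<cdot> (a \<cdot> f) = f" "b \<cdot> (a \<cdot> g) = g"
    using cmp_extend[OF b(4), of f] cmp_extend[OF b(4), of g] assms b iso_arrow[OF assms(1)] by simp_all
  ultimately show ?thesis by simp
qed

lemma iso_cmp [simp]:
  assumes "iso f" "iso g" "src g = trg f"
  shows "iso (g \<cdot> f)"
proof -
  note [simp] = iso_arrow[OF assms(1)] iso_arrow[OF assms(2)] assms(3)
  obtain f' where f' [simp]: "arrow f'" "src f' = trg f" "trg f' = src f"
      "f' \<cdot> f = idt C (src f)" "f \<cdot> f' = idt C (trg f)"
    using assms(1) by (auto simp: iso_def)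
  obtain g' where g' [simp]: "arrow g'" "src g' = trg g" "trg g' = src g"
      "g' \<cdot> g = idt C (src g)" "g \<cdot> g' = idt C (trg g)"
    using assms(2) by (auto simp: iso_def)
  have "(f' \<cdot> g') \<cdot> (g \<cdot> f) = idt C (src f)" "(g \<cdot> f) \<cdot> (f' \<cdot> g') = idt C (trg g)"
    using cmp_extend[OF g'(4), of f] cmp_extend[OF f'(5), of g'] by simp_all
  then show ?thesis
    unfolding iso_def by (intro conjI exI[of _ "f' \<cdot> g'"]) simp_all
qed

section \<open>Signs in composites\<close>

lemma arr_neg [simp]:
  assumes "arrow f"
  shows "arrow (neg_arr f)" "src (neg_arr f) = src f" "trg (neg_arr f) = trg f"
    "val (neg_arr f) = - val f"
  using assms subspace_neg[OF subspace_homspace, of "src f" "trg f" "val f"]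
  by (simp_all add: neg_arr_def arrow_Arr)

text \<open>\<open>linear_on\<close> speaks of sums and scalar multiples only, so \<open>- v\<close>
  is read as the multiple of \<open>v\<close> by -1.\<close>

lemma linear_on_neg: "\<lbrakk>linear_on (scl C) (scl C) V \<phi>; v \<in> V\<rbrakk> \<Longrightarrow> \<phi> (- v) = - \<phi> v"
  unfolding linear_on_def by (metis scale_minus_left scale_one)

lemma arr_eq: "\<lbrakk>src f = src g; trg f = trg g; val f = val g\<rbrakk> \<Longrightarrow> f = g"
  by (simp add: arr.expand)

lemma Arr_val [simp]: "\<lbrakk>src f = X; trg f = Y\<rbrakk> \<Longrightarrow> Arr X Y (val f) = f"
  by auto

lemma neg_neg [simp]: "neg_arr (neg_arr f) = f"
  by (simp add: neg_arr_def)

lemma cmp_neg_right [simp]: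
  assumes "arrow f" "arrow g" "src g = trg f"
  shows "g \<cdot> neg_arr f = neg_arr (g \<cdot> f)"
proof (rule arr_eq)
  have "linear_on (scl C) (scl C) (homspace C (src f) (src g)) (\<lambda>v. val (g \<cdot> Arr (src f) (src g) v))"
    using assms by (intro cmp_linear_right[of "src f" "src g" "trg g"]) (auto simp: Hom_iff_arrow)
  from linear_on_neg[OF this, of "val f"] show "val (g \<cdot> neg_arr f) = val (neg_arr (g \<cdot> f))"
    using assms by (simp add: neg_arr_def)
qed (use assms in simp_all)

lemma cmp_neg_left [simp]:
  assumes "arrow f" "arrow g" "src g = trg f"
  shows "neg_arr g \<cdot> f = neg_arr (g \<cdot> f)"
proof (rule arr_eq)
  have "linear_on (scl C) (scl C) (homspace C (src g) (trg g)) (\<lambda>v. val (Arr (src g) (trg g) v \<cdot> f))"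
    using assms by (intro cmp_linear_left[of "src f" "src g" "trg g"]) (auto simp: Hom_iff_arrow)
  from linear_on_neg[OF this, of "val g"] show "val (neg_arr g \<cdot> f) = val (neg_arr (g \<cdot> f))"
    using assms arrow_val[OF assms(2)] by (simp add: neg_arr_def)
qed (use assms in simp_all)

end

section \<open>Calculus of tensor products, associators and unitors\<close>

context linear_monoidal_category
begin

declare tunit_obj [simp] tensor_obj_obj [simp]

lemma arr_tensor [simp]:
  assumes "arrow f" "arrow g"
  shows "arrow (f \<otimes> g)" "src (f \<otimes> g) = src f \<odot> src g" "trg (f \<otimes> g) = trg f \<odot> trg g"
proof -
  have "f \<otimes> g \<in> Hom C (src f \<odot> src g) (trg f \<odot> trg g)"
    using assms by (intro tensor_in_Hom) (auto simp: Hom_iff_arrow)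
  then show "arrow (f \<otimes> g)" "src (f \<otimes> g) = src f \<odot> src g" "trg (f \<otimes> g) = trg f \<odot> trg g"
    using assms by (simp_all add: Hom_iff_arrow)
qed

declare tensor_idt [simp]

lemma tensor_cmp [simp]:
  assumes "arrow f" "arrow g" "arrow f'" "arrow g'" "src g = trg f" "src g' = trg f'"
  shows "(g \<otimes> g') \<cdot> (f \<otimes> f') = (g \<cdot> f) \<otimes> (g' \<cdot> f')"
  using assms by (intro interchange[of "src f" "trg f" "trg g" "src f'" "trg f'" "trg g'"])
    (auto simp: Hom_iff_arrow)

lemma tensor_cmp_extend [simp]:
  assumes "arrow f" "arrow g" "arrow f'" "arrow g'" "src g = trg f" "src g' = trg f'"
    and "arrow h" "trg h = src f \<odot> src f'"
  shows "(g \<otimes> g') \<cdot> (f \<otimes> f') \<cdot> h = ((g \<cdot> f) \<otimes> (g' \<cdot> f')) \<cdot> h"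
  using assms by (intro cmp_extend) auto

lemma tensor_neg [simp]:
  assumes "arrow f" "arrow g"
  shows "f \<otimes> neg_arr g = neg_arr (f \<otimes> g)" "neg_arr f \<otimes> g = neg_arr (f \<otimes> g)"
proof -
  have "linear_on (scl C) (scl C) (homspace C (src g) (trg g)) (\<lambda>v. val (f \<otimes> Arr (src g) (trg g) v))"
    using assms by (intro tensor_linear_right[of "src f" "trg f"]) (auto simp: Hom_iff_arrow)
  from linear_on_neg[OF this, of "val g"] show "f \<otimes> neg_arr g = neg_arr (f \<otimes> g)"
    using assms by (intro arr_eq) (simp_all, simp add: neg_arr_def)
  have "linear_on (scl C) (scl C) (homspace C (src f) (trg f)) (\<lambda>v. val (Arr (src f) (trg f) v \<otimes> g))"
    using assms by (intro tensor_linear_left[of _ _ "src g" "trg g"]) (auto simp: Hom_iff_arrow)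
  from linear_on_neg[OF this, of "val f"] show "neg_arr f \<otimes> g = neg_arr (f \<otimes> g)"
    using assms by (intro arr_eq) (simp_all, simp add: neg_arr_def)
qed

lemma arr_assoc [simp]:
  assumes "X \<in> obj C" "Y \<in> obj C" "Z \<in> obj C"
  shows "arrow (assoc C X Y Z)" "src (assoc C X Y Z) = (X \<odot> Y) \<odot> Z"
    "trg (assoc C X Y Z) = X \<odot> (Y \<odot> Z)"
    "arrow (iassoc C X Y Z)" "src (iassoc C X Y Z) = X \<odot> (Y \<odot> Z)"
    "trg (iassoc C X Y Z) = (X \<odot> Y) \<odot> Z"
    "assoc C X Y Z \<cdot> iassoc C X Y Z = idt C (X \<odot> (Y \<odot> Z))"
    "iassoc C X Y Z \<cdot> assoc C X Y Z = idt C ((X \<odot> Y) \<odot> Z)"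
  using assoc_in_Hom[OF assms] iassoc_in_Hom[OF assms] assoc_iassoc iassoc_assoc assms
  by (simp_all add: Hom_iff_arrow)

lemma assoc_cancel [simp]:
  assumes "X \<in> obj C" "Y \<in> obj C" "Z \<in> obj C" "arrow f"
  shows "trg f = X \<odot> (Y \<odot> Z) \<Longrightarrow> assoc C X Y Z \<cdot> iassoc C X Y Z \<cdot> f = f"
    "trg f = (X \<odot> Y) \<odot> Z \<Longrightarrow> iassoc C X Y Z \<cdot> assoc C X Y Z \<cdot> f = f"
  using cmp_extend[OF arr_assoc(7), of X Y Z f] cmp_extend[OF arr_assoc(8), of X Y Z f] assms by simp_all

lemma iso_assoc [simp]:
  assumes "X \<in> obj C" "Y \<in> obj C" "Z \<in> obj C"
  shows "iso (assoc C X Y Z)" "iso (iassoc C X Y Z)"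
  using assms by (auto simp: iso_def intro: exI[of _ "assoc C X Y Z"] exI[of _ "iassoc C X Y Z"])

lemma iso_idt [simp]: "X \<in> obj C \<Longrightarrow> iso (idt C X)"
  by (auto simp: iso_def intro!: exI[of _ "idt C X"])

lemma iso_tensor [simp]:
  assumes "iso f" "iso g"
  shows "iso (f \<otimes> g)"
proof -
  note [simp] = iso_arrow[OF assms(1)] iso_arrow[OF assms(2)]
  obtain f' where f' [simp]: "arrow f'" "src f' = trg f" "trg f' = src f"
      "f' \<cdot> f = idt C (src f)" "f \<cdot> f' = idt C (trg f)"
    using assms(1) by (auto simp: iso_def)
  obtain g' where g' [simp]: "arrow g'" "src g' = trg g" "trg g' = src g"
      "g' \<cdot> g = idt C (src g)" "g \<cdot> g' = idt C (trg g)"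
    using assms(2) by (auto simp: iso_def)
  show ?thesis
    unfolding iso_def by (intro conjI exI[of _ "f' \<otimes> g'"]) simp_all
qed

lemma assoc_nat:
  "\<lbrakk>arrow f; arrow g; arrow h; src f = X; src g = Y; src h = Z; trg f = X'; trg g = Y'; trg h = Z'\<rbrakk>
    \<Longrightarrow> assoc C X' Y' Z' \<cdot> ((f \<otimes> g) \<otimes> h) = (f \<otimes> (g \<otimes> h)) \<cdot> assoc C X Y Z"
  by (rule assoc_natural) (auto simp: Hom_iff_arrow)

text \<open>Naturality is an axiom for \<open>assoc\<close>; conjugating by the associators carries
  it over to the inverse.\<close>

lemma iassoc_nat:
  assumes "arrow f" "arrow g" "arrow h" "src f = X" "src g = Y" "src h = Z"
    "trg f = X'" "trg g = Y'" "trg h = Z'"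
  shows "iassoc C X' Y' Z' \<cdot> (f \<otimes> (g \<otimes> h)) = ((f \<otimes> g) \<otimes> h) \<cdot> iassoc C X Y Z"
proof -
  have o: "X \<in> obj C" "Y \<in> obj C" "Z \<in> obj C" "X' \<in> obj C" "Y' \<in> obj C" "Z' \<in> obj C"
    using assms by auto
  have "(f \<otimes> (g \<otimes> h)) = (assoc C X' Y' Z' \<cdot> ((f \<otimes> g) \<otimes> h)) \<cdot> iassoc C X Y Z"
    unfolding assoc_nat[OF assms] using assms o by simp
  then show ?thesis using assms o by simp
qed

lemma arr_unit [simp]:
  assumes "X \<in> obj C"
  shows "iso (lunit C X)" "arrow (lunit C X)" "src (lunit C X) = \<one> \<odot> X" "trg (lunit C X) = X"
    "iso (runit C X)" "arrow (runit C X)" "src (runit C X) = X \<odot> \<one>" "trg (runit C X) = X"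
  using iso_of_isomorphism[OF _ _ lunit_iso] iso_of_isomorphism[OF _ _ runit_iso] assms by auto

lemma lunit_nat: "\<lbrakk>arrow f; src f = X; trg f = Y\<rbrakk> \<Longrightarrow> lunit C Y \<cdot> (idt C \<one> \<otimes> f) = f \<cdot> lunit C X"
  by (rule lunit_natural) (auto simp: Hom_iff_arrow)

lemma runit_nat: "\<lbrakk>arrow f; src f = X; trg f = Y\<rbrakk> \<Longrightarrow> runit C Y \<cdot> (f \<otimes> idt C \<one>) = f \<cdot> runit C X"
  by (rule runit_natural) (auto simp: Hom_iff_arrow)

text \<open>\<open>lunit\<close> is an invertible natural transformation from tensoring with \<one>
  to the identity, so this tensoring loses no information. It allows axioms with one more unit to be
  used below.\<close>

lemma lwhisker_unit_inj:
  assumes "arrow f" "arrow g" "src f = src g" "trg f = trg g" "idt C \<one> \<otimes> f = idt C \<one> \<otimes> g"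
  shows "f = g"
  by (rule iso_cancel_right[of "lunit C (src f)"])
    (use assms in \<open>simp_all flip: lunit_nat[of f] lunit_nat[of g]\<close>)

lemma rwhisker_unit_inj:
  assumes "arrow f" "arrow g" "src f = src g" "trg f = trg g" "f \<otimes> idt C \<one> = g \<otimes> idt C \<one>"
  shows "f = g"
  by (rule iso_cancel_right[of "runit C (src f)"])
    (use assms in \<open>simp_all flip: runit_nat[of f] runit_nat[of g]\<close>)

section \<open>Unitors of a tensor product\<close>

lemma pent:
  "\<lbrakk>W \<in> obj C; X \<in> obj C; Y \<in> obj C; Z \<in> obj C\<rbrakk> \<Longrightarrow>
    assoc C W X (Y \<odot> Z) \<cdot> assoc C (W \<odot> X) Y Z =
    (idt C W \<otimes> assoc C X Y Z) \<cdot> assoc C W (X \<odot> Y) Z \<cdot> (assoc C W X Y \<otimes> idt C Z)"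
  using pentagon by (simp add: pentagon_def)

lemma tri: "\<lbrakk>X \<in> obj C; Y \<in> obj C\<rbrakk> \<Longrightarrow>
    (idt C X \<otimes> lunit C Y) \<cdot> assoc C X \<one> Y = runit C X \<otimes> idt C Y"
  using triangle by (simp add: triangle_def)

text \<open>The triangle axiom has the unit in the middle; here it stands on the left. By Kelly's
  argument one more unit is put in front, and the pentagon for \<one>, \<one>, X, Y with two
  triangles proves the equation under \<one>.\<close>

lemma lunit_tensor:
  assumes [simp]: "X \<in> obj C" "Y \<in> obj C"
  shows "lunit C (X \<odot> Y) \<cdot> assoc C \<one> X Y = lunit C X \<otimes> idt C Y"
proof (rule lwhisker_unit_inj)
  show "idt C \<one> \<otimes> (lunit C (X \<odot> Y) \<cdot> assoc C \<one> X Y) = idt C \<one> \<otimes> (lunit C X \<otimes> idt C Y)"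
  \<comment> \<open>The two arrows that come first on the three-arrow side of the pentagon, so that
    its other side can be substituted.\<close>
  proof (rule iso_cancel_right[of "assoc C \<one> (\<one> \<odot> X) Y \<cdot> (assoc C \<one> \<one> X \<otimes> idt C Y)"])
    have "(idt C \<one> \<otimes> (lunit C (X \<odot> Y) \<cdot> assoc C \<one> X Y)) \<cdot> assoc C \<one> (\<one> \<odot> X) Y \<cdot> (assoc C \<one> \<one> X \<otimes> idt C Y)
      = (idt C \<one> \<otimes> lunit C (X \<odot> Y)) \<cdot> (assoc C \<one> \<one> (X \<odot> Y) \<cdot> assoc C (\<one> \<odot> \<one>) X Y)"
      unfolding pent[OF tunit_obj tunit_obj assms] by simp
    also have "\<dots> = (runit C \<one> \<otimes> (idt C X \<otimes> idt C Y)) \<cdot> assoc C (\<one> \<odot> \<one>) X Y"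
      using cmp_extend[OF tri[of \<one> "X \<odot> Y"], of "assoc C (\<one> \<odot> \<one>) X Y"] by simp
    also have "\<dots> = assoc C \<one> X Y \<cdot> ((runit C \<one> \<otimes> idt C X) \<otimes> idt C Y)"
      by (rule assoc_nat[symmetric]) simp_all
    also have "\<dots> = (assoc C \<one> X Y \<cdot> ((idt C \<one> \<otimes> lunit C X) \<otimes> idt C Y)) \<cdot> (assoc C \<one> \<one> X \<otimes> idt C Y)"
      unfolding tri[OF tunit_obj assms(1), symmetric] by simp
    also have "assoc C \<one> X Y \<cdot> ((idt C \<one> \<otimes> lunit C X) \<otimes> idt C Y)
        = (idt C \<one> \<otimes> (lunit C X \<otimes> idt C Y)) \<cdot> assoc C \<one> (\<one> \<odot> X) Y"
      by (rule assoc_nat) simp_all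
    finally show "(idt C \<one> \<otimes> (lunit C (X \<odot> Y) \<cdot> assoc C \<one> X Y)) \<cdot> assoc C \<one> (\<one> \<odot> X) Y \<cdot> (assoc C \<one> \<one> X \<otimes> idt C Y)
      = (idt C \<one> \<otimes> (lunit C X \<otimes> idt C Y)) \<cdot> assoc C \<one> (\<one> \<odot> X) Y \<cdot> (assoc C \<one> \<one> X \<otimes> idt C Y)"
      by simp
  qed simp_all
qed simp_all

text \<open>The mirror image: one more unit on the right, the pentagon for X, Y, \<one>, \<one> and
  two triangles.\<close>

lemma runit_tensor:
  assumes [simp]: "X \<in> obj C" "Y \<in> obj C"
  shows "(idt C X \<otimes> runit C Y) \<cdot> assoc C X Y \<one> = runit C (X \<odot> Y)"
proof (rule rwhisker_unit_inj)
  show "((idt C X \<otimes> runit C Y) \<cdot> assoc C X Y \<one>) \<otimes> idt C \<one> = runit C (X \<odot> Y) \<otimes> idt C \<one>"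
  proof (rule iso_cancel_left[of "assoc C X Y \<one>"])
    have "assoc C X Y \<one> \<cdot> (((idt C X \<otimes> runit C Y) \<cdot> assoc C X Y \<one>) \<otimes> idt C \<one>)
      = (assoc C X Y \<one> \<cdot> ((idt C X \<otimes> runit C Y) \<otimes> idt C \<one>)) \<cdot> (assoc C X Y \<one> \<otimes> idt C \<one>)"
      by simp
    also have "assoc C X Y \<one> \<cdot> ((idt C X \<otimes> runit C Y) \<otimes> idt C \<one>)
      = (idt C X \<otimes> (runit C Y \<otimes> idt C \<one>)) \<cdot> assoc C X (Y \<odot> \<one>) \<one>"
      by (rule assoc_nat) simp_all
    also have "(\<dots>) \<cdot> (assoc C X Y \<one> \<otimes> idt C \<one>)
      = (idt C X \<otimes> (idt C Y \<otimes> lunit C \<one>)) \<cdot> (assoc C X Y (\<one> \<odot> \<one>) \<cdot> assoc C (X \<odot> Y) \<one> \<one>)"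
      unfolding pent[OF assms tunit_obj tunit_obj] tri[OF assms(2) tunit_obj, symmetric] by simp
    also have "\<dots> = ((idt C X \<otimes> (idt C Y \<otimes> lunit C \<one>)) \<cdot> assoc C X Y (\<one> \<odot> \<one>)) \<cdot> assoc C (X \<odot> Y) \<one> \<one>"
      by simp
    also have "(idt C X \<otimes> (idt C Y \<otimes> lunit C \<one>)) \<cdot> assoc C X Y (\<one> \<odot> \<one>)
      = assoc C X Y \<one> \<cdot> ((idt C X \<otimes> idt C Y) \<otimes> lunit C \<one>)"
      by (rule assoc_nat[symmetric]) simp_all
    also have "(\<dots>) \<cdot> assoc C (X \<odot> Y) \<one> \<one> = assoc C X Y \<one> \<cdot> (runit C (X \<odot> Y) \<otimes> idt C \<one>)"
      using tri[of "X \<odot> Y" \<one>] by simp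
    finally show "assoc C X Y \<one> \<cdot> (((idt C X \<otimes> runit C Y) \<cdot> assoc C X Y \<one>) \<otimes> idt C \<one>) = \<dots>" .
  qed simp_all
qed simp_all

end

section \<open>Coherence in braided categories\<close>

locale braided_linear_category = linear_monoidal_category C
  for C :: "('o, 'v::ab_group_add, 'k::field, 'z) linear_monoidal_data_scheme" (structure) +
  fixes c :: "'o \<Rightarrow> 'o \<Rightarrow> ('o, 'v) arr"
  assumes c_iso: "\<lbrakk>X \<in> obj C; Y \<in> obj C\<rbrakk> \<Longrightarrow> isomorphism C (Hom C) (X \<odot> Y) (Y \<odot> X) (c X Y)"
    and c_natural: "\<lbrakk>X \<in> obj C; Y \<in> obj C; X' \<in> obj C; Y' \<in> obj C;
        f \<in> Hom C X X'; g \<in> Hom C Y Y'\<rbrakk> \<Longrightarrow> c X' Y' \<cdot> (f \<otimes> g) = (g \<otimes> f) \<cdot> c X Y"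
    and c_hexagons: "hexagons C c"
begin

lemma arr_c [simp]:
  assumes "X \<in> obj C" "Y \<in> obj C"
  shows "iso (c X Y)" "arrow (c X Y)" "src (c X Y) = X \<odot> Y" "trg (c X Y) = Y \<odot> X"
  using iso_of_isomorphism[OF _ _ c_iso] assms by auto

lemma c_nat: "\<lbrakk>arrow f; arrow g; src f = X; src g = Y; trg f = X'; trg g = Y'\<rbrakk>
    \<Longrightarrow> c X' Y' \<cdot> (f \<otimes> g) = (g \<otimes> f) \<cdot> c X Y"
  by (rule c_natural) (auto simp: Hom_iff_arrow)

lemma hex_right: "\<lbrakk>X \<in> obj C; Y \<in> obj C; Z \<in> obj C\<rbrakk> \<Longrightarrow>
    assoc C Y Z X \<cdot> c X (Y \<odot> Z) \<cdot> assoc C X Y Z =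
      (idt C Y \<otimes> c X Z) \<cdot> assoc C Y X Z \<cdot> (c X Y \<otimes> idt C Z)"
  using c_hexagons by (simp add: hexagons_def)

lemma hex_left: "\<lbrakk>X \<in> obj C; Y \<in> obj C; Z \<in> obj C\<rbrakk> \<Longrightarrow>
    iassoc C Z X Y \<cdot> c (X \<odot> Y) Z \<cdot> iassoc C X Y Z =
      (c X Z \<otimes> idt C Y) \<cdot> iassoc C X Z Y \<cdot> (idt C X \<otimes> c Y Z)"
  using c_hexagons by (simp add: hexagons_def)

text \<open>The hexagons do not mention the unitors. In the one for X, \<one>, \<one>, naturality of
  c along \<open>runit C \<one>\<close> merges the two units, and what remains compares the unitors
  under \<one>.\<close>

lemma lunit_c:
  assumes [simp]: "X \<in> obj C"
  shows "lunit C X \<cdot> c X \<one> = runit C X"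
proof (rule lwhisker_unit_inj)
  show "idt C \<one> \<otimes> (lunit C X \<cdot> c X \<one>) = idt C \<one> \<otimes> runit C X"
  proof (rule iso_cancel_right[of "assoc C \<one> X \<one> \<cdot> (c X \<one> \<otimes> idt C \<one>)"])
    have "(idt C \<one> \<otimes> (lunit C X \<cdot> c X \<one>)) \<cdot> assoc C \<one> X \<one> \<cdot> (c X \<one> \<otimes> idt C \<one>)
      = (idt C \<one> \<otimes> lunit C X) \<cdot> (assoc C \<one> \<one> X \<cdot> c X (\<one> \<odot> \<one>) \<cdot> assoc C X \<one> \<one>)"
      unfolding hex_right[OF assms tunit_obj tunit_obj] by simp
    also have "\<dots> = ((idt C \<one> \<otimes> lunit C X) \<cdot> assoc C \<one> \<one> X) \<cdot> c X (\<one> \<odot> \<one>) \<cdot> assoc C X \<one> \<one>"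
      by simp
    also have "\<dots> = ((runit C \<one> \<otimes> idt C X) \<cdot> c X (\<one> \<odot> \<one>)) \<cdot> assoc C X \<one> \<one>"
      unfolding tri[OF tunit_obj assms] by simp
    also have "(runit C \<one> \<otimes> idt C X) \<cdot> c X (\<one> \<odot> \<one>) = c X \<one> \<cdot> (idt C X \<otimes> runit C \<one>)"
      by (rule c_nat[symmetric]) simp_all
    also have "(\<dots>) \<cdot> assoc C X \<one> \<one> = c X \<one> \<cdot> runit C (X \<odot> \<one>)"
      unfolding runit_tensor[OF assms tunit_obj, symmetric] by simp
    also have "\<dots> = runit C (\<one> \<odot> X) \<cdot> (c X \<one> \<otimes> idt C \<one>)"
      by (rule runit_nat[symmetric]) simp_all
    also have "\<dots> = (idt C \<one> \<otimes> runit C X) \<cdot> assoc C \<one> X \<one> \<cdot> (c X \<one> \<otimes> idt C \<one>)"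
      unfolding runit_tensor[OF tunit_obj assms, symmetric] by simp
    finally show "(idt C \<one> \<otimes> (lunit C X \<cdot> c X \<one>)) \<cdot> assoc C \<one> X \<one> \<cdot> (c X \<one> \<otimes> idt C \<one>) = \<dots>" .
  qed simp_all
qed simp_all

text \<open>The other hexagon is used, as c is not assumed symmetric: that \<open>c Y \<one>\<close>
  inverts \<open>c \<one> Y\<close> is deduced from this lemma and the previous one.\<close>

lemma runit_c:
  assumes [simp]: "X \<in> obj C"
  shows "runit C X \<cdot> c \<one> X = lunit C X"
proof (rule rwhisker_unit_inj)
  show "(runit C X \<cdot> c \<one> X) \<otimes> idt C \<one> = lunit C X \<otimes> idt C \<one>"
  proof (rule iso_cancel_right[of "iassoc C \<one> X \<one> \<cdot> (idt C \<one> \<otimes> c \<one> X)"])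
    have "((runit C X \<cdot> c \<one> X) \<otimes> idt C \<one>) \<cdot> iassoc C \<one> X \<one> \<cdot> (idt C \<one> \<otimes> c \<one> X)
      = (runit C X \<otimes> idt C \<one>) \<cdot> (iassoc C X \<one> \<one> \<cdot> c (\<one> \<odot> \<one>) X \<cdot> iassoc C \<one> \<one> X)"
      unfolding hex_left[OF tunit_obj tunit_obj assms] by simp
    also have "\<dots> = ((idt C X \<otimes> lunit C \<one>) \<cdot> c (\<one> \<odot> \<one>) X) \<cdot> iassoc C \<one> \<one> X"
      unfolding tri[OF assms tunit_obj, symmetric] by simp
    also have "(idt C X \<otimes> lunit C \<one>) \<cdot> c (\<one> \<odot> \<one>) X = c \<one> X \<cdot> (lunit C \<one> \<otimes> idt C X)"
      by (rule c_nat[symmetric]) simp_all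
    also have "(\<dots>) \<cdot> iassoc C \<one> \<one> X = c \<one> X \<cdot> lunit C (\<one> \<odot> X)"
      unfolding lunit_tensor[OF tunit_obj assms, symmetric] by simp
    also have "\<dots> = lunit C (X \<odot> \<one>) \<cdot> (idt C \<one> \<otimes> c \<one> X)"
      by (rule lunit_nat[symmetric]) simp_all
    also have "\<dots> = (lunit C X \<otimes> idt C \<one>) \<cdot> iassoc C \<one> X \<one> \<cdot> (idt C \<one> \<otimes> c \<one> X)"
      unfolding lunit_tensor[OF assms tunit_obj, symmetric] by simp
    finally show "((runit C X \<cdot> c \<one> X) \<otimes> idt C \<one>) \<cdot> iassoc C \<one> X \<one> \<cdot> (idt C \<one> \<otimes> c \<one> X) = \<dots>" .
  qed simp_all
qed simp_all

text \<open>Puts the unit into the symmetric center, where the equivalence with \<open>sVect\<close>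
  can be applied to it.\<close>

lemma tunit_transparent:
  assumes [simp]: "Y \<in> obj C"
  shows "c Y \<one> \<cdot> c \<one> Y = idt C (\<one> \<odot> Y)"
proof (rule iso_cancel_left[of "lunit C Y"])
  show "lunit C Y \<cdot> (c Y \<one> \<cdot> c \<one> Y) = lunit C Y \<cdot> idt C (\<one> \<odot> Y)"
    using cmp_extend[OF lunit_c[OF assms], of "c \<one> Y"] by (simp add: runit_c)
qed simp_all

text \<open>Naturality slides \<open>f\<close> through both crossings. Applied to \<xi>, this puts
  \<epsilon> \<odot> \<epsilon> into the symmetric center.\<close>

lemma transparent_iso:
  assumes "iso f" "src f = X" "trg f = X'" "Y \<in> obj C" "c Y X' \<cdot> c X' Y = idt C (X' \<odot> Y)"
  shows "c Y X \<cdot> c X Y = idt C (X \<odot> Y)"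
proof -
  note [simp] = assms(2-4) iso_arrow[OF assms(1)]
  have [simp]: "X \<in> obj C" "X' \<in> obj C"
    using arrow_obj[OF iso_arrow[OF assms(1)]] by simp_all
  show ?thesis
  proof (rule iso_cancel_left[of "f \<otimes> idt C Y"])
    have "(f \<otimes> idt C Y) \<cdot> c Y X \<cdot> c X Y = ((f \<otimes> idt C Y) \<cdot> c Y X) \<cdot> c X Y"
      by simp
    also have "(f \<otimes> idt C Y) \<cdot> c Y X = c Y X' \<cdot> (idt C Y \<otimes> f)"
      by (rule c_nat[symmetric]) simp_all
    also have "(\<dots>) \<cdot> c X Y = c Y X' \<cdot> ((idt C Y \<otimes> f) \<cdot> c X Y)"
      by simp
    also have "(idt C Y \<otimes> f) \<cdot> c X Y = c X' Y \<cdot> (f \<otimes> idt C Y)"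
      by (rule c_nat[symmetric]) simp_all
    also have "c Y X' \<cdot> \<dots> = f \<otimes> idt C Y"
      using cmp_extend[OF assms(5), of "f \<otimes> idt C Y"] by simp
    finally show "(f \<otimes> idt C Y) \<cdot> (c Y X \<cdot> c X Y) = (f \<otimes> idt C Y) \<cdot> idt C (X \<odot> Y)"
      by simp
  qed (use assms(1) in simp_all)
qed

end

section \<open>Tensoring with a transparent object that anticommutes with itself\<close>

text \<open>What the construction takes from slight degeneracy. Transparency will be membership of
  \<epsilon> in the symmetric center, and the equivalence with \<open>sVect\<close> is consulted for
  \<open>c_eps_eps\<close> alone.\<close>

locale fermion = braided_linear_category C c
  for C :: "('o, 'v::ab_group_add, 'k::field, 'z) linear_monoidal_data_scheme" (structure) and c +
  fixes \<epsilon> :: 'o and \<xi> :: "('o, 'v) arr"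
  assumes eps_obj [simp]: "\<epsilon> \<in> obj C"
    and eps_transparent: "X \<in> obj C \<Longrightarrow> c X \<epsilon> \<cdot> c \<epsilon> X = idt C (\<epsilon> \<odot> X)"
    and c_eps_eps: "c \<epsilon> \<epsilon> = neg_arr (idt C (\<epsilon> \<odot> \<epsilon>))"
    and arr_xi [simp]: "arrow \<xi>" "src \<xi> = \<epsilon> \<odot> \<epsilon>" "trg \<xi> = \<one>"
begin

abbreviation "\<mu> \<equiv> contract C \<epsilon> \<xi>"
abbreviation "m \<equiv> move_eps C c \<epsilon>"

lemma arr_mu [simp]:
  assumes "Z \<in> obj C"
  shows "arrow (\<mu> Z)" "src (\<mu> Z) = \<epsilon> \<odot> \<epsilon> \<odot> Z" "trg (\<mu> Z) = Z"
  using assms by (simp_all add: contract_def)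

lemma arr_m [simp]:
  assumes "Y \<in> obj C" "Z \<in> obj C"
  shows "arrow (m Y Z)" "src (m Y Z) = Y \<odot> \<epsilon> \<odot> Z" "trg (m Y Z) = \<epsilon> \<odot> Y \<odot> Z"
  using assms by (simp_all add: move_eps_def)

lemma mu_assoc: "Z \<in> obj C \<Longrightarrow> \<mu> Z \<cdot> assoc C \<epsilon> \<epsilon> Z = lunit C Z \<cdot> (\<xi> \<otimes> idt C Z)"
  by (simp add: contract_def)

lemma m_assoc: "\<lbrakk>Y \<in> obj C; Z \<in> obj C\<rbrakk> \<Longrightarrow>
    m Y Z \<cdot> assoc C Y \<epsilon> Z = assoc C \<epsilon> Y Z \<cdot> (c Y \<epsilon> \<otimes> idt C Z)"
  by (simp add: move_eps_def)

section \<open>Contraction and half braiding: naturality and coherence\<close>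

lemma mu_nat:
  assumes "arrow f" "src f = X" "trg f = Y"
  shows "\<mu> Y \<cdot> (idt C \<epsilon> \<otimes> (idt C \<epsilon> \<otimes> f)) = f \<cdot> \<mu> X"
proof -
  have [simp]: "X \<in> obj C" "Y \<in> obj C" using assms by auto
  note [simp] = assms
  have "\<mu> Y \<cdot> (idt C \<epsilon> \<otimes> (idt C \<epsilon> \<otimes> f))
    = (lunit C Y \<cdot> (\<xi> \<otimes> idt C Y)) \<cdot> (iassoc C \<epsilon> \<epsilon> Y \<cdot> (idt C \<epsilon> \<otimes> (idt C \<epsilon> \<otimes> f)))"
    by (simp add: contract_def)
  also have "iassoc C \<epsilon> \<epsilon> Y \<cdot> (idt C \<epsilon> \<otimes> (idt C \<epsilon> \<otimes> f))
    = ((idt C \<epsilon> \<otimes> idt C \<epsilon>) \<otimes> f) \<cdot> iassoc C \<epsilon> \<epsilon> X"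
    by (rule iassoc_nat) simp_all
  also have "(lunit C Y \<cdot> (\<xi> \<otimes> idt C Y)) \<cdot> \<dots>
    = (lunit C Y \<cdot> (idt C \<one> \<otimes> f)) \<cdot> (\<xi> \<otimes> idt C X) \<cdot> iassoc C \<epsilon> \<epsilon> X"
    by simp
  also have "lunit C Y \<cdot> (idt C \<one> \<otimes> f) = f \<cdot> lunit C X"
    by (rule lunit_nat) simp_all
  finally show ?thesis
    by (simp add: contract_def)
qed

lemma m_nat:
  assumes "arrow f" "arrow g" "src f = Y" "trg f = Y'" "src g = Z" "trg g = Z'"
  shows "m Y' Z' \<cdot> (f \<otimes> (idt C \<epsilon> \<otimes> g)) = (idt C \<epsilon> \<otimes> (f \<otimes> g)) \<cdot> m Y Z"
proof -
  have [simp]: "Y \<in> obj C" "Y' \<in> obj C" "Z \<in> obj C" "Z' \<in> obj C" using assms by auto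
  note [simp] = assms
  have "m Y' Z' \<cdot> (f \<otimes> (idt C \<epsilon> \<otimes> g))
    = (assoc C \<epsilon> Y' Z' \<cdot> (c Y' \<epsilon> \<otimes> idt C Z')) \<cdot> (iassoc C Y' \<epsilon> Z' \<cdot> (f \<otimes> (idt C \<epsilon> \<otimes> g)))"
    by (simp add: move_eps_def)
  also have "iassoc C Y' \<epsilon> Z' \<cdot> (f \<otimes> (idt C \<epsilon> \<otimes> g)) = ((f \<otimes> idt C \<epsilon>) \<otimes> g) \<cdot> iassoc C Y \<epsilon> Z"
    by (rule iassoc_nat) simp_all
  also have "(assoc C \<epsilon> Y' Z' \<cdot> (c Y' \<epsilon> \<otimes> idt C Z')) \<cdot> \<dots>
    = assoc C \<epsilon> Y' Z' \<cdot> ((c Y' \<epsilon> \<cdot> (f \<otimes> idt C \<epsilon>)) \<otimes> g) \<cdot> iassoc C Y \<epsilon> Z"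
    by simp
  also have "c Y' \<epsilon> \<cdot> (f \<otimes> idt C \<epsilon>) = (idt C \<epsilon> \<otimes> f) \<cdot> c Y \<epsilon>"
    by (rule c_nat) simp_all
  also have "assoc C \<epsilon> Y' Z' \<cdot> (((idt C \<epsilon> \<otimes> f) \<cdot> c Y \<epsilon>) \<otimes> g) \<cdot> iassoc C Y \<epsilon> Z
    = (assoc C \<epsilon> Y' Z' \<cdot> ((idt C \<epsilon> \<otimes> f) \<otimes> g)) \<cdot> (c Y \<epsilon> \<otimes> idt C Z) \<cdot> iassoc C Y \<epsilon> Z"
    by simp
  also have "assoc C \<epsilon> Y' Z' \<cdot> ((idt C \<epsilon> \<otimes> f) \<otimes> g) = (idt C \<epsilon> \<otimes> (f \<otimes> g)) \<cdot> assoc C \<epsilon> Y Z"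
    by (rule assoc_nat) simp_all
  finally show ?thesis
    by (simp add: move_eps_def)
qed

text \<open>The pentagon for \<epsilon>, \<epsilon>, Y, Z regroups the factors, \<xi> passes the
  associator by naturality, and \<open>lunit_tensor\<close> deals with the unit that is
  left.\<close>

lemma mu_assoc_tensor:
  assumes [simp]: "Y \<in> obj C" "Z \<in> obj C"
  shows "\<mu> (Y \<odot> Z) \<cdot> (idt C \<epsilon> \<otimes> assoc C \<epsilon> Y Z) \<cdot> assoc C \<epsilon> (\<epsilon> \<odot> Y) Z = \<mu> Y \<otimes> idt C Z"
proof (rule iso_cancel_right[of "assoc C \<epsilon> \<epsilon> Y \<otimes> idt C Z"])
  have "(\<mu> (Y \<odot> Z) \<cdot> (idt C \<epsilon> \<otimes> assoc C \<epsilon> Y Z) \<cdot> assoc C \<epsilon> (\<epsilon> \<odot> Y) Z) \<cdot> (assoc C \<epsilon> \<epsilon> Y \<otimes> idt C Z)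
    = \<mu> (Y \<odot> Z) \<cdot> ((idt C \<epsilon> \<otimes> assoc C \<epsilon> Y Z) \<cdot> assoc C \<epsilon> (\<epsilon> \<odot> Y) Z \<cdot> (assoc C \<epsilon> \<epsilon> Y \<otimes> idt C Z))"
    by simp
  also have "\<dots> = (\<mu> (Y \<odot> Z) \<cdot> assoc C \<epsilon> \<epsilon> (Y \<odot> Z)) \<cdot> assoc C (\<epsilon> \<odot> \<epsilon>) Y Z"
    unfolding pent[OF eps_obj eps_obj assms, symmetric] by simp
  also have "\<dots> = lunit C (Y \<odot> Z) \<cdot> ((\<xi> \<otimes> (idt C Y \<otimes> idt C Z)) \<cdot> assoc C (\<epsilon> \<odot> \<epsilon>) Y Z)"
    by (simp add: mu_assoc)
  also have "(\<xi> \<otimes> (idt C Y \<otimes> idt C Z)) \<cdot> assoc C (\<epsilon> \<odot> \<epsilon>) Y Z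
    = assoc C \<one> Y Z \<cdot> ((\<xi> \<otimes> idt C Y) \<otimes> idt C Z)"
    by (rule assoc_nat[symmetric]) simp_all
  also have "lunit C (Y \<odot> Z) \<cdot> \<dots> = (lunit C (Y \<odot> Z) \<cdot> assoc C \<one> Y Z) \<cdot> ((\<xi> \<otimes> idt C Y) \<otimes> idt C Z)"
    by simp
  also have "\<dots> = (\<mu> Y \<cdot> assoc C \<epsilon> \<epsilon> Y) \<otimes> idt C Z"
    unfolding lunit_tensor[OF assms] mu_assoc[OF assms(1)] by simp
  finally show "(\<mu> (Y \<odot> Z) \<cdot> (idt C \<epsilon> \<otimes> assoc C \<epsilon> Y Z) \<cdot> assoc C \<epsilon> (\<epsilon> \<odot> Y) Z) \<cdot> (assoc C \<epsilon> \<epsilon> Y \<otimes> idt C Z)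
    = (\<mu> Y \<otimes> idt C Z) \<cdot> (assoc C \<epsilon> \<epsilon> Y \<otimes> idt C Z)"
    by simp
qed simp_all

text \<open>The two sides differ by the braiding of \<open>\<epsilon>\<close> with \<open>\<epsilon> \<odot> \<epsilon>\<close>, in which the two signs of
  \<open>c \<epsilon> \<epsilon>\<close> cancel.\<close>

lemma xi_assoc: "lunit C \<epsilon> \<cdot> (\<xi> \<otimes> idt C \<epsilon>) = runit C \<epsilon> \<cdot> (idt C \<epsilon> \<otimes> \<xi>) \<cdot> assoc C \<epsilon> \<epsilon> \<epsilon>"
proof -
  have "assoc C \<epsilon> \<epsilon> \<epsilon> \<cdot> (c \<epsilon> (\<epsilon> \<odot> \<epsilon>) \<cdot> assoc C \<epsilon> \<epsilon> \<epsilon>) = assoc C \<epsilon> \<epsilon> \<epsilon> \<cdot> idt C ((\<epsilon> \<odot> \<epsilon>) \<odot> \<epsilon>)"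
    unfolding hex_right[OF eps_obj eps_obj eps_obj] by (simp add: c_eps_eps)
  then have *: "c \<epsilon> (\<epsilon> \<odot> \<epsilon>) \<cdot> assoc C \<epsilon> \<epsilon> \<epsilon> = idt C ((\<epsilon> \<odot> \<epsilon>) \<odot> \<epsilon>)"
    by (rule iso_cancel_left[rotated -1]) simp_all
  have "runit C \<epsilon> \<cdot> (idt C \<epsilon> \<otimes> \<xi>) \<cdot> assoc C \<epsilon> \<epsilon> \<epsilon>
    = lunit C \<epsilon> \<cdot> (c \<epsilon> \<one> \<cdot> (idt C \<epsilon> \<otimes> \<xi>)) \<cdot> assoc C \<epsilon> \<epsilon> \<epsilon>"
    unfolding lunit_c[OF eps_obj, symmetric] by simp
  also have "c \<epsilon> \<one> \<cdot> (idt C \<epsilon> \<otimes> \<xi>) = (\<xi> \<otimes> idt C \<epsilon>) \<cdot> c \<epsilon> (\<epsilon> \<odot> \<epsilon>)"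
    by (rule c_nat) simp_all
  finally show ?thesis
    by (simp add: *)
qed

text \<open>Of three copies of \<epsilon> in front of Z, contract the last two or the first two.
  Pentagon, triangle and \<open>lunit_tensor\<close> reduce the comparison to
  \<open>xi_assoc\<close> tensored with Z. This is what makes composition of three odd arrows
  associative.\<close>

lemma eps_mu:
  assumes [simp]: "Z \<in> obj C"
  shows "idt C \<epsilon> \<otimes> \<mu> Z = \<mu> (\<epsilon> \<odot> Z)"
proof (rule iso_cancel_right[of "assoc C \<epsilon> \<epsilon> (\<epsilon> \<odot> Z) \<cdot> assoc C (\<epsilon> \<odot> \<epsilon>) \<epsilon> Z"])
  have "(idt C \<epsilon> \<otimes> \<mu> Z) \<cdot> assoc C \<epsilon> \<epsilon> (\<epsilon> \<odot> Z) \<cdot> assoc C (\<epsilon> \<odot> \<epsilon>) \<epsilon> Z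
    = (idt C \<epsilon> \<otimes> (\<mu> Z \<cdot> assoc C \<epsilon> \<epsilon> Z)) \<cdot> assoc C \<epsilon> (\<epsilon> \<odot> \<epsilon>) Z \<cdot> (assoc C \<epsilon> \<epsilon> \<epsilon> \<otimes> idt C Z)"
    unfolding pent[OF eps_obj eps_obj eps_obj assms] by simp
  also have "\<dots> = (idt C \<epsilon> \<otimes> lunit C Z) \<cdot> ((idt C \<epsilon> \<otimes> (\<xi> \<otimes> idt C Z)) \<cdot> assoc C \<epsilon> (\<epsilon> \<odot> \<epsilon>) Z)
      \<cdot> (assoc C \<epsilon> \<epsilon> \<epsilon> \<otimes> idt C Z)"
    unfolding mu_assoc[OF assms] by simp
  also have "(idt C \<epsilon> \<otimes> (\<xi> \<otimes> idt C Z)) \<cdot> assoc C \<epsilon> (\<epsilon> \<odot> \<epsilon>) Z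
    = assoc C \<epsilon> \<one> Z \<cdot> ((idt C \<epsilon> \<otimes> \<xi>) \<otimes> idt C Z)"
    by (rule assoc_nat[symmetric]) simp_all
  also have "(idt C \<epsilon> \<otimes> lunit C Z) \<cdot> (\<dots>) \<cdot> (assoc C \<epsilon> \<epsilon> \<epsilon> \<otimes> idt C Z)
    = ((idt C \<epsilon> \<otimes> lunit C Z) \<cdot> assoc C \<epsilon> \<one> Z) \<cdot> (((idt C \<epsilon> \<otimes> \<xi>) \<cdot> assoc C \<epsilon> \<epsilon> \<epsilon>) \<otimes> idt C Z)"
    by simp
  also have "\<dots> = (lunit C \<epsilon> \<cdot> (\<xi> \<otimes> idt C \<epsilon>)) \<otimes> idt C Z"
    unfolding tri[OF eps_obj assms] xi_assoc by simp
  also have "\<dots> = lunit C (\<epsilon> \<odot> Z) \<cdot> (assoc C \<one> \<epsilon> Z \<cdot> ((\<xi> \<otimes> idt C \<epsilon>) \<otimes> idt C Z))"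
    using cmp_extend[OF lunit_tensor[OF eps_obj assms], of "(\<xi> \<otimes> idt C \<epsilon>) \<otimes> idt C Z"] by simp
  also have "assoc C \<one> \<epsilon> Z \<cdot> ((\<xi> \<otimes> idt C \<epsilon>) \<otimes> idt C Z)
    = (\<xi> \<otimes> (idt C \<epsilon> \<otimes> idt C Z)) \<cdot> assoc C (\<epsilon> \<odot> \<epsilon>) \<epsilon> Z"
    by (rule assoc_nat) simp_all
  also have "lunit C (\<epsilon> \<odot> Z) \<cdot> \<dots> = (\<mu> (\<epsilon> \<odot> Z) \<cdot> assoc C \<epsilon> \<epsilon> (\<epsilon> \<odot> Z)) \<cdot> assoc C (\<epsilon> \<odot> \<epsilon>) \<epsilon> Z"
    by (simp add: mu_assoc)
  finally show "(idt C \<epsilon> \<otimes> \<mu> Z) \<cdot> assoc C \<epsilon> \<epsilon> (\<epsilon> \<odot> Z) \<cdot> assoc C (\<epsilon> \<odot> \<epsilon>) \<epsilon> Z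
    = \<mu> (\<epsilon> \<odot> Z) \<cdot> assoc C \<epsilon> \<epsilon> (\<epsilon> \<odot> Z) \<cdot> assoc C (\<epsilon> \<odot> \<epsilon>) \<epsilon> Z"
    by simp
qed simp_all

text \<open>Rewrites a half braiding under X as a braiding acting on the factors in front of Z,
  where the hexagons apply.\<close>

lemma eps_m_assoc:
  assumes [simp]: "X \<in> obj C" "Y \<in> obj C" "Z \<in> obj C"
  shows "(idt C X \<otimes> m Y Z) \<cdot> assoc C X Y (\<epsilon> \<odot> Z) \<cdot> assoc C (X \<odot> Y) \<epsilon> Z
    = (idt C X \<otimes> assoc C \<epsilon> Y Z) \<cdot> assoc C X (\<epsilon> \<odot> Y) Z \<cdot> (((idt C X \<otimes> c Y \<epsilon>) \<cdot> assoc C X Y \<epsilon>) \<otimes> idt C Z)"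
proof -
  have "(idt C X \<otimes> m Y Z) \<cdot> assoc C X Y (\<epsilon> \<odot> Z) \<cdot> assoc C (X \<odot> Y) \<epsilon> Z
    = (idt C X \<otimes> (m Y Z \<cdot> assoc C Y \<epsilon> Z)) \<cdot> assoc C X (Y \<odot> \<epsilon>) Z \<cdot> (assoc C X Y \<epsilon> \<otimes> idt C Z)"
    unfolding pent[OF assms(1,2) eps_obj assms(3)] by simp
  also have "\<dots> = (idt C X \<otimes> assoc C \<epsilon> Y Z)
      \<cdot> ((idt C X \<otimes> (c Y \<epsilon> \<otimes> idt C Z)) \<cdot> assoc C X (Y \<odot> \<epsilon>) Z) \<cdot> (assoc C X Y \<epsilon> \<otimes> idt C Z)"
    unfolding m_assoc[OF assms(2,3)] by simp
  also have "(idt C X \<otimes> (c Y \<epsilon> \<otimes> idt C Z)) \<cdot> assoc C X (Y \<odot> \<epsilon>) Z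
    = assoc C X (\<epsilon> \<odot> Y) Z \<cdot> ((idt C X \<otimes> c Y \<epsilon>) \<otimes> idt C Z)"
    by (rule assoc_nat[symmetric]) simp_all
  finally show ?thesis
    by simp
qed

text \<open>By the hexagon, moving two copies of \<epsilon> past Y in turn is braiding Y with
  \<epsilon> \<odot> \<epsilon>. Naturality along \<xi> replaces this by the braiding with \<one>,
  which \<open>lunit_c\<close> absorbs into the unitors. The copies keep their order, so no sign
  appears.\<close>

lemma m_m_mu:
  assumes [simp]: "Y \<in> obj C" "Z \<in> obj C"
  shows "\<mu> (Y \<odot> Z) \<cdot> (idt C \<epsilon> \<otimes> m Y Z) \<cdot> m Y (\<epsilon> \<odot> Z) = idt C Y \<otimes> \<mu> Z"
\<comment> \<open>Groups Y with both copies of \<epsilon> and leaves Z outermost, so that the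
  hexagon acts in the first factor.\<close>
proof (rule iso_cancel_right[of "assoc C Y \<epsilon> (\<epsilon> \<odot> Z) \<cdot> assoc C (Y \<odot> \<epsilon>) \<epsilon> Z"])
  have "(\<mu> (Y \<odot> Z) \<cdot> (idt C \<epsilon> \<otimes> m Y Z) \<cdot> m Y (\<epsilon> \<odot> Z)) \<cdot> assoc C Y \<epsilon> (\<epsilon> \<odot> Z) \<cdot> assoc C (Y \<odot> \<epsilon>) \<epsilon> Z
    = (\<mu> (Y \<odot> Z) \<cdot> (idt C \<epsilon> \<otimes> m Y Z)) \<cdot> (m Y (\<epsilon> \<odot> Z) \<cdot> assoc C Y \<epsilon> (\<epsilon> \<odot> Z)) \<cdot> assoc C (Y \<odot> \<epsilon>) \<epsilon> Z"
    by simp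
  also have "\<dots> = (\<mu> (Y \<odot> Z) \<cdot> (idt C \<epsilon> \<otimes> m Y Z) \<cdot> assoc C \<epsilon> Y (\<epsilon> \<odot> Z))
      \<cdot> ((c Y \<epsilon> \<otimes> (idt C \<epsilon> \<otimes> idt C Z)) \<cdot> assoc C (Y \<odot> \<epsilon>) \<epsilon> Z)"
    by (simp add: m_assoc)
  also have "(c Y \<epsilon> \<otimes> (idt C \<epsilon> \<otimes> idt C Z)) \<cdot> assoc C (Y \<odot> \<epsilon>) \<epsilon> Z
    = assoc C (\<epsilon> \<odot> Y) \<epsilon> Z \<cdot> ((c Y \<epsilon> \<otimes> idt C \<epsilon>) \<otimes> idt C Z)"
    by (rule assoc_nat[symmetric]) simp_all
  also have "(\<mu> (Y \<odot> Z) \<cdot> (idt C \<epsilon> \<otimes> m Y Z) \<cdot> assoc C \<epsilon> Y (\<epsilon> \<odot> Z)) \<cdot> \<dots>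
    = \<mu> (Y \<odot> Z) \<cdot> ((idt C \<epsilon> \<otimes> m Y Z) \<cdot> assoc C \<epsilon> Y (\<epsilon> \<odot> Z) \<cdot> assoc C (\<epsilon> \<odot> Y) \<epsilon> Z)
      \<cdot> ((c Y \<epsilon> \<otimes> idt C \<epsilon>) \<otimes> idt C Z)"
    by simp
  also have "\<dots> = (\<mu> (Y \<odot> Z) \<cdot> (idt C \<epsilon> \<otimes> assoc C \<epsilon> Y Z) \<cdot> assoc C \<epsilon> (\<epsilon> \<odot> Y) Z)
      \<cdot> (((idt C \<epsilon> \<otimes> c Y \<epsilon>) \<cdot> assoc C \<epsilon> Y \<epsilon> \<cdot> (c Y \<epsilon> \<otimes> idt C \<epsilon>)) \<otimes> idt C Z)"
    unfolding eps_m_assoc[OF eps_obj assms] by simp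
  also have "\<dots> = ((\<mu> Y \<cdot> assoc C \<epsilon> \<epsilon> Y) \<cdot> c Y (\<epsilon> \<odot> \<epsilon>) \<cdot> assoc C Y \<epsilon> \<epsilon>) \<otimes> idt C Z"
    unfolding hex_right[OF assms(1) eps_obj eps_obj, symmetric] mu_assoc_tensor[OF assms] by simp
  also have "(\<mu> Y \<cdot> assoc C \<epsilon> \<epsilon> Y) \<cdot> c Y (\<epsilon> \<odot> \<epsilon>) \<cdot> assoc C Y \<epsilon> \<epsilon>
    = lunit C Y \<cdot> ((\<xi> \<otimes> idt C Y) \<cdot> c Y (\<epsilon> \<odot> \<epsilon>)) \<cdot> assoc C Y \<epsilon> \<epsilon>"
    unfolding mu_assoc[OF assms(1)] by simp
  also have "(\<xi> \<otimes> idt C Y) \<cdot> c Y (\<epsilon> \<odot> \<epsilon>) = c Y \<one> \<cdot> (idt C Y \<otimes> \<xi>)"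
    by (rule c_nat[symmetric]) simp_all
  also have "lunit C Y \<cdot> (\<dots>) \<cdot> assoc C Y \<epsilon> \<epsilon> = runit C Y \<cdot> (idt C Y \<otimes> \<xi>) \<cdot> assoc C Y \<epsilon> \<epsilon>"
    unfolding lunit_c[OF assms(1), symmetric] by simp
  also have "(\<dots>) \<otimes> idt C Z = (idt C Y \<otimes> lunit C Z) \<cdot> (assoc C Y \<one> Z \<cdot> ((idt C Y \<otimes> \<xi>) \<otimes> idt C Z))
      \<cdot> (assoc C Y \<epsilon> \<epsilon> \<otimes> idt C Z)"
    using cmp_extend[OF tri[OF assms], of "((idt C Y \<otimes> \<xi>) \<cdot> assoc C Y \<epsilon> \<epsilon>) \<otimes> idt C Z"] by simp
  also have "assoc C Y \<one> Z \<cdot> ((idt C Y \<otimes> \<xi>) \<otimes> idt C Z)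
    = (idt C Y \<otimes> (\<xi> \<otimes> idt C Z)) \<cdot> assoc C Y (\<epsilon> \<odot> \<epsilon>) Z"
    by (rule assoc_nat) simp_all
  also have "(idt C Y \<otimes> lunit C Z) \<cdot> (\<dots>) \<cdot> (assoc C Y \<epsilon> \<epsilon> \<otimes> idt C Z)
    = (idt C Y \<otimes> \<mu> Z) \<cdot> assoc C Y \<epsilon> (\<epsilon> \<odot> Z) \<cdot> assoc C (Y \<odot> \<epsilon>) \<epsilon> Z"
    unfolding pent[OF assms(1) eps_obj eps_obj assms(2)] by (simp add: mu_assoc)
  finally show "(\<mu> (Y \<odot> Z) \<cdot> (idt C \<epsilon> \<otimes> m Y Z) \<cdot> m Y (\<epsilon> \<odot> Z)) \<cdot> assoc C Y \<epsilon> (\<epsilon> \<odot> Z) \<cdot> assoc C (Y \<odot> \<epsilon>) \<epsilon> Z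
    = \<dots>" .
qed simp_all

lemma c_tensor_eps:
  assumes [simp]: "X \<in> obj C" "Y \<in> obj C"
  shows "c (X \<odot> Y) \<epsilon> = m X Y \<cdot> (idt C X \<otimes> c Y \<epsilon>) \<cdot> assoc C X Y \<epsilon>"
proof -
  have "c (X \<odot> Y) \<epsilon>
    = assoc C \<epsilon> X Y \<cdot> (iassoc C \<epsilon> X Y \<cdot> c (X \<odot> Y) \<epsilon> \<cdot> iassoc C X Y \<epsilon>) \<cdot> assoc C X Y \<epsilon>"
    by simp
  then show ?thesis
    unfolding hex_left[OF assms eps_obj] by (simp add: move_eps_def)
qed

lemma m_eps: "Z \<in> obj C \<Longrightarrow> m \<epsilon> Z = neg_arr (idt C (\<epsilon> \<odot> \<epsilon> \<odot> Z))"
  by (simp add: move_eps_def c_eps_eps)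

text \<open>On the left the right-hand copy of \<epsilon> leaves first and has to cross the
  left-hand one, which costs the sign of \<open>m_eps\<close>. On the right the left-hand copy
  leaves first and the two never cross. This is the sign behind the super interchange law.\<close>

lemma assoc_m_swap:
  assumes [simp]: "Y \<in> obj C" "Z \<in> obj C"
  shows "(idt C \<epsilon> \<otimes> assoc C \<epsilon> Y Z) \<cdot> m (\<epsilon> \<odot> Y) Z = neg_arr ((idt C \<epsilon> \<otimes> m Y Z) \<cdot> assoc C \<epsilon> Y (\<epsilon> \<odot> Z))"
proof (rule iso_cancel_right[of "assoc C (\<epsilon> \<odot> Y) \<epsilon> Z"])
  have "((idt C \<epsilon> \<otimes> assoc C \<epsilon> Y Z) \<cdot> m (\<epsilon> \<odot> Y) Z) \<cdot> assoc C (\<epsilon> \<odot> Y) \<epsilon> Z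
    = (idt C \<epsilon> \<otimes> assoc C \<epsilon> Y Z) \<cdot> assoc C \<epsilon> (\<epsilon> \<odot> Y) Z \<cdot> (c (\<epsilon> \<odot> Y) \<epsilon> \<otimes> idt C Z)"
    by (simp add: m_assoc)
  also have "\<dots> = neg_arr ((idt C \<epsilon> \<otimes> assoc C \<epsilon> Y Z) \<cdot> assoc C \<epsilon> (\<epsilon> \<odot> Y) Z
      \<cdot> (((idt C \<epsilon> \<otimes> c Y \<epsilon>) \<cdot> assoc C \<epsilon> Y \<epsilon>) \<otimes> idt C Z))"
    unfolding c_tensor_eps[OF eps_obj assms(1)] by (simp add: m_eps)
  also have "\<dots> = neg_arr ((idt C \<epsilon> \<otimes> m Y Z) \<cdot> assoc C \<epsilon> Y (\<epsilon> \<odot> Z)) \<cdot> assoc C (\<epsilon> \<odot> Y) \<epsilon> Z"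
    unfolding eps_m_assoc[OF eps_obj assms, symmetric] by simp
  finally show "((idt C \<epsilon> \<otimes> assoc C \<epsilon> Y Z) \<cdot> m (\<epsilon> \<odot> Y) Z) \<cdot> assoc C (\<epsilon> \<odot> Y) \<epsilon> Z = \<dots>" .
qed simp_all

text \<open>Here and in the next lemma \<epsilon> is pulled out of the middle or the last of three
  factors under either bracketing, as supernaturality of the associator requires. The middle case
  takes two pentagons, with \<epsilon> in first and in second place.\<close>

lemma assoc_m_middle:
  assumes [simp]: "X \<in> obj C" "Y \<in> obj C" "Z \<in> obj C"
  shows "(idt C \<epsilon> \<otimes> assoc C X Y Z) \<cdot> assoc C \<epsilon> (X \<odot> Y) Z \<cdot> (m X Y \<otimes> idt C Z)
    = m X (Y \<odot> Z) \<cdot> (idt C X \<otimes> assoc C \<epsilon> Y Z) \<cdot> assoc C X (\<epsilon> \<odot> Y) Z"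
proof (rule iso_cancel_right[of "assoc C X \<epsilon> Y \<otimes> idt C Z"])
  have "((idt C \<epsilon> \<otimes> assoc C X Y Z) \<cdot> assoc C \<epsilon> (X \<odot> Y) Z \<cdot> (m X Y \<otimes> idt C Z)) \<cdot> (assoc C X \<epsilon> Y \<otimes> idt C Z)
    = ((idt C \<epsilon> \<otimes> assoc C X Y Z) \<cdot> assoc C \<epsilon> (X \<odot> Y) Z \<cdot> (assoc C \<epsilon> X Y \<otimes> idt C Z))
      \<cdot> ((c X \<epsilon> \<otimes> idt C Y) \<otimes> idt C Z)"
    by (simp add: m_assoc)
  also have "\<dots> = assoc C \<epsilon> X (Y \<odot> Z) \<cdot> (assoc C (\<epsilon> \<odot> X) Y Z \<cdot> ((c X \<epsilon> \<otimes> idt C Y) \<otimes> idt C Z))"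
    unfolding pent[OF eps_obj assms, symmetric] by simp
  also have "assoc C (\<epsilon> \<odot> X) Y Z \<cdot> ((c X \<epsilon> \<otimes> idt C Y) \<otimes> idt C Z)
    = (c X \<epsilon> \<otimes> (idt C Y \<otimes> idt C Z)) \<cdot> assoc C (X \<odot> \<epsilon>) Y Z"
    by (rule assoc_nat) simp_all
  also have "assoc C \<epsilon> X (Y \<odot> Z) \<cdot> \<dots> = m X (Y \<odot> Z) \<cdot> assoc C X \<epsilon> (Y \<odot> Z) \<cdot> assoc C (X \<odot> \<epsilon>) Y Z"
    using cmp_extend[OF m_assoc[of X "Y \<odot> Z"], of "assoc C (X \<odot> \<epsilon>) Y Z"] by simp
  also have "\<dots> = (m X (Y \<odot> Z) \<cdot> (idt C X \<otimes> assoc C \<epsilon> Y Z) \<cdot> assoc C X (\<epsilon> \<odot> Y) Z) \<cdot> (assoc C X \<epsilon> Y \<otimes> idt C Z)"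
    unfolding pent[OF assms(1) eps_obj assms(2,3)] by simp
  finally show "((idt C \<epsilon> \<otimes> assoc C X Y Z) \<cdot> assoc C \<epsilon> (X \<odot> Y) Z \<cdot> (m X Y \<otimes> idt C Z)) \<cdot> (assoc C X \<epsilon> Y \<otimes> idt C Z)
    = \<dots>" .
qed simp_all

text \<open>Passing X \<odot> Y amounts to passing Y and then X, by \<open>c_tensor_eps\<close>, and
  the second passage is covered by \<open>assoc_m_middle\<close>.\<close>

lemma assoc_m_right:
  assumes [simp]: "X \<in> obj C" "Y \<in> obj C" "Z \<in> obj C"
  shows "(idt C \<epsilon> \<otimes> assoc C X Y Z) \<cdot> m (X \<odot> Y) Z
    = m X (Y \<odot> Z) \<cdot> (idt C X \<otimes> m Y Z) \<cdot> assoc C X Y (\<epsilon> \<odot> Z)"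
proof (rule iso_cancel_right[of "assoc C (X \<odot> Y) \<epsilon> Z"])
  have "((idt C \<epsilon> \<otimes> assoc C X Y Z) \<cdot> m (X \<odot> Y) Z) \<cdot> assoc C (X \<odot> Y) \<epsilon> Z
    = ((idt C \<epsilon> \<otimes> assoc C X Y Z) \<cdot> assoc C \<epsilon> (X \<odot> Y) Z \<cdot> (m X Y \<otimes> idt C Z))
      \<cdot> (((idt C X \<otimes> c Y \<epsilon>) \<cdot> assoc C X Y \<epsilon>) \<otimes> idt C Z)"
    by (simp add: m_assoc c_tensor_eps)
  also have "\<dots> = m X (Y \<odot> Z) \<cdot> ((idt C X \<otimes> assoc C \<epsilon> Y Z) \<cdot> assoc C X (\<epsilon> \<odot> Y) Z
      \<cdot> (((idt C X \<otimes> c Y \<epsilon>) \<cdot> assoc C X Y \<epsilon>) \<otimes> idt C Z))"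
    unfolding assoc_m_middle[OF assms] by simp
  also have "\<dots> = (m X (Y \<odot> Z) \<cdot> (idt C X \<otimes> m Y Z) \<cdot> assoc C X Y (\<epsilon> \<odot> Z)) \<cdot> assoc C (X \<odot> Y) \<epsilon> Z"
    unfolding eps_m_assoc[OF assms, symmetric] by simp
  finally show "((idt C \<epsilon> \<otimes> assoc C X Y Z) \<cdot> m (X \<odot> Y) Z) \<cdot> assoc C (X \<odot> Y) \<epsilon> Z = \<dots>" .
qed simp_all

lemma lunit_m:
  assumes [simp]: "Y \<in> obj C"
  shows "(idt C \<epsilon> \<otimes> lunit C Y) \<cdot> m \<one> Y = lunit C (\<epsilon> \<odot> Y)"
proof (rule iso_cancel_right[of "assoc C \<one> \<epsilon> Y"])
  have "((idt C \<epsilon> \<otimes> lunit C Y) \<cdot> m \<one> Y) \<cdot> assoc C \<one> \<epsilon> Y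
    = ((idt C \<epsilon> \<otimes> lunit C Y) \<cdot> assoc C \<epsilon> \<one> Y) \<cdot> (c \<one> \<epsilon> \<otimes> idt C Y)"
    by (simp add: m_assoc)
  then show "((idt C \<epsilon> \<otimes> lunit C Y) \<cdot> m \<one> Y) \<cdot> assoc C \<one> \<epsilon> Y = lunit C (\<epsilon> \<odot> Y) \<cdot> assoc C \<one> \<epsilon> Y"
    by (simp add: tri runit_c lunit_tensor)
qed simp_all

text \<open>Transparency is spent here: the braiding of \<epsilon> \<odot> Y with Z contains
  \<open>c \<epsilon> Z\<close>, and \<open>m\<close> brings \<epsilon> back to the front by
  \<open>c Z \<epsilon>\<close>, so a double braiding cancels.\<close>

lemma c_assoc:
  assumes [simp]: "Y \<in> obj C" "Z \<in> obj C"
  shows "(idt C \<epsilon> \<otimes> c Y Z) \<cdot> assoc C \<epsilon> Y Z = m Z Y \<cdot> c (\<epsilon> \<odot> Y) Z"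
proof -
  have "m Z Y \<cdot> c (\<epsilon> \<odot> Y) Z = assoc C \<epsilon> Z Y \<cdot> (c Z \<epsilon> \<otimes> idt C Y)
      \<cdot> (iassoc C Z \<epsilon> Y \<cdot> c (\<epsilon> \<odot> Y) Z \<cdot> iassoc C \<epsilon> Y Z) \<cdot> assoc C \<epsilon> Y Z"
    by (simp add: move_eps_def)
  then show ?thesis
    unfolding hex_left[OF eps_obj assms] by (simp add: eps_transparent)
qed

text \<open>In the second argument both sides contain \<open>c Y \<epsilon>\<close> in the same
  direction, and the first hexagon gives the equation.\<close>

lemma c_m:
  assumes [simp]: "Y \<in> obj C" "Z \<in> obj C"
  shows "(idt C \<epsilon> \<otimes> c Y Z) \<cdot> m Y Z = assoc C \<epsilon> Z Y \<cdot> c Y (\<epsilon> \<odot> Z)"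
proof -
  have "assoc C \<epsilon> Z Y \<cdot> c Y (\<epsilon> \<odot> Z)
    = (assoc C \<epsilon> Z Y \<cdot> c Y (\<epsilon> \<odot> Z) \<cdot> assoc C Y \<epsilon> Z) \<cdot> iassoc C Y \<epsilon> Z"
    by simp
  then show ?thesis
    unfolding hex_right[OF assms(1) eps_obj assms(2)] by (simp add: move_eps_def)
qed

section \<open>Arrows of arbitrary parity\<close>

text \<open>Parities stay sums, normalised as in a commutative monoid, so that the degree of a
  composite matches the \<open>p + q\<close> in the target of \<open>M\<close>.\<close>

declare add_bit_eq_xor [simp del]

lemmas bit_add_ac [simp] =
  add.assoc[where 'a = bit] add.commute[where 'a = bit] add.left_commute[where 'a = bit]

text \<open>\<open>pw\<close> and \<open>T\<close> are tensoring on the left with \<open>\<epsilon>\<close> to the power \<open>p\<close>; \<open>M\<close>, \<open>L\<close>, \<open>R\<close> multiply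
  two such powers, and pull one out of the left or the right tensor factor.\<close>

definition pw :: "bit \<Rightarrow> 'o \<Rightarrow> 'o"
  where "pw p X = (if p = 0 then X else \<epsilon> \<odot> X)"

definition T :: "bit \<Rightarrow> ('o, 'v) arr \<Rightarrow> ('o, 'v) arr"
  where "T p f = (if p = 0 then f else idt C \<epsilon> \<otimes> f)"

definition M :: "bit \<Rightarrow> bit \<Rightarrow> 'o \<Rightarrow> ('o, 'v) arr"
  where "M p q Z = (if p = 1 \<and> q = 1 then \<mu> Z else idt C (pw (p + q) Z))"

definition L :: "bit \<Rightarrow> 'o \<Rightarrow> 'o \<Rightarrow> ('o, 'v) arr"
  where "L p Y Z = (if p = 0 then idt C (Y \<odot> Z) else assoc C \<epsilon> Y Z)"

definition R :: "bit \<Rightarrow> 'o \<Rightarrow> 'o \<Rightarrow> ('o, 'v) arr"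
  where "R p Y Z = (if p = 0 then idt C (Y \<odot> Z) else m Y Z)"

text \<open>The counterpart of \<open>sgn_twist\<close> for arrows of C; \<open>repr\<close> carries
  one to the other.\<close>

definition sg :: "bit \<Rightarrow> bit \<Rightarrow> ('o, 'v) arr \<Rightarrow> ('o, 'v) arr"
  where "sg p q f = (if p = 1 \<and> q = 1 then neg_arr f else f)"

lemma pw_simps [simp]: "pw 0 X = X" "X \<in> obj C \<Longrightarrow> pw p X \<in> obj C"
  by (simp_all add: pw_def)

lemma arr_T [simp]:
  assumes "arrow f"
  shows "arrow (T p f)" "src (T p f) = pw p (src f)" "trg (T p f) = pw p (trg f)"
  using assms by (simp_all add: T_def pw_def)

lemma T_simps [simp]:
  "T 0 f = f" "X \<in> obj C \<Longrightarrow> T p (idt C X) = idt C (pw p X)"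
  "\<lbrakk>arrow f; arrow g; src g = trg f\<rbrakk> \<Longrightarrow> T p (g \<cdot> f) = T p g \<cdot> T p f"
  "arrow f \<Longrightarrow> T p (neg_arr f) = neg_arr (T p f)"
  by (simp_all add: T_def pw_def)

lemma arr_M [simp]:
  assumes "Z \<in> obj C"
  shows "arrow (M p q Z)" "src (M p q Z) = pw p (pw q Z)" "trg (M p q Z) = pw (p + q) Z"
  using assms by (cases p; cases q; simp add: M_def pw_def)+

lemma M_zero [simp]: "M 0 q Z = idt C (pw q Z)" "M p 0 Z = idt C (pw p Z)"
  by (simp_all add: M_def)

lemma arr_L [simp]:
  assumes "Y \<in> obj C" "Z \<in> obj C"
  shows "arrow (L p Y Z)" "src (L p Y Z) = pw p Y \<odot> Z" "trg (L p Y Z) = pw p (Y \<odot> Z)"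
  using assms by (simp_all add: L_def pw_def)

lemma arr_R [simp]:
  assumes "Y \<in> obj C" "Z \<in> obj C"
  shows "arrow (R p Y Z)" "src (R p Y Z) = Y \<odot> pw p Z" "trg (R p Y Z) = pw p (Y \<odot> Z)"
  using assms by (simp_all add: R_def pw_def)

lemma LR_zero [simp]: "L 0 Y Z = idt C (Y \<odot> Z)" "R 0 Y Z = idt C (Y \<odot> Z)"
  by (simp_all add: L_def R_def)

lemma sg_zero [simp]: "sg 0 q f = f" "sg p 0 f = f"
  by (simp_all add: sg_def)

lemma arr_sg [simp]:
  assumes "arrow f"
  shows "arrow (sg p q f)" "src (sg p q f) = src f" "trg (sg p q f) = trg f" "T r (sg p q f) = sg p q (T r f)"
  using assms by (simp_all add: sg_def)

lemma sg_sg [simp]: "sg p q (sg p q f) = f"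
  by (simp add: sg_def)

lemma sg_cmp [simp]:
  assumes "arrow f" "arrow g" "src g = trg f"
  shows "g \<cdot> sg p q f = sg p q (g \<cdot> f)" "sg p q g \<cdot> f = sg p q (g \<cdot> f)"
  using assms by (simp_all add: sg_def)

section \<open>Laws of the structural arrows with parity as a variable\<close>

lemma M_nat:
  assumes "arrow f" "src f = X" "trg f = Y"
  shows "M p q Y \<cdot> T p (T q f) = T (p + q) f \<cdot> M p q X"
proof -
  have "X \<in> obj C" "Y \<in> obj C" using assms by auto
  with assms show ?thesis
    by (cases p; cases q) (simp_all add: M_def T_def pw_def mu_nat)
qed

text \<open>With all three parities odd this is \<open>eps_mu\<close>; otherwise at most one
  contraction occurs, the same on both sides.\<close>

lemma M_assoc:
  assumes "Z \<in> obj C"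
  shows "M p (q + r) Z \<cdot> T p (M q r Z) = M (p + q) r Z \<cdot> M p q (pw r Z)"
  using assms
  by (cases p; cases q; cases r)
    (simp_all add: M_def T_def pw_def eps_mu)

lemma L_nat:
  assumes "arrow f" "arrow g" "src f = Y" "trg f = Y'" "src g = Z" "trg g = Z'"
  shows "L p Y' Z' \<cdot> (T p f \<otimes> g) = T p (f \<otimes> g) \<cdot> L p Y Z"
proof -
  have "Y \<in> obj C" "Z \<in> obj C" "Y' \<in> obj C" "Z' \<in> obj C" using assms by auto
  with assms show ?thesis
    by (cases p) (simp_all add: L_def T_def assoc_nat)
qed

lemma R_nat:
  assumes "arrow f" "arrow g" "src f = Y" "trg f = Y'" "src g = Z" "trg g = Z'"
  shows "R p Y' Z' \<cdot> (f \<otimes> T p g) = T p (f \<otimes> g) \<cdot> R p Y Z"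
proof -
  have "Y \<in> obj C" "Z \<in> obj C" "Y' \<in> obj C" "Z' \<in> obj C" using assms by auto
  with assms show ?thesis
    by (cases p) (simp_all add: R_def T_def m_nat)
qed

lemma L_M:
  assumes "Y \<in> obj C" "Z \<in> obj C"
  shows "L (p + q) Y Z \<cdot> (M p q Y \<otimes> idt C Z) = M p q (Y \<odot> Z) \<cdot> T p (L q Y Z) \<cdot> L p (pw q Y) Z"
  using assms
  by (cases p; cases q)
    (simp_all add: L_def M_def T_def pw_def mu_assoc_tensor)

lemma R_M:
  assumes "Y \<in> obj C" "Z \<in> obj C"
  shows "R (p + q) Y Z \<cdot> (idt C Y \<otimes> M p q Z) = M p q (Y \<odot> Z) \<cdot> T p (R q Y Z) \<cdot> R p Y (pw q Z)"
  using assms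
  by (cases p; cases q)
    (simp_all add: R_def M_def T_def pw_def m_m_mu)

text \<open>Two odd copies reach the front in either order, which is \<open>assoc_m_swap\<close>; if
  one parity is even there is nothing to cross and \<open>sg\<close> is trivial.\<close>

lemma L_R_swap:
  assumes "Y \<in> obj C" "Z \<in> obj C"
  shows "M q p (Y \<odot> Z) \<cdot> T q (L p Y Z) \<cdot> R q (pw p Y) Z
    = sg p q (M p q (Y \<odot> Z) \<cdot> T p (R q Y Z) \<cdot> L p Y (pw q Z))"
  using assms
  by (cases p; cases q)
    (simp_all add: L_def R_def M_def T_def pw_def sg_def assoc_m_swap)

lemma assoc_L:
  "\<lbrakk>X \<in> obj C; Y \<in> obj C; Z \<in> obj C\<rbrakk> \<Longrightarrow>
    T p (assoc C X Y Z) \<cdot> L p (X \<odot> Y) Z \<cdot> (L p X Y \<otimes> idt C Z) = L p X (Y \<odot> Z) \<cdot> assoc C (pw p X) Y Z"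
  by (cases p) (simp_all add: L_def T_def pw_def pent)

lemma assoc_L_R:
  "\<lbrakk>X \<in> obj C; Y \<in> obj C; Z \<in> obj C\<rbrakk> \<Longrightarrow>
    T p (assoc C X Y Z) \<cdot> L p (X \<odot> Y) Z \<cdot> (R p X Y \<otimes> idt C Z)
      = R p X (Y \<odot> Z) \<cdot> (idt C X \<otimes> L p Y Z) \<cdot> assoc C X (pw p Y) Z"
  by (cases p) (simp_all add: L_def R_def T_def pw_def assoc_m_middle)

lemma assoc_R:
  "\<lbrakk>X \<in> obj C; Y \<in> obj C; Z \<in> obj C\<rbrakk> \<Longrightarrow>
    T p (assoc C X Y Z) \<cdot> R p (X \<odot> Y) Z = R p X (Y \<odot> Z) \<cdot> (idt C X \<otimes> R p Y Z) \<cdot> assoc C X Y (pw p Z)"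
  by (cases p) (simp_all add: R_def T_def pw_def assoc_m_right)

lemma lunit_R: "Y \<in> obj C \<Longrightarrow> T p (lunit C Y) \<cdot> R p \<one> Y = lunit C (pw p Y)"
  by (cases p) (simp_all add: R_def T_def pw_def lunit_m)

lemma runit_L: "Y \<in> obj C \<Longrightarrow> T p (runit C Y) \<cdot> L p Y \<one> = runit C (pw p Y)"
  by (cases p) (simp_all add: L_def T_def pw_def runit_tensor)

lemma c_L: "\<lbrakk>Y \<in> obj C; Z \<in> obj C\<rbrakk> \<Longrightarrow> T p (c Y Z) \<cdot> L p Y Z = R p Z Y \<cdot> c (pw p Y) Z"
  by (cases p) (simp_all add: L_def R_def T_def pw_def c_assoc)

lemma c_R: "\<lbrakk>Y \<in> obj C; Z \<in> obj C\<rbrakk> \<Longrightarrow> T p (c Y Z) \<cdot> R p Y Z = L p Z Y \<cdot> c Y (pw p Z)"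
  by (cases p) (simp_all add: L_def R_def T_def pw_def c_m)

text \<open>Linearity is a statement about values, but operations act on arrows. Recording also
  where the result lands makes such operations composable, so that bilinearity of composition and
  tensor product can be read off their formulas.\<close>

definition linear_op :: "'o \<Rightarrow> 'o \<Rightarrow> 'o \<Rightarrow> 'o \<Rightarrow> (('o, 'v) arr \<Rightarrow> ('o, 'v) arr) \<Rightarrow> bool"
  where "linear_op X Y X' Y' \<Phi> \<longleftrightarrow>
    (\<forall>f. arrow f \<and> src f = X \<and> trg f = Y \<longrightarrow> arrow (\<Phi> f) \<and> src (\<Phi> f) = X' \<and> trg (\<Phi> f) = Y') \<and>
    linear_on (scl C) (scl C) (homspace C X Y) (\<lambda>v. val (\<Phi> (Arr X Y v)))"

lemma linear_op_id: "linear_op X Y X Y (\<lambda>f. f)"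
  by (simp add: linear_op_def linear_on_def)

lemma linear_op_comp:
  assumes "X \<in> obj C" "Y \<in> obj C" "linear_op X Y X' Y' \<Phi>" "linear_op X' Y' X'' Y'' \<Psi>"
  shows "linear_op X Y X'' Y'' (\<lambda>f. \<Psi> (\<Phi> f))"
proof -
  \<comment> \<open>Both operations are read on values. An arrow of known type is recovered from its
    value, so the composite operation becomes \<psi> after \<phi>.\<close>
  define \<phi> where "\<phi> v = val (\<Phi> (Arr X Y v))" for v
  define \<psi> where "\<psi> w = val (\<Psi> (Arr X' Y' w))" for w
  have \<Phi>: "\<phi> v \<in> homspace C X' Y'" "val (\<Psi> (\<Phi> (Arr X Y v))) = \<psi> (\<phi> v)"
    if "v \<in> homspace C X Y" for v
  proof -
    have f: "arrow (\<Phi> (Arr X Y v))" "src (\<Phi> (Arr X Y v)) = X'" "trg (\<Phi> (Arr X Y v)) = Y'"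
      using assms(1-3) that unfolding linear_op_def by (simp_all add: arrow_Arr)
    then show "\<phi> v \<in> homspace C X' Y'"
      using arrow_val[OF f(1)] by (simp add: \<phi>_def)
    show "val (\<Psi> (\<Phi> (Arr X Y v))) = \<psi> (\<phi> v)"
      unfolding \<phi>_def \<psi>_def Arr_val[OF f(2,3)] ..
  qed
  have cl: "v + w \<in> homspace C X Y" "scl C a v \<in> homspace C X Y"
    if "v \<in> homspace C X Y" "w \<in> homspace C X Y" for v w a
    using that subspace_homspace[OF assms(1,2)] by (auto intro: subspace_add subspace_scale)
  have "linear_on (scl C) (scl C) (homspace C X Y) \<phi>" "linear_on (scl C) (scl C) (homspace C X' Y') \<psi>"
    using assms(3,4) unfolding linear_op_def \<phi>_def[abs_def] \<psi>_def[abs_def] by simp_all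
  then have "linear_on (scl C) (scl C) (homspace C X Y) (\<lambda>v. val (\<Psi> (\<Phi> (Arr X Y v))))"
    unfolding linear_on_def using \<Phi> cl by simp
  then show ?thesis
    using assms(3,4) unfolding linear_op_def by blast
qed

lemma linear_op_cmp:
  assumes "arrow g" "src g = Y" "trg g = Z" "X \<in> obj C"
  shows "linear_op X Y X Z (\<lambda>f. g \<cdot> f)" "linear_op Z X Y X (\<lambda>f. f \<cdot> g)"
  using assms cmp_linear_right[of X Y Z g] cmp_linear_left[of Y Z X g]
  by (auto simp: linear_op_def Hom_iff_arrow)

lemma linear_op_tensor:
  assumes "arrow g" "src g = X'" "trg g = Y'" "X \<in> obj C" "Y \<in> obj C"
  shows "linear_op X Y (X' \<odot> X) (Y' \<odot> Y) (\<lambda>f. g \<otimes> f)"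
    "linear_op X Y (X \<odot> X') (Y \<odot> Y') (\<lambda>f. f \<otimes> g)"
  using assms tensor_linear_right[of X' Y' X Y g] tensor_linear_left[of X Y X' Y' g]
  by (auto simp: linear_op_def Hom_iff_arrow)

lemma linear_op_T: "\<lbrakk>X \<in> obj C; Y \<in> obj C\<rbrakk> \<Longrightarrow> linear_op X Y (pw p X) (pw p Y) (T p)"
  using linear_op_tensor(1)[of "idt C \<epsilon>" \<epsilon> \<epsilon> X Y] linear_op_id[of X Y]
  by (cases p) (simp_all add: T_def[abs_def] pw_def)

text \<open>The representative forgets the parity: an arrow of C from X to \<epsilon> \<odot> Y
  represents an odd arrow to Y as well as an even arrow to \<epsilon> \<odot> Y.\<close>

lemma repr_eqI:
  "\<lbrakk>par f = par g; ssrc f = ssrc g; strg f = strg g; repr C \<epsilon> f = repr C \<epsilon> g\<rbrakk> \<Longrightarrow> f = g"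
  by (auto simp: repr_def sarr.expand)

text \<open>For odd \<open>f\<close> the representative ends at
  \<open>\<epsilon> \<odot> strg f\<close>, and from this object \<open>strg f \<in> obj C\<close>
  cannot be read off.\<close>

definition sarrow :: "('o, 'v) sarr \<Rightarrow> bool"
  where "sarrow f \<longleftrightarrow> strg f \<in> obj C \<and> arrow (repr C \<epsilon> f)"

lemma repr_simps [simp]:
  "src (repr C \<epsilon> f) = ssrc f" "trg (repr C \<epsilon> f) = pw (par f) (strg f)" "val (repr C \<epsilon> f) = sval f"
  by (simp_all add: repr_def pw_def)

lemma sarrow_simps [simp]:
  "sarrow f \<Longrightarrow> arrow (repr C \<epsilon> f)" "sarrow f \<Longrightarrow> strg f \<in> obj C" "sarrow f \<Longrightarrow> ssrc f \<in> obj C"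
  using arrow_obj(1)[of "repr C \<epsilon> f"] by (auto simp: sarrow_def)

lemma sarrowI: "\<lbrakk>strg f \<in> obj C; arrow (repr C \<epsilon> f)\<rbrakk> \<Longrightarrow> sarrow f"
  unfolding sarrow_def ..

lemma arr_even [simp]:
  "par (even_arr f) = 0" "ssrc (even_arr f) = src f" "strg (even_arr f) = trg f"
  "repr C \<epsilon> (even_arr f) = f"
  by (simp_all add: even_arr_def repr_def)

lemma sarrow_even [simp]: "arrow f \<Longrightarrow> sarrow (even_arr f)"
  by (rule sarrowI) simp_all

abbreviation sid :: "'o \<Rightarrow> ('o, 'v) sarr"
  where "sid X \<equiv> even_arr (idt C X)"

abbreviation scmp :: "('o, 'v) sarr \<Rightarrow> ('o, 'v) sarr \<Rightarrow> ('o, 'v) sarr"  (infixr "\<bullet>" 60)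
  where "g \<bullet> f \<equiv> hat_cmp C \<epsilon> \<xi> g f"

abbreviation stensor :: "('o, 'v) sarr \<Rightarrow> ('o, 'v) sarr \<Rightarrow> ('o, 'v) sarr"  (infixr "\<boxtimes>" 70)
  where "f \<boxtimes> g \<equiv> hat_tensor C c \<epsilon> \<xi> f g"

lemma sarr_cmp [simp]:
  "par (g \<bullet> f) = par g + par f" "ssrc (g \<bullet> f) = ssrc f" "strg (g \<bullet> f) = strg g"
  by (simp_all add: hat_cmp_def)

text \<open>One formula for all clauses of \<open>hat_cmp\<close>. It has the shape of Kleisli
  composition for the family \<open>T\<close>, graded by parity, with multiplication
  \<open>M\<close>.\<close>

lemma repr_cmp [simp]:
  assumes "sarrow f" "sarrow g" "ssrc g = strg f"
  shows "repr C \<epsilon> (g \<bullet> f) = M (par f) (par g) (strg g) \<cdot> T (par f) (repr C \<epsilon> g) \<cdot> repr C \<epsilon> f"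
    (is "_ = ?r")
proof (rule arr_eq)
  have [simp]: "arrow (repr C \<epsilon> g)" "arrow (repr C \<epsilon> f)" using assms by auto
  show "val (repr C \<epsilon> (g \<bullet> f)) = val ?r"
    using assms
    by (cases "par f"; cases "par g")
      (simp_all add: hat_cmp_def M_def T_def pw_def)
qed (use assms in simp_all)

lemma sarrow_cmp [simp]: "\<lbrakk>sarrow f; sarrow g; ssrc g = strg f\<rbrakk> \<Longrightarrow> sarrow (g \<bullet> f)"
  by (rule sarrowI) simp_all

lemma sarr_tensor [simp]:
  "par (f \<boxtimes> g) = par f + par g" "ssrc (f \<boxtimes> g) = ssrc f \<odot> ssrc g" "strg (f \<boxtimes> g) = strg f \<odot> strg g"
  by (simp_all add: hat_tensor_def)

text \<open>The left copy of \<epsilon> is pulled out first by \<open>L\<close>, the right one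
  second by \<open>R\<close>, and then the two are multiplied. The factor \<open>sg\<close> is the
  \<open>neg_arr \<xi>\<close> of the odd-odd clause, moved outside by linearity.\<close>

lemma repr_tensor [simp]:
  assumes "sarrow f" "sarrow g"
  shows "repr C \<epsilon> (f \<boxtimes> g) = sg (par f) (par g) (M (par f) (par g) (strg f \<odot> strg g)
    \<cdot> T (par f) (R (par g) (strg f) (strg g)) \<cdot> L (par f) (strg f) (pw (par g) (strg g))
    \<cdot> (repr C \<epsilon> f \<otimes> repr C \<epsilon> g))" (is "_ = ?r")
proof (rule arr_eq)
  show "val (repr C \<epsilon> (f \<boxtimes> g)) = val ?r"
    using assms
    by (cases "par f"; cases "par g")
      (simp_all add: hat_tensor_def Let_def M_def T_def pw_def R_def L_def sg_def contract_def)
qed (use assms in simp_all)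

lemma sarrow_tensor [simp]: "\<lbrakk>sarrow f; sarrow g\<rbrakk> \<Longrightarrow> sarrow (f \<boxtimes> g)"
  by (rule sarrowI) simp_all

lemma sgn_twist_simps [simp]:
  "par (sgn_twist p q f) = par f" "ssrc (sgn_twist p q f) = ssrc f" "strg (sgn_twist p q f) = strg f"
  "repr C \<epsilon> (sgn_twist p q f) = sg p q (repr C \<epsilon> f)"
  by (simp_all add: sgn_twist_def sg_def repr_def neg_arr_def)

lemma sarrow_sgn_twist [simp]: "sarrow f \<Longrightarrow> sarrow (sgn_twist p q f)"
  by (rule sarrowI) simp_all

section \<open>The monoidal supercategory\<close>

text \<open>The associativity argument for Kleisli composition: \<open>M_assoc\<close> regroups the
  multiplications and \<open>M_nat\<close> carries one of them past \<open>h\<close>.\<close>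

lemma scmp_assoc [simp]:
  assumes [simp]: "sarrow f" "sarrow g" "sarrow h" "ssrc g = strg f" "ssrc h = strg g"
  shows "(h \<bullet> g) \<bullet> f = h \<bullet> g \<bullet> f"
proof (rule repr_eqI)
  let ?p = "par f" and ?q = "par g" and ?r = "par h" and ?Z = "strg h"
  let ?f = "repr C \<epsilon> f" and ?g = "repr C \<epsilon> g" and ?h = "repr C \<epsilon> h"
  have "repr C \<epsilon> ((h \<bullet> g) \<bullet> f) = (M ?p (?q + ?r) ?Z \<cdot> T ?p (M ?q ?r ?Z)) \<cdot> T ?p (T ?q ?h) \<cdot> T ?p ?g \<cdot> ?f"
    by simp
  also have "M ?p (?q + ?r) ?Z \<cdot> T ?p (M ?q ?r ?Z) = M (?p + ?q) ?r ?Z \<cdot> M ?p ?q (pw ?r ?Z)"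
    by (rule M_assoc) simp
  also have "(\<dots>) \<cdot> T ?p (T ?q ?h) \<cdot> T ?p ?g \<cdot> ?f
    = M (?p + ?q) ?r ?Z \<cdot> (M ?p ?q (pw ?r ?Z) \<cdot> T ?p (T ?q ?h)) \<cdot> T ?p ?g \<cdot> ?f"
    by simp
  also have "M ?p ?q (pw ?r ?Z) \<cdot> T ?p (T ?q ?h) = T (?p + ?q) ?h \<cdot> M ?p ?q (strg g)"
    by (rule M_nat) simp_all
  also have "M (?p + ?q) ?r ?Z \<cdot> (\<dots>) \<cdot> T ?p ?g \<cdot> ?f = repr C \<epsilon> (h \<bullet> g \<bullet> f)"
    by simp
  finally show "repr C \<epsilon> ((h \<bullet> g) \<bullet> f) = repr C \<epsilon> (h \<bullet> g \<bullet> f)" .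
qed simp_all

lemma sid_cmp [simp]: "\<lbrakk>sarrow f; X = strg f\<rbrakk> \<Longrightarrow> sid X \<bullet> f = f"
  by (rule repr_eqI) simp_all

lemma cmp_sid [simp]: "\<lbrakk>sarrow f; X = ssrc f\<rbrakk> \<Longrightarrow> f \<bullet> sid X = f"
  by (rule repr_eqI) simp_all

lemma even_cmp [simp]: "\<lbrakk>arrow f; arrow g; src g = trg f\<rbrakk> \<Longrightarrow> even_arr g \<bullet> even_arr f = even_arr (g \<cdot> f)"
  by (rule repr_eqI) simp_all

lemma even_tensor [simp]: "\<lbrakk>arrow f; arrow g\<rbrakk> \<Longrightarrow> even_arr f \<boxtimes> even_arr g = even_arr (f \<otimes> g)"
  by (rule repr_eqI) simp_all

lemma scmp_extend:
  "\<lbrakk>g \<bullet> f = k; sarrow f; sarrow g; sarrow h; ssrc g = strg f; ssrc f = strg h\<rbrakk> \<Longrightarrow> g \<bullet> f \<bullet> h = k \<bullet> h"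
  by (metis scmp_assoc)

lemma sgn_twist_cmp [simp]:
  assumes "sarrow f" "sarrow g" "ssrc g = strg f"
  shows "g \<bullet> sgn_twist p q f = sgn_twist p q (g \<bullet> f)" "sgn_twist p q g \<bullet> f = sgn_twist p q (g \<bullet> f)"
  by (rule repr_eqI; use assms in simp)+

text \<open>The other factor is even, so no sign arises, and functoriality reduces to
  \<open>L\<close> being natural and compatible with multiplication. The next lemma is the same with
  \<open>R\<close>.\<close>

lemma lwhisker_cmp:
  assumes [simp]: "sarrow f" "sarrow g" "ssrc g = strg f" "Z \<in> obj C"
  shows "(g \<boxtimes> sid Z) \<bullet> (f \<boxtimes> sid Z) = (g \<bullet> f) \<boxtimes> sid Z"
proof (rule repr_eqI)
  let ?p = "par f" and ?q = "par g" and ?Y = "strg g"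
  let ?f = "repr C \<epsilon> f" and ?g = "repr C \<epsilon> g"
  have "repr C \<epsilon> ((g \<bullet> f) \<boxtimes> sid Z) = (L (?p + ?q) ?Y Z \<cdot> (M ?p ?q ?Y \<otimes> idt C Z))
      \<cdot> (T ?p ?g \<otimes> idt C Z) \<cdot> (?f \<otimes> idt C Z)"
    by simp
  also have "L (?p + ?q) ?Y Z \<cdot> (M ?p ?q ?Y \<otimes> idt C Z)
    = M ?p ?q (?Y \<odot> Z) \<cdot> T ?p (L ?q ?Y Z) \<cdot> L ?p (pw ?q ?Y) Z"
    by (rule L_M) simp_all
  also have "(\<dots>) \<cdot> (T ?p ?g \<otimes> idt C Z) \<cdot> (?f \<otimes> idt C Z)
    = (M ?p ?q (?Y \<odot> Z) \<cdot> T ?p (L ?q ?Y Z)) \<cdot> (L ?p (pw ?q ?Y) Z \<cdot> (T ?p ?g \<otimes> idt C Z)) \<cdot> (?f \<otimes> idt C Z)"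
    by simp
  also have "L ?p (pw ?q ?Y) Z \<cdot> (T ?p ?g \<otimes> idt C Z) = T ?p (?g \<otimes> idt C Z) \<cdot> L ?p (strg f) Z"
    by (rule L_nat) simp_all
  finally show "repr C \<epsilon> ((g \<boxtimes> sid Z) \<bullet> (f \<boxtimes> sid Z)) = repr C \<epsilon> ((g \<bullet> f) \<boxtimes> sid Z)"
    by simp
qed simp_all

lemma rwhisker_cmp:
  assumes [simp]: "sarrow f" "sarrow g" "ssrc g = strg f" "X \<in> obj C"
  shows "(sid X \<boxtimes> g) \<bullet> (sid X \<boxtimes> f) = sid X \<boxtimes> (g \<bullet> f)"
proof (rule repr_eqI)
  let ?p = "par f" and ?q = "par g" and ?Y = "strg g"
  let ?f = "repr C \<epsilon> f" and ?g = "repr C \<epsilon> g"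
  have "repr C \<epsilon> (sid X \<boxtimes> (g \<bullet> f)) = (R (?p + ?q) X ?Y \<cdot> (idt C X \<otimes> M ?p ?q ?Y))
      \<cdot> (idt C X \<otimes> T ?p ?g) \<cdot> (idt C X \<otimes> ?f)"
    by simp
  also have "R (?p + ?q) X ?Y \<cdot> (idt C X \<otimes> M ?p ?q ?Y)
    = M ?p ?q (X \<odot> ?Y) \<cdot> T ?p (R ?q X ?Y) \<cdot> R ?p X (pw ?q ?Y)"
    by (rule R_M) simp_all
  also have "(\<dots>) \<cdot> (idt C X \<otimes> T ?p ?g) \<cdot> (idt C X \<otimes> ?f)
    = (M ?p ?q (X \<odot> ?Y) \<cdot> T ?p (R ?q X ?Y)) \<cdot> (R ?p X (pw ?q ?Y) \<cdot> (idt C X \<otimes> T ?p ?g)) \<cdot> (idt C X \<otimes> ?f)"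
    by simp
  also have "R ?p X (pw ?q ?Y) \<cdot> (idt C X \<otimes> T ?p ?g) = T ?p (idt C X \<otimes> ?g) \<cdot> R ?p X (strg f)"
    by (rule R_nat) simp_all
  finally show "repr C \<epsilon> ((sid X \<boxtimes> g) \<bullet> (sid X \<boxtimes> f)) = repr C \<epsilon> (sid X \<boxtimes> (g \<bullet> f))"
    by simp
qed simp_all

text \<open>\<open>g\<close> acts first, so its \<epsilon> is pulled out before that of
  \<open>f\<close>. Restoring the order of \<open>repr_tensor\<close> costs the sign of
  \<open>L_R_swap\<close>, and this is exactly the minus that the definition puts in front of
  \<xi>.\<close>

lemma stensor_split:
  assumes [simp]: "sarrow f" "sarrow g" "ssrc f = X" "strg g = Y"
  shows "(f \<boxtimes> sid Y) \<bullet> (sid X \<boxtimes> g) = f \<boxtimes> g"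
proof (rule repr_eqI)
  have [simp]: "X \<in> obj C" "Y \<in> obj C"
    using assms sarrow_simps by blast+
  let ?p = "par f" and ?q = "par g" and ?Y = "strg f"
  let ?f = "repr C \<epsilon> f" and ?g = "repr C \<epsilon> g"
  have "repr C \<epsilon> ((f \<boxtimes> sid Y) \<bullet> (sid X \<boxtimes> g))
    = (M ?q ?p (?Y \<odot> Y) \<cdot> T ?q (L ?p ?Y Y)) \<cdot> (T ?q (?f \<otimes> idt C Y) \<cdot> R ?q X Y) \<cdot> (idt C X \<otimes> ?g)"
    by simp
  also have "T ?q (?f \<otimes> idt C Y) \<cdot> R ?q X Y = R ?q (pw ?p ?Y) Y \<cdot> (?f \<otimes> T ?q (idt C Y))"
    by (rule R_nat[symmetric]) simp_all
  also have "(M ?q ?p (?Y \<odot> Y) \<cdot> T ?q (L ?p ?Y Y)) \<cdot> (\<dots>) \<cdot> (idt C X \<otimes> ?g)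
    = (M ?q ?p (?Y \<odot> Y) \<cdot> T ?q (L ?p ?Y Y) \<cdot> R ?q (pw ?p ?Y) Y) \<cdot> (?f \<otimes> ?g)"
    by simp
  also have "M ?q ?p (?Y \<odot> Y) \<cdot> T ?q (L ?p ?Y Y) \<cdot> R ?q (pw ?p ?Y) Y
    = sg ?p ?q (M ?p ?q (?Y \<odot> Y) \<cdot> T ?p (R ?q ?Y Y) \<cdot> L ?p ?Y (pw ?q Y))"
    by (rule L_R_swap) simp_all
  finally show "repr C \<epsilon> ((f \<boxtimes> sid Y) \<bullet> (sid X \<boxtimes> g)) = repr C \<epsilon> (f \<boxtimes> g)"
    by simp
qed (insert sarrow_simps(2,3)[OF assms(1)] sarrow_simps(2,3)[OF assms(2)], simp_all)

text \<open>Here the copies leave in the order of the definition, left before right, so nothing is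
  exchanged and the minus of the definition remains as the twist.\<close>

lemma stensor_swap:
  assumes [simp]: "sarrow f" "sarrow g" "strg f = Y" "ssrc g = X"
  shows "(sid Y \<boxtimes> g) \<bullet> (f \<boxtimes> sid X) = sgn_twist (par f) (par g) (f \<boxtimes> g)"
proof (rule repr_eqI)
  have [simp]: "X \<in> obj C" "Y \<in> obj C"
    using assms sarrow_simps by blast+
  let ?p = "par f" and ?q = "par g" and ?Z = "strg g"
  let ?f = "repr C \<epsilon> f" and ?g = "repr C \<epsilon> g"
  have "repr C \<epsilon> ((sid Y \<boxtimes> g) \<bullet> (f \<boxtimes> sid X))
    = (M ?p ?q (Y \<odot> ?Z) \<cdot> T ?p (R ?q Y ?Z)) \<cdot> (T ?p (idt C Y \<otimes> ?g) \<cdot> L ?p Y X) \<cdot> (?f \<otimes> idt C X)"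
    by simp
  also have "T ?p (idt C Y \<otimes> ?g) \<cdot> L ?p Y X = L ?p Y (pw ?q ?Z) \<cdot> (T ?p (idt C Y) \<otimes> ?g)"
    by (rule L_nat[symmetric]) simp_all
  finally show "repr C \<epsilon> ((sid Y \<boxtimes> g) \<bullet> (f \<boxtimes> sid X)) = repr C \<epsilon> (sgn_twist (par f) (par g) (f \<boxtimes> g))"
    by simp
qed (insert sarrow_simps(2,3)[OF assms(1)] sarrow_simps(2,3)[OF assms(2)], simp_all)

text \<open>Once both tensor products are split, only the inner pair is out of order:
  \<open>g'\<close> in the right factor follows \<open>f\<close> in the left one. Exchanging these
  two gives the whole sign, and functoriality in each factor does the rest.\<close>

lemma stensor_interchange:
  assumes [simp]: "sarrow f" "sarrow g" "sarrow f'" "sarrow g'" "ssrc g = strg f" "ssrc g' = strg f'"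
  shows "(g \<boxtimes> g') \<bullet> (f \<boxtimes> f') = sgn_twist (par g') (par f) ((g \<bullet> f) \<boxtimes> (g' \<bullet> f'))"
proof -
  let ?X = "ssrc f" and ?Y = "strg f" and ?Z = "strg g" and ?X' = "ssrc f'" and ?Y' = "strg f'" and ?Z' = "strg g'"
  have tw: "sgn_twist (par f) (par g') h = sgn_twist (par g') (par f) h" for h :: "('o, 'v) sarr"
    by (auto simp: sgn_twist_def)
  have "(g \<boxtimes> g') \<bullet> (f \<boxtimes> f')
    = ((g \<boxtimes> sid ?Z') \<bullet> (sid ?Y \<boxtimes> g')) \<bullet> ((f \<boxtimes> sid ?Y') \<bullet> (sid ?X \<boxtimes> f'))"
    unfolding stensor_split[OF assms(2,4,5) refl] stensor_split[OF assms(1,3) refl refl] ..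
  also have "\<dots> = (g \<boxtimes> sid ?Z') \<bullet> ((sid ?Y \<boxtimes> g') \<bullet> (f \<boxtimes> sid ?Y')) \<bullet> (sid ?X \<boxtimes> f')"
    by simp
  also have "(sid ?Y \<boxtimes> g') \<bullet> (f \<boxtimes> sid ?Y') = sgn_twist (par f) (par g') (f \<boxtimes> g')"
    by (rule stensor_swap) simp_all
  also have "f \<boxtimes> g' = (f \<boxtimes> sid ?Z') \<bullet> (sid ?X \<boxtimes> g')"
    by (rule stensor_split[symmetric]) simp_all
  also have "(g \<boxtimes> sid ?Z') \<bullet> sgn_twist (par f) (par g') (\<dots>) \<bullet> (sid ?X \<boxtimes> f')
    = sgn_twist (par g') (par f)
        (((g \<boxtimes> sid ?Z') \<bullet> (f \<boxtimes> sid ?Z')) \<bullet> ((sid ?X \<boxtimes> g') \<bullet> (sid ?X \<boxtimes> f')))"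
    by (simp add: tw)
  also have "((g \<boxtimes> sid ?Z') \<bullet> (f \<boxtimes> sid ?Z')) \<bullet> ((sid ?X \<boxtimes> g') \<bullet> (sid ?X \<boxtimes> f')) = (g \<bullet> f) \<boxtimes> (g' \<bullet> f')"
    by (simp add: lwhisker_cmp rwhisker_cmp stensor_split)
  finally show ?thesis .
qed

section \<open>Supernaturality of the associator, one factor at a time\<close>

lemma sassoc_left:
  assumes [simp]: "sarrow f" "ssrc f = X" "strg f = X'" "Y \<in> obj C" "Z \<in> obj C"
  shows "even_arr (assoc C X' Y Z) \<bullet> ((f \<boxtimes> sid Y) \<boxtimes> sid Z) = (f \<boxtimes> sid (Y \<odot> Z)) \<bullet> even_arr (assoc C X Y Z)"
proof (rule repr_eqI)
  have [simp]: "X \<in> obj C" "X' \<in> obj C"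
    using assms sarrow_simps by blast+
  let ?p = "par f" and ?f = "repr C \<epsilon> f"
  have "repr C \<epsilon> (even_arr (assoc C X' Y Z) \<bullet> ((f \<boxtimes> sid Y) \<boxtimes> sid Z))
    = (T ?p (assoc C X' Y Z) \<cdot> L ?p (X' \<odot> Y) Z \<cdot> (L ?p X' Y \<otimes> idt C Z)) \<cdot> ((?f \<otimes> idt C Y) \<otimes> idt C Z)"
    by simp
  also have "T ?p (assoc C X' Y Z) \<cdot> L ?p (X' \<odot> Y) Z \<cdot> (L ?p X' Y \<otimes> idt C Z)
    = L ?p X' (Y \<odot> Z) \<cdot> assoc C (pw ?p X') Y Z"
    by (rule assoc_L) simp_all
  also have "(\<dots>) \<cdot> ((?f \<otimes> idt C Y) \<otimes> idt C Z)
    = L ?p X' (Y \<odot> Z) \<cdot> (assoc C (pw ?p X') Y Z \<cdot> ((?f \<otimes> idt C Y) \<otimes> idt C Z))"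
    by simp
  also have "assoc C (pw ?p X') Y Z \<cdot> ((?f \<otimes> idt C Y) \<otimes> idt C Z)
    = (?f \<otimes> (idt C Y \<otimes> idt C Z)) \<cdot> assoc C X Y Z"
    by (rule assoc_nat) simp_all
  finally show "repr C \<epsilon> (even_arr (assoc C X' Y Z) \<bullet> ((f \<boxtimes> sid Y) \<boxtimes> sid Z))
    = repr C \<epsilon> ((f \<boxtimes> sid (Y \<odot> Z)) \<bullet> even_arr (assoc C X Y Z))"
    by simp
qed (insert sarrow_simps(2,3)[OF assms(1)], simp_all)

lemma sassoc_middle:
  assumes [simp]: "sarrow f" "ssrc f = Y" "strg f = Y'" "X \<in> obj C" "Z \<in> obj C"
  shows "even_arr (assoc C X Y' Z) \<bullet> ((sid X \<boxtimes> f) \<boxtimes> sid Z) = (sid X \<boxtimes> (f \<boxtimes> sid Z)) \<bullet> even_arr (assoc C X Y Z)"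
proof (rule repr_eqI)
  have [simp]: "Y \<in> obj C" "Y' \<in> obj C"
    using assms sarrow_simps by blast+
  let ?p = "par f" and ?f = "repr C \<epsilon> f"
  have "repr C \<epsilon> (even_arr (assoc C X Y' Z) \<bullet> ((sid X \<boxtimes> f) \<boxtimes> sid Z))
    = (T ?p (assoc C X Y' Z) \<cdot> L ?p (X \<odot> Y') Z \<cdot> (R ?p X Y' \<otimes> idt C Z)) \<cdot> ((idt C X \<otimes> ?f) \<otimes> idt C Z)"
    by simp
  also have "T ?p (assoc C X Y' Z) \<cdot> L ?p (X \<odot> Y') Z \<cdot> (R ?p X Y' \<otimes> idt C Z)
    = R ?p X (Y' \<odot> Z) \<cdot> (idt C X \<otimes> L ?p Y' Z) \<cdot> assoc C X (pw ?p Y') Z"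
    by (rule assoc_L_R) simp_all
  also have "(\<dots>) \<cdot> ((idt C X \<otimes> ?f) \<otimes> idt C Z)
    = (R ?p X (Y' \<odot> Z) \<cdot> (idt C X \<otimes> L ?p Y' Z)) \<cdot> (assoc C X (pw ?p Y') Z \<cdot> ((idt C X \<otimes> ?f) \<otimes> idt C Z))"
    by simp
  also have "assoc C X (pw ?p Y') Z \<cdot> ((idt C X \<otimes> ?f) \<otimes> idt C Z)
    = (idt C X \<otimes> (?f \<otimes> idt C Z)) \<cdot> assoc C X Y Z"
    by (rule assoc_nat) simp_all
  finally show "repr C \<epsilon> (even_arr (assoc C X Y' Z) \<bullet> ((sid X \<boxtimes> f) \<boxtimes> sid Z))
    = repr C \<epsilon> ((sid X \<boxtimes> (f \<boxtimes> sid Z)) \<bullet> even_arr (assoc C X Y Z))"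
    by simp
qed (insert sarrow_simps(2,3)[OF assms(1)], simp_all)

lemma sassoc_right:
  assumes [simp]: "sarrow f" "ssrc f = Z" "strg f = Z'" "X \<in> obj C" "Y \<in> obj C"
  shows "even_arr (assoc C X Y Z') \<bullet> (sid (X \<odot> Y) \<boxtimes> f) = (sid X \<boxtimes> (sid Y \<boxtimes> f)) \<bullet> even_arr (assoc C X Y Z)"
proof (rule repr_eqI)
  have [simp]: "Z \<in> obj C" "Z' \<in> obj C"
    using assms sarrow_simps by blast+
  let ?p = "par f" and ?f = "repr C \<epsilon> f"
  have "repr C \<epsilon> (even_arr (assoc C X Y Z') \<bullet> (sid (X \<odot> Y) \<boxtimes> f))
    = (T ?p (assoc C X Y Z') \<cdot> R ?p (X \<odot> Y) Z') \<cdot> ((idt C X \<otimes> idt C Y) \<otimes> ?f)"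
    by simp
  also have "T ?p (assoc C X Y Z') \<cdot> R ?p (X \<odot> Y) Z'
    = R ?p X (Y \<odot> Z') \<cdot> (idt C X \<otimes> R ?p Y Z') \<cdot> assoc C X Y (pw ?p Z')"
    by (rule assoc_R) simp_all
  also have "(\<dots>) \<cdot> ((idt C X \<otimes> idt C Y) \<otimes> ?f)
    = (R ?p X (Y \<odot> Z') \<cdot> (idt C X \<otimes> R ?p Y Z')) \<cdot> (assoc C X Y (pw ?p Z') \<cdot> ((idt C X \<otimes> idt C Y) \<otimes> ?f))"
    by simp
  also have "assoc C X Y (pw ?p Z') \<cdot> ((idt C X \<otimes> idt C Y) \<otimes> ?f)
    = (idt C X \<otimes> (idt C Y \<otimes> ?f)) \<cdot> assoc C X Y Z"
    by (rule assoc_nat) simp_all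
  finally show "repr C \<epsilon> (even_arr (assoc C X Y Z') \<bullet> (sid (X \<odot> Y) \<boxtimes> f))
    = repr C \<epsilon> ((sid X \<boxtimes> (sid Y \<boxtimes> f)) \<bullet> even_arr (assoc C X Y Z))"
    by simp
qed (insert sarrow_simps(2,3)[OF assms(1)], simp_all)

text \<open>A triple tensor product is a composite of three arrows, each an identity in two of the
  factors. In the order left, middle, right both bracketings split without a sign.\<close>

lemma sassoc_natural:
  assumes [simp]: "sarrow f" "sarrow g" "sarrow h" "ssrc f = X" "strg f = X'" "ssrc g = Y" "strg g = Y'"
    "ssrc h = Z" "strg h = Z'"
  shows "even_arr (assoc C X' Y' Z') \<bullet> ((f \<boxtimes> g) \<boxtimes> h) = (f \<boxtimes> (g \<boxtimes> h)) \<bullet> even_arr (assoc C X Y Z)"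
proof -
  have [simp]: "X \<in> obj C" "X' \<in> obj C" "Y \<in> obj C" "Y' \<in> obj C" "Z \<in> obj C" "Z' \<in> obj C"
    using assms sarrow_simps by blast+
  have "(f \<boxtimes> g) \<boxtimes> h
    = ((f \<boxtimes> sid Y') \<boxtimes> sid Z') \<bullet> ((sid X \<boxtimes> g) \<boxtimes> sid Z') \<bullet> (sid (X \<odot> Y) \<boxtimes> h)"
    using scmp_extend[OF lwhisker_cmp[of "sid X \<boxtimes> g" "f \<boxtimes> sid Y'" Z'], of "sid (X \<odot> Y) \<boxtimes> h"]
    by (simp add: stensor_split)
  then have "even_arr (assoc C X' Y' Z') \<bullet> ((f \<boxtimes> g) \<boxtimes> h)
    = (even_arr (assoc C X' Y' Z') \<bullet> ((f \<boxtimes> sid Y') \<boxtimes> sid Z')) \<bullet> ((sid X \<boxtimes> g) \<boxtimes> sid Z') \<bullet> (sid (X \<odot> Y) \<boxtimes> h)"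
    by simp
  also have "even_arr (assoc C X' Y' Z') \<bullet> ((f \<boxtimes> sid Y') \<boxtimes> sid Z')
    = (f \<boxtimes> sid (Y' \<odot> Z')) \<bullet> even_arr (assoc C X Y' Z')"
    by (rule sassoc_left) simp_all
  also have "(\<dots>) \<bullet> ((sid X \<boxtimes> g) \<boxtimes> sid Z') \<bullet> (sid (X \<odot> Y) \<boxtimes> h)
    = (f \<boxtimes> sid (Y' \<odot> Z')) \<bullet> (even_arr (assoc C X Y' Z') \<bullet> ((sid X \<boxtimes> g) \<boxtimes> sid Z')) \<bullet> (sid (X \<odot> Y) \<boxtimes> h)"
    by simp
  also have "even_arr (assoc C X Y' Z') \<bullet> ((sid X \<boxtimes> g) \<boxtimes> sid Z')
    = (sid X \<boxtimes> (g \<boxtimes> sid Z')) \<bullet> even_arr (assoc C X Y Z')"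
    by (rule sassoc_middle) simp_all
  also have "(f \<boxtimes> sid (Y' \<odot> Z')) \<bullet> (\<dots>) \<bullet> (sid (X \<odot> Y) \<boxtimes> h)
    = ((f \<boxtimes> sid (Y' \<odot> Z')) \<bullet> (sid X \<boxtimes> (g \<boxtimes> sid Z'))) \<bullet> (even_arr (assoc C X Y Z') \<bullet> (sid (X \<odot> Y) \<boxtimes> h))"
    by simp
  also have "even_arr (assoc C X Y Z') \<bullet> (sid (X \<odot> Y) \<boxtimes> h)
    = (sid X \<boxtimes> (sid Y \<boxtimes> h)) \<bullet> even_arr (assoc C X Y Z)"
    by (rule sassoc_right) simp_all
  also have "((f \<boxtimes> sid (Y' \<odot> Z')) \<bullet> (sid X \<boxtimes> (g \<boxtimes> sid Z'))) \<bullet> (\<dots>)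
    = (f \<boxtimes> sid (Y' \<odot> Z')) \<bullet> ((sid X \<boxtimes> (g \<boxtimes> sid Z')) \<bullet> (sid X \<boxtimes> (sid Y \<boxtimes> h))) \<bullet> even_arr (assoc C X Y Z)"
    by simp
  also have "(sid X \<boxtimes> (g \<boxtimes> sid Z')) \<bullet> (sid X \<boxtimes> (sid Y \<boxtimes> h)) = sid X \<boxtimes> (g \<boxtimes> h)"
    by (simp add: rwhisker_cmp stensor_split)
  also have "(f \<boxtimes> sid (Y' \<odot> Z')) \<bullet> (\<dots>) \<bullet> even_arr (assoc C X Y Z)
    = ((f \<boxtimes> sid (Y' \<odot> Z')) \<bullet> (sid X \<boxtimes> (g \<boxtimes> h))) \<bullet> even_arr (assoc C X Y Z)"
    by simp
  also have "(f \<boxtimes> sid (Y' \<odot> Z')) \<bullet> (sid X \<boxtimes> (g \<boxtimes> h)) = f \<boxtimes> (g \<boxtimes> h)"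
    by (rule stensor_split) simp_all
  finally show ?thesis .
qed

section \<open>Supernaturality of the unitors and of the braiding\<close>

lemma slunit_natural:
  assumes [simp]: "sarrow f" "ssrc f = X" "strg f = Y"
  shows "even_arr (lunit C Y) \<bullet> (sid \<one> \<boxtimes> f) = f \<bullet> even_arr (lunit C X)"
proof (rule repr_eqI)
  have [simp]: "X \<in> obj C" "Y \<in> obj C"
    using assms sarrow_simps by blast+
  let ?p = "par f" and ?f = "repr C \<epsilon> f"
  have "repr C \<epsilon> (even_arr (lunit C Y) \<bullet> (sid \<one> \<boxtimes> f)) = (T ?p (lunit C Y) \<cdot> R ?p \<one> Y) \<cdot> (idt C \<one> \<otimes> ?f)"
    by simp
  then show "repr C \<epsilon> (even_arr (lunit C Y) \<bullet> (sid \<one> \<boxtimes> f)) = repr C \<epsilon> (f \<bullet> even_arr (lunit C X))"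
    by (simp add: lunit_R lunit_nat)
qed (insert sarrow_simps(2,3)[OF assms(1)], simp_all)

lemma srunit_natural:
  assumes [simp]: "sarrow f" "ssrc f = X" "strg f = Y"
  shows "even_arr (runit C Y) \<bullet> (f \<boxtimes> sid \<one>) = f \<bullet> even_arr (runit C X)"
proof (rule repr_eqI)
  have [simp]: "X \<in> obj C" "Y \<in> obj C"
    using assms sarrow_simps by blast+
  let ?p = "par f" and ?f = "repr C \<epsilon> f"
  have "repr C \<epsilon> (even_arr (runit C Y) \<bullet> (f \<boxtimes> sid \<one>)) = (T ?p (runit C Y) \<cdot> L ?p Y \<one>) \<cdot> (?f \<otimes> idt C \<one>)"
    by simp
  then show "repr C \<epsilon> (even_arr (runit C Y) \<bullet> (f \<boxtimes> sid \<one>)) = repr C \<epsilon> (f \<bullet> even_arr (runit C X))"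
    by (simp add: runit_L runit_nat)
qed (insert sarrow_simps(2,3)[OF assms(1)], simp_all)

lemma sbraiding_left:
  assumes [simp]: "sarrow f" "ssrc f = X" "strg f = Y" "Z \<in> obj C"
  shows "even_arr (c Y Z) \<bullet> (f \<boxtimes> sid Z) = (sid Z \<boxtimes> f) \<bullet> even_arr (c X Z)"
proof (rule repr_eqI)
  have [simp]: "X \<in> obj C" "Y \<in> obj C"
    using assms sarrow_simps by blast+
  let ?p = "par f" and ?f = "repr C \<epsilon> f"
  have "repr C \<epsilon> (even_arr (c Y Z) \<bullet> (f \<boxtimes> sid Z)) = (T ?p (c Y Z) \<cdot> L ?p Y Z) \<cdot> (?f \<otimes> idt C Z)"
    by simp
  then show "repr C \<epsilon> (even_arr (c Y Z) \<bullet> (f \<boxtimes> sid Z)) = repr C \<epsilon> ((sid Z \<boxtimes> f) \<bullet> even_arr (c X Z))"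
    by (simp add: c_L c_nat)
qed (insert sarrow_simps(2,3)[OF assms(1)], simp_all)

lemma sbraiding_right:
  assumes [simp]: "sarrow f" "ssrc f = X" "strg f = Y" "Z \<in> obj C"
  shows "even_arr (c Z Y) \<bullet> (sid Z \<boxtimes> f) = (f \<boxtimes> sid Z) \<bullet> even_arr (c Z X)"
proof (rule repr_eqI)
  have [simp]: "X \<in> obj C" "Y \<in> obj C"
    using assms sarrow_simps by blast+
  let ?p = "par f" and ?f = "repr C \<epsilon> f"
  have "repr C \<epsilon> (even_arr (c Z Y) \<bullet> (sid Z \<boxtimes> f)) = (T ?p (c Z Y) \<cdot> R ?p Z Y) \<cdot> (idt C Z \<otimes> ?f)"
    by simp
  then show "repr C \<epsilon> (even_arr (c Z Y) \<bullet> (sid Z \<boxtimes> f)) = repr C \<epsilon> ((f \<boxtimes> sid Z) \<bullet> even_arr (c Z X))"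
    by (simp add: c_R c_nat)
qed (insert sarrow_simps(2,3)[OF assms(1)], simp_all)

text \<open>Splitting puts \<open>f\<close> after \<open>g\<close>, and each passes the braiding
  without a sign. They come out as \<open>sid Y' \<boxtimes> f\<close> after
  \<open>g \<boxtimes> sid X\<close>, the order in which \<open>stensor_swap\<close> produces the
  twist.\<close>

lemma sbraiding_natural:
  assumes [simp]: "sarrow f" "sarrow g" "ssrc f = X" "strg f = X'" "ssrc g = Y" "strg g = Y'"
  shows "even_arr (c X' Y') \<bullet> (f \<boxtimes> g) = sgn_twist (par f) (par g) ((g \<boxtimes> f) \<bullet> even_arr (c X Y))"
proof -
  have [simp]: "X \<in> obj C" "X' \<in> obj C" "Y \<in> obj C" "Y' \<in> obj C"
    using assms sarrow_simps by blast+
  have tw: "sgn_twist (par g) (par f) h = sgn_twist (par f) (par g) h" for h :: "('o, 'v) sarr"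
    by (auto simp: sgn_twist_def)
  have "even_arr (c X' Y') \<bullet> (f \<boxtimes> g) = (even_arr (c X' Y') \<bullet> (f \<boxtimes> sid Y')) \<bullet> (sid X \<boxtimes> g)"
    by (simp add: stensor_split)
  also have "even_arr (c X' Y') \<bullet> (f \<boxtimes> sid Y') = (sid Y' \<boxtimes> f) \<bullet> even_arr (c X Y')"
    by (rule sbraiding_left) simp_all
  also have "(\<dots>) \<bullet> (sid X \<boxtimes> g) = (sid Y' \<boxtimes> f) \<bullet> (even_arr (c X Y') \<bullet> (sid X \<boxtimes> g))"
    by simp
  also have "even_arr (c X Y') \<bullet> (sid X \<boxtimes> g) = (g \<boxtimes> sid X) \<bullet> even_arr (c X Y)"
    by (rule sbraiding_right) simp_all
  also have "(sid Y' \<boxtimes> f) \<bullet> (\<dots>) = ((sid Y' \<boxtimes> f) \<bullet> (g \<boxtimes> sid X)) \<bullet> even_arr (c X Y)"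
    by simp
  also have "(sid Y' \<boxtimes> f) \<bullet> (g \<boxtimes> sid X) = sgn_twist (par g) (par f) (g \<boxtimes> f)"
    by (rule stensor_swap) simp_all
  finally show ?thesis
    by (simp add: tw)
qed

text \<open>The homogeneous parts of the Hom superspaces are Hom spaces of C, so linearity of
  \<open>F\<close> can be tested on the operation \<Phi> that it induces on representatives.\<close>

lemma linear_on_sarrow:
  assumes "X \<in> obj C" "Y \<in> obj C" "linear_op X (pw p Y) X' Y' \<Phi>"
    and "\<And>f. \<lbrakk>sarrow f; par f = p; ssrc f = X; strg f = Y\<rbrakk> \<Longrightarrow> repr C \<epsilon> (F f) = \<Phi> (repr C \<epsilon> f)"
  shows "linear_on (scl C) (scl C) (homspace C X (pw p Y)) (\<lambda>v. sval (F (SArr p X Y v)))"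
proof -
  have "sval (F (SArr p X Y v)) = val (\<Phi> (Arr X (pw p Y) v))" if "v \<in> homspace C X (pw p Y)" for v
  proof -
    have r: "repr C \<epsilon> (SArr p X Y v) = Arr X (pw p Y) v"
      by (simp add: repr_def pw_def)
    have "sarrow (SArr p X Y v)"
      by (rule sarrowI) (use assms that in \<open>simp_all add: r arrow_Arr\<close>)
    from assms(4)[OF this] have "repr C \<epsilon> (F (SArr p X Y v)) = \<Phi> (Arr X (pw p Y) v)"
      by (simp add: r)
    then show ?thesis
      by (metis repr_simps(3))
  qed
  moreover have "v + w \<in> homspace C X (pw p Y)" "scl C a v \<in> homspace C X (pw p Y)"
    if "v \<in> homspace C X (pw p Y)" "w \<in> homspace C X (pw p Y)" for v w a
    using that subspace_homspace[of X "pw p Y"] assms(1,2) by (auto intro: subspace_add subspace_scale)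
  ultimately show ?thesis
    using assms(3) unfolding linear_op_def linear_on_def by simp
qed

end

text \<open>\<open>hat\<close> takes records without extension fields, and a supercategory has
  finite-dimensional Hom superspaces; both restrictions are imposed here.\<close>

locale finite_fermion = fermion C c \<epsilon> \<xi>
  for C :: "('o, 'v::ab_group_add, 'k::field) linear_monoidal_data" (structure) and c \<epsilon> \<xi> +
  assumes homspace_finite: "\<lbrakk>X \<in> obj C; Y \<in> obj C\<rbrakk> \<Longrightarrow> \<exists>B. finite B \<and> homspace C X Y = span B"
begin

abbreviation "hatC \<equiv> hat C c \<epsilon> \<xi>"

section \<open>Checking the axioms of a braided monoidal supercategory\<close>

lemma hat_simps [simp]:
  "obj hatC = obj C" "idt hatC = (\<lambda>X. sid X)" "cmp hatC = hat_cmp C \<epsilon> \<xi>"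
  "tensor_obj hatC = tensor_obj C" "tensor hatC = hat_tensor C c \<epsilon> \<xi>" "tunit hatC = \<one>"
  "assoc hatC = (\<lambda>X Y Z. even_arr (assoc C X Y Z))" "iassoc hatC = (\<lambda>X Y Z. even_arr (iassoc C X Y Z))"
  "lunit hatC = (\<lambda>X. even_arr (lunit C X))" "runit hatC = (\<lambda>X. even_arr (runit C X))"
  "shomspace hatC p X Y = homspace C X (pw p Y)" "sscl hatC = scl C"
  by (simp_all add: hat_def pw_def)

lemma SHom_iff:
  assumes "X \<in> obj C" "Y \<in> obj C"
  shows "f \<in> SHom hatC p X Y \<longleftrightarrow> sarrow f \<and> par f = p \<and> ssrc f = X \<and> strg f = Y"
proof
  assume "f \<in> SHom hatC p X Y"
  then obtain v where v: "f = SArr p X Y v" "v \<in> homspace C X (pw p Y)"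
    by (auto simp: SHom_def)
  then have "repr C \<epsilon> f = Arr X (pw p Y) v"
    by (simp add: repr_def pw_def)
  then have "arrow (repr C \<epsilon> f)"
    using assms v(2) by (simp add: arrow_Arr)
  then show "sarrow f \<and> par f = p \<and> ssrc f = X \<and> strg f = Y"
    using v(1) assms by (simp add: sarrowI)
next
  assume f: "sarrow f \<and> par f = p \<and> ssrc f = X \<and> strg f = Y"
  then have "sval f \<in> homspace C X (pw p Y)"
    using arrow_val[of "repr C \<epsilon> f"] by simp
  then show "f \<in> SHom hatC p X Y"
    using f unfolding SHom_def by (intro image_eqI[of _ _ "sval f"]) (auto simp: sarr.expand)
qed

lemma isomorphism_even:
  assumes "X \<in> obj C" "Y \<in> obj C" "isomorphism C (Hom C) X Y f"
  shows "isomorphism hatC (SHom hatC 0) X Y (even_arr f)"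
proof -
  obtain g where "g \<in> Hom C Y X" "g \<cdot> f = idt C X" "f \<cdot> g = idt C Y"
    using assms(3) by (auto simp: isomorphism_def)
  then show ?thesis
    using assms unfolding isomorphism_def
    by (intro conjI bexI[of _ "even_arr g"]) (auto simp: SHom_iff Hom_iff_arrow)
qed

lemma scmp_linear:
  assumes "X \<in> obj C" "Y \<in> obj C" "Z \<in> obj C"
  shows "g \<in> SHom hatC q Y Z \<Longrightarrow> linear_on (scl C) (scl C) (homspace C X (pw p Y)) (\<lambda>v. sval (g \<bullet> SArr p X Y v))"
    "f \<in> SHom hatC p X Y \<Longrightarrow> linear_on (scl C) (scl C) (homspace C Y (pw q Z)) (\<lambda>v. sval (SArr q Y Z v \<bullet> f))"
proof -
  assume "g \<in> SHom hatC q Y Z"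
  then have [simp]: "sarrow g" "par g = q" "ssrc g = Y" "strg g = Z"
    using assms by (simp_all add: SHom_iff)
  have "linear_op X (pw p Y) X (pw (p + q) Z) (\<lambda>f. (M p q Z \<cdot> T p (repr C \<epsilon> g)) \<cdot> f)"
    using assms by (intro linear_op_cmp) simp_all
  then show "linear_on (scl C) (scl C) (homspace C X (pw p Y)) (\<lambda>v. sval (g \<bullet> SArr p X Y v))"
    by (rule linear_on_sarrow[where F = "\<lambda>f. g \<bullet> f", OF assms(1,2)]) (use assms in simp_all)
next
  assume "f \<in> SHom hatC p X Y"
  then have [simp]: "sarrow f" "par f = p" "ssrc f = X" "strg f = Y"
    using assms by (simp_all add: SHom_iff)
  have 1: "linear_op Y (pw q Z) (pw p Y) (pw p (pw q Z)) (T p)"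
    using assms by (intro linear_op_T) simp_all
  have 2: "linear_op (pw p Y) (pw p (pw q Z)) (pw p Y) (pw (p + q) Z) (\<lambda>g. M p q Z \<cdot> g)"
    using assms by (intro linear_op_cmp(1)) simp_all
  have 3: "linear_op (pw p Y) (pw (p + q) Z) X (pw (p + q) Z) (\<lambda>g. g \<cdot> repr C \<epsilon> f)"
    using assms by (intro linear_op_cmp(2)) simp_all
  have "linear_op Y (pw q Z) X (pw (p + q) Z) (\<lambda>g. (M p q Z \<cdot> T p g) \<cdot> repr C \<epsilon> f)"
    using linear_op_comp[OF _ _ linear_op_comp[OF _ _ 1 2] 3] assms by simp
  then show "linear_on (scl C) (scl C) (homspace C Y (pw q Z)) (\<lambda>v. sval (SArr q Y Z v \<bullet> f))"
    by (rule linear_on_sarrow[where F = "\<lambda>g. g \<bullet> f", OF assms(2,3)]) (use assms in simp_all)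
qed

lemma stensor_linear:
  assumes "X \<in> obj C" "Y \<in> obj C" "X' \<in> obj C" "Y' \<in> obj C"
  shows "f \<in> SHom hatC p X Y \<Longrightarrow>
      linear_on (scl C) (scl C) (homspace C X' (pw q Y')) (\<lambda>v. sval (f \<boxtimes> SArr q X' Y' v))"
    "g \<in> SHom hatC q X' Y' \<Longrightarrow>
      linear_on (scl C) (scl C) (homspace C X (pw p Y)) (\<lambda>v. sval (SArr p X Y v \<boxtimes> g))"
proof -
  \<comment> \<open>The structural factor of \<open>repr_tensor\<close>, common to both variables;
    what remains is tensoring with a fixed representative.\<close>
  let ?K = "sg p q (M p q (Y \<odot> Y') \<cdot> T p (R q Y Y') \<cdot> L p Y (pw q Y'))"
  have K: "linear_op (X \<odot> X') (pw p Y \<odot> pw q Y') (X \<odot> X') (pw (p + q) (Y \<odot> Y')) (\<lambda>g. ?K \<cdot> g)"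
    using assms by (intro linear_op_cmp(1)) simp_all
  {
    assume "f \<in> SHom hatC p X Y"
    then have [simp]: "sarrow f" "par f = p" "ssrc f = X" "strg f = Y"
      using assms by (simp_all add: SHom_iff)
    have 1: "linear_op X' (pw q Y') (X \<odot> X') (pw p Y \<odot> pw q Y') (\<lambda>g. repr C \<epsilon> f \<otimes> g)"
      using assms by (intro linear_op_tensor(1)) simp_all
    have "linear_op X' (pw q Y') (X \<odot> X') (pw (p + q) (Y \<odot> Y')) (\<lambda>g. ?K \<cdot> (repr C \<epsilon> f \<otimes> g))"
      using linear_op_comp[OF _ _ 1 K] assms by simp
    then show "linear_on (scl C) (scl C) (homspace C X' (pw q Y')) (\<lambda>v. sval (f \<boxtimes> SArr q X' Y' v))"
      by (rule linear_on_sarrow[where F = "\<lambda>g. f \<boxtimes> g", OF assms(3,4)]) (use assms in simp_all)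
  next
    assume "g \<in> SHom hatC q X' Y'"
    then have [simp]: "sarrow g" "par g = q" "ssrc g = X'" "strg g = Y'"
      using assms by (simp_all add: SHom_iff)
    have 1: "linear_op X (pw p Y) (X \<odot> X') (pw p Y \<odot> pw q Y') (\<lambda>f. f \<otimes> repr C \<epsilon> g)"
      using assms by (intro linear_op_tensor(2)) simp_all
    have "linear_op X (pw p Y) (X \<odot> X') (pw (p + q) (Y \<odot> Y')) (\<lambda>f. ?K \<cdot> (f \<otimes> repr C \<epsilon> g))"
      using linear_op_comp[OF _ _ 1 K] assms by simp
    then show "linear_on (scl C) (scl C) (homspace C X (pw p Y)) (\<lambda>v. sval (SArr p X Y v \<boxtimes> g))"
      by (rule linear_on_sarrow[where F = "\<lambda>f. f \<boxtimes> g", OF assms(1,2)]) (use assms in simp_all)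
  }
qed

lemma supercategory_hat: "supercategory hatC"
proof (intro supercategory.intro supercategory_axioms.intro)
  show "vector_space (sscl hatC)"
    using vector_space_axioms by simp
next
  fix p X Y assume "X \<in> obj hatC" "Y \<in> obj hatC"
  then show "module.subspace (sscl hatC) (shomspace hatC p X Y)"
    "\<exists>B. finite B \<and> shomspace hatC p X Y = module.span (sscl hatC) B"
    using subspace_homspace homspace_finite[of X "pw p Y"] by simp_all
qed (simp_all add: SHom_iff scmp_linear)

lemma monoidal_supercategory_hat: "monoidal_supercategory hatC"
proof (intro monoidal_supercategory.intro supercategory_hat monoidal_supercategory_axioms.intro)
  show "pentagon hatC" "triangle hatC"
    by (simp_all add: pentagon_def triangle_def pent tri)
qed (simp_all add: SHom_iff stensor_interchange stensor_linear sassoc_natural slunit_natural srunit_natural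
    isomorphism_even lunit_iso runit_iso)

theorem braided_monoidal_supercategory_hat: "braided_monoidal_supercategory hatC (\<lambda>X Y. even_arr (c X Y))"
proof (intro braided_monoidal_supercategory.intro monoidal_supercategory_hat
    braided_monoidal_supercategory_axioms.intro)
  show "hexagons hatC (\<lambda>X Y. even_arr (c X Y))"
    by (simp add: hexagons_def hex_left hex_right)
qed (simp_all add: SHom_iff sbraiding_natural isomorphism_even c_iso)

end

section \<open>Invertible superspaces\<close>

interpretation vec: vector_space "vscale :: 'k::field \<Rightarrow> 'k vec \<Rightarrow> 'k vec"
  by unfold_locales (auto simp: vscale_def fun_eq_iff algebra_simps)

lemma vscale_apply [simp]: "vscale a v i = a * v i"
  by (simp add: vscale_def)

lemma vtensor_Pair [simp]: "vtensor v w (Pair i j) = v i * w j"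
  by (simp add: vtensor_def)

lemma vtensor_eq_iff: "vtensor v w = vtensor v' w' \<longleftrightarrow> (\<forall>i j. v i * w j = v' i * w' j)"
proof
  assume "\<forall>i j. v i * w j = v' i * w' j"
  then show "vtensor v w = vtensor v' w'"
    by (intro ext) (simp add: vtensor_def split: ix.split)
qed (metis vtensor_Pair)

lemma superspace_subspace: "V \<in> superspaces \<Longrightarrow> vec.subspace (V p)"
  by (auto simp: superspaces_def) (metis vec.subspace_span)

lemma superspace_Int: "V \<in> superspaces \<Longrightarrow> x \<in> V 0 \<Longrightarrow> x \<in> V 1 \<Longrightarrow> x = 0"
  by (auto simp: superspaces_def)

text \<open>Stated for families of subspaces because it is applied to
  \<open>sspace_tensor V W\<close>, which is known here as a family of spans.\<close>

lemma superspace_total: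
  assumes "\<And>p. vec.subspace (V p)"
  shows "V p \<subseteq> total V" "vec.subspace (total V)"
proof -
  have "v \<in> total V" if "v \<in> V p" for v
  proof (cases p)
    case zero
    then have "v = v + 0 \<and> v \<in> V 0 \<and> 0 \<in> V 1"
      using that vec.subspace_0[OF assms, of 1] by simp
    then show ?thesis
      unfolding total_def by blast
  next
    case one
    then have "v = 0 + v \<and> 0 \<in> V 0 \<and> v \<in> V 1"
      using that vec.subspace_0[OF assms, of 0] by simp
    then show ?thesis
      unfolding total_def by blast
  qed
  then show "V p \<subseteq> total V" by auto
  show "vec.subspace (total V)"
    using vec.subspace_sums[OF assms assms] by (simp add: total_def)
qed

lemma sspace_tensor_subspace: "vec.subspace (sspace_tensor V W p)"
  by (simp add: sspace_tensor_def)

lemma vtensor_in_total: "v \<in> V p \<Longrightarrow> w \<in> W q \<Longrightarrow> vtensor v w \<in> total (sspace_tensor V W)"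
proof -
  assume "v \<in> V p" "w \<in> W q"
  then have "vtensor v w \<in> sspace_tensor V W (p + q)"
    unfolding sspace_tensor_def by (intro vec.span_base) blast
  then show ?thesis
    using superspace_total(1)[of "sspace_tensor V W" "p + q", OF sspace_tensor_subspace] by blast
qed

lemma total_sspace_unit: "total sspace_unit = range (\<lambda>a. vscale a (unit_vec :: 'k::field vec))"
  by (auto simp: total_def sspace_unit_def vec.span_singleton image_iff)

lemma even_map_total:
  assumes "f \<in> even_maps V W" "\<And>p. vec.subspace (V p)"
  shows "x \<in> total V \<Longrightarrow> f x \<in> total W"
    "\<lbrakk>x \<in> total V; y \<in> total V\<rbrakk> \<Longrightarrow> f (x + y) = f x + f y"
    "x \<in> total V \<Longrightarrow> f (vscale a x) = vscale a (f x)"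
    "x \<notin> total V \<Longrightarrow> f x = 0"
proof -
  have lin: "linear_on vscale vscale (total V) f" and im: "\<And>p x. x \<in> V p \<Longrightarrow> f x \<in> W p"
    using assms(1) by (auto simp: even_maps_def)
  show add: "f (x + y) = f x + f y" if "x \<in> total V" "y \<in> total V" for x y
    using lin that by (simp add: linear_on_def)
  show "f (vscale a x) = vscale a (f x)" if "x \<in> total V"
    using lin that by (simp add: linear_on_def)
  show "f x = 0" if "x \<notin> total V"
    using assms(1) that by (simp add: even_maps_def)
  show "f x \<in> total W" if "x \<in> total V"
  proof -
    obtain v w where x: "x = v + w" "v \<in> V 0" "w \<in> V 1"
      using \<open>x \<in> total V\<close> by (auto simp: total_def)
    then have "f x = f v + f w"
      using superspace_total(1)[of V, OF assms(2)] by (auto intro!: add)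
    then show ?thesis
      using im x(2,3) unfolding total_def by blast
  qed
qed

text \<open>A vector of the opposite parity is a multiple of \<open>v\<close>, so it lies in both
  parts and vanishes.\<close>

lemma total_line:
  assumes "V \<in> superspaces" "v \<in> V p" "\<And>q w. w \<in> V q \<Longrightarrow> \<exists>a. w = vscale a v"
  shows "V (p + 1) = {0}" "V p = range (\<lambda>a. vscale a v)" "total V = range (\<lambda>a. vscale a v)"
proof -
  have scaled: "vscale a v \<in> V p" for a
    using superspace_subspace[OF assms(1)] assms(2) by (rule vec.subspace_scale)
  then show p: "V p = range (\<lambda>a. vscale a v)"
    using assms(3) by blast
  have "w = 0" if "w \<in> V (p + 1)" for w
  proof -
    have "w \<in> V p"
      using assms(3)[OF that] scaled by blast
    then show ?thesis
      using that superspace_Int[OF assms(1)] by (cases p) auto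
  qed
  then show q: "V (p + 1) = {0}"
    using vec.subspace_0[OF superspace_subspace[OF assms(1)]] by blast
  show "total V = range (\<lambda>a. vscale a v)"
  proof (cases p)
    case zero
    then have "total V = {x + y |x y. x \<in> V p \<and> y \<in> V (p + 1)}"
      by (simp add: total_def)
    then show ?thesis
      using p q by auto
  next
    case one
    then have "total V = {x + y |x y. x \<in> V (p + 1) \<and> y \<in> V p}"
      by (simp add: total_def)
    then show ?thesis
      using p q by auto
  qed
qed

section \<open>Isomorphisms of superspaces as pairs of even maps\<close>

lemma isomorphism_sVect:
  "isomorphism sVect (Hom sVect) V W f \<longleftrightarrow> (\<exists>h \<in> even_maps V W. \<exists>g \<in> even_maps W V. f = Arr V W h \<and>
    g \<circ> h = (\<lambda>x. if x \<in> total V then x else 0) \<and> h \<circ> g = (\<lambda>x. if x \<in> total W then x else 0))"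
  by (auto simp: isomorphism_def sVect_def Hom_def)

lemma even_maps_comp:
  assumes "h \<in> even_maps V W" "h' \<in> even_maps W U" "\<And>p. vec.subspace (V p)" "\<And>p. vec.subspace (W p)"
  shows "h' \<circ> h \<in> even_maps V U"
proof -
  note H = even_map_total[of h V, OF assms(1,3)] and H' = even_map_total[of h' W, OF assms(2,4)]
  \<comment> \<open>Outside \<open>total V\<close> the map \<open>h\<close> is 0, and the composite
    has to be 0 there as well. That \<open>h'\<close> sends 0 to 0 follows from its compatibility
    with the scalar 0.\<close>
  have "h' 0 = h' (vscale 0 0)"
    by simp
  also have "\<dots> = 0"
    using H'(3)[of 0 0] superspace_total(2)[of W, OF assms(4)] by (simp add: vec.subspace_0)
  finally have "h' 0 = 0" .
  then show ?thesis
    using assms(1,2) H H' unfolding even_maps_def linear_on_def by (auto simp: image_subset_iff)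
qed

lemma isomorphism_sVect_comp:
  assumes "isomorphism sVect (Hom sVect) V W f" "isomorphism sVect (Hom sVect) W U f'"
    and V: "\<And>p. vec.subspace (V p)" and W: "\<And>p. vec.subspace (W p)" and U: "\<And>p. vec.subspace (U p)"
  shows "\<exists>k. isomorphism sVect (Hom sVect) V U k"
proof -
  obtain h g where h: "h \<in> even_maps V W" and g: "g \<in> even_maps W V"
    and gh: "g \<circ> h = (\<lambda>x. if x \<in> total V then x else 0)"
    and hg: "h \<circ> g = (\<lambda>x. if x \<in> total W then x else 0)"
    using assms(1) unfolding isomorphism_sVect by blast
  obtain h' g' where h': "h' \<in> even_maps W U" and g': "g' \<in> even_maps U W"
    and gh': "g' \<circ> h' = (\<lambda>x. if x \<in> total W then x else 0)"
    and hg': "h' \<circ> g' = (\<lambda>x. if x \<in> total U then x else 0)"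
    using assms(2) unfolding isomorphism_sVect by blast
  have comp: "h' \<circ> h \<in> even_maps V U" "g \<circ> g' \<in> even_maps U V"
    using even_maps_comp[OF h h' V W] even_maps_comp[OF g' g U W] .
  have "((g \<circ> g') \<circ> (h' \<circ> h)) x = (if x \<in> total V then x else 0)" for x
  proof (cases "x \<in> total V")
    case True
    then have "g' (h' (h x)) = h x" "g (h x) = x"
      using fun_cong[OF gh', of "h x"] fun_cong[OF gh, of x] even_map_total(1)[of h V, OF h V] by simp_all
    then show ?thesis using True by simp
  next
    case False
    then have "(h' \<circ> h) x = 0"
      by (rule even_map_total(4)[of _ V, OF comp(1) V])
    moreover have "(g \<circ> g') 0 = vscale 0 ((g \<circ> g') 0)"
      using even_map_total(3)[of _ U, OF comp(2) U, of 0 0] superspace_total(2)[of U, OF U]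
      by (simp add: vec.subspace_0)
    ultimately show ?thesis using False by simp
  qed
  moreover have "((h' \<circ> h) \<circ> (g \<circ> g')) x = (if x \<in> total U then x else 0)" for x
  proof (cases "x \<in> total U")
    case True
    then have "h (g (g' x)) = g' x" "h' (g' x) = x"
      using fun_cong[OF hg, of "g' x"] fun_cong[OF hg', of x] even_map_total(1)[of g' U, OF g' U] by simp_all
    then show ?thesis using True by simp
  next
    case False
    then have "(g \<circ> g') x = 0"
      by (rule even_map_total(4)[of _ U, OF comp(2) U])
    moreover have "(h' \<circ> h) 0 = vscale 0 ((h' \<circ> h) 0)"
      using even_map_total(3)[of _ V, OF comp(1) V, of 0 0] superspace_total(2)[of V, OF V]
      by (simp add: vec.subspace_0)
    ultimately show ?thesis using False by simp
  qed
  ultimately show ?thesis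
    using comp unfolding isomorphism_sVect by blast
qed

lemma isomorphism_sVect_sym:
  "isomorphism sVect (Hom sVect) V W f \<Longrightarrow> \<exists>g. isomorphism sVect (Hom sVect) W V g"
  unfolding isomorphism_sVect by blast

text \<open>An invertible superspace is a line: it is nonzero, and any two of its homogeneous vectors are
  proportional because their tensor products with a fixed one are.\<close>

lemma tensor_square_unit_line:
  fixes V :: "'k::field sspace"
  assumes V: "V \<in> superspaces" and iso: "isomorphism sVect (Hom sVect) (sspace_tensor V V) sspace_unit \<theta>"
  obtains p v where "v \<in> V p" "v \<noteq> 0" "\<And>q w. w \<in> V q \<Longrightarrow> \<exists>a. w = vscale a v"
    "\<And>x. x \<in> total (sspace_tensor V V) \<Longrightarrow> \<exists>a. x = vscale a (vtensor v v)"
proof -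
  let ?T = "sspace_tensor V V" and ?u = "unit_vec :: 'k vec"
  have u: "?u \<noteq> 0"
    by (auto simp: unit_vec_def fun_eq_iff)
  have subU: "vec.subspace (sspace_unit p)" for p
    by (simp add: sspace_unit_def)
  obtain h g where h: "h \<in> even_maps ?T sspace_unit" and g: "g \<in> even_maps sspace_unit ?T"
    and gh: "g \<circ> h = (\<lambda>x. if x \<in> total ?T then x else 0)"
    and hg: "h \<circ> g = (\<lambda>x. if x \<in> total sspace_unit then x else 0)"
    using iso unfolding isomorphism_sVect by blast
  note H = even_map_total[of h ?T, OF h sspace_tensor_subspace] and G = even_map_total[of g sspace_unit, OF g subU]
  have gh: "g (h x) = x" if "x \<in> total ?T" for x
    using fun_cong[OF gh, of x] that by simp
  have hg: "h (g x) = x" if "x \<in> total sspace_unit" for x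
    using fun_cong[OF hg, of x] that by simp
  \<comment> \<open>The unit superspace is spanned by one vector, so \<open>h x\<close> and
    \<open>h y\<close> are multiples of it; \<open>g\<close> inverts \<open>h\<close> and carries
    the proportion back.\<close>
  have proportional: "\<exists>a. x = vscale a y" if xy: "x \<in> total ?T" "y \<in> total ?T" "y \<noteq> 0" for x y
  proof -
    obtain a b where ab: "h x = vscale a ?u" "h y = vscale b ?u"
      using H(1)[OF xy(1)] H(1)[OF xy(2)] unfolding total_sspace_unit by blast
    have "b \<noteq> 0"
    proof
      assume "b = 0"
      then have "h y = vscale 0 (h y)"
        using ab(2) by simp
      then have "g (h y) = vscale 0 (g (h y))"
        using G(3)[OF H(1)[OF xy(2)], of 0] by simp
      then show False
        using gh[OF xy(2)] xy(3) by simp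
    qed
    then have "h x = vscale (a / b) (h y)"
      using ab by simp
    then have "g (h x) = vscale (a / b) (g (h y))"
      using G(3)[OF H(1)[OF xy(2)]] by simp
    then show ?thesis
      using gh xy by auto
  qed
  have ut: "?u \<in> total sspace_unit"
    unfolding total_sspace_unit by (rule image_eqI[of _ _ 1]) simp_all
  \<comment> \<open>If all products of homogeneous vectors vanished, so would the tensor square, and
    with it the unit vector \<open>h (g ?u)\<close>.\<close>
  have "\<exists>p v q w. v \<in> V p \<and> w \<in> V q \<and> vtensor v w \<noteq> 0"
  proof (rule ccontr)
    assume "\<not> ?thesis"
    then have z: "vtensor v w = 0" if "v \<in> V p" "w \<in> V q" for p q v w
      using that by blast
    have T0: "?T r \<subseteq> {0}" for r
      unfolding sspace_tensor_def by (rule vec.span_minimal) (auto simp: z)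
    obtain x y where "g ?u = x + y" "x \<in> ?T 0" "y \<in> ?T 1"
      using G(1)[OF ut] by (auto simp: total_def)
    moreover from this have "x = 0" "y = 0"
      using T0 by blast+
    ultimately have "g ?u = 0"
      by simp
    then have "h (g ?u) = vscale 0 (h (g ?u))"
      using H(3)[OF G(1)[OF ut], of 0] by simp
    then show False
      using hg[OF ut] u by simp
  qed
  then obtain p v q w where vw: "v \<in> V p" "w \<in> V q" "vtensor v w \<noteq> 0"
    by blast
  \<comment> \<open>Only \<open>v\<close> is kept from here on. Its square is nonzero at the
    coordinate \<open>Pair i i\<close> and is the vector with which all others are compared.\<close>
  have v0: "v \<noteq> 0"
  proof
    assume "v = 0"
    then have "vtensor v w = 0"
      by (auto simp: vtensor_def fun_eq_iff split: ix.split)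
    then show False using vw(3) by simp
  qed
  then obtain i where i: "v i \<noteq> 0"
    by (auto simp: fun_eq_iff)
  have vv: "vtensor v v \<noteq> 0"
  proof
    assume "vtensor v v = 0"
    then have "vtensor v v (Pair i i) = 0"
      by (simp only: zero_fun_apply)
    then show False
      using i by simp
  qed
  have sq: "vtensor v v \<in> total ?T"
    by (rule vtensor_in_total) (fact vw(1))+
  have line: "\<exists>a. w = vscale a v" if w: "w \<in> V q" for w q
  proof -
    obtain a where "vtensor v w = vscale a (vtensor v v)"
      using proportional[OF vtensor_in_total[where V = V and W = V, OF vw(1) w] sq vv] by blast
    \<comment> \<open>Comparing the coordinates \<open>Pair i j\<close> for the fixed
      \<open>i\<close> and all \<open>j\<close> allows \<open>v i\<close> to be cancelled.\<close>
    then have "vtensor v w (Pair i j) = vscale a (vtensor v v) (Pair i j)" for j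
      by simp
    then have "w j = a * v j" for j
      using i by (simp add: mult.left_commute)
    then have "w = vscale a v"
      by (auto simp: fun_eq_iff)
    then show ?thesis ..
  qed
  show thesis
    by (rule that[OF vw(1) v0 line proportional[OF _ sq vv]])
qed

section \<open>Even and odd lines\<close>

lemma even_line_isomorphic_unit:
  fixes V :: "'k::field sspace"
  assumes V: "V \<in> superspaces" and v: "v \<in> V 0" "v \<noteq> 0" "\<And>q w. w \<in> V q \<Longrightarrow> \<exists>a. w = vscale a v"
  shows "isomorphic sVect V sspace_unit"
proof -
  let ?u = "unit_vec :: 'k vec"
  obtain i where i: "v i \<noteq> 0"
    using v(2) by (auto simp: fun_eq_iff)
  have u: "?u (Pt 0) = 1"
    by (simp add: unit_vec_def)
  have U: "total sspace_unit = range (\<lambda>a. vscale a ?u)" "sspace_unit 0 = range (\<lambda>a. vscale a ?u)"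
    "sspace_unit 1 = {0 :: 'k vec}"
    by (simp_all add: total_sspace_unit) (simp_all add: sspace_unit_def vec.span_singleton)
  have L: "total V = range (\<lambda>a. vscale a v)" "V 0 = range (\<lambda>a. vscale a v)" "V 1 = {0}"
    using total_line[OF V v(1,3)] by simp_all
  \<comment> \<open>A nonzero entry of \<open>v\<close> serves as coordinate on the line; on the
    unit superspace it is the entry at \<open>Pt 0\<close>, where \<open>unit_vec\<close> is
    1.\<close>
  define h where "h x = (if x \<in> total V then vscale (x i / v i) ?u else 0)" for x
  define g where "g y = (if y \<in> total sspace_unit then vscale (y (Pt 0)) v else 0)" for y
  have h: "h (vscale a v) = vscale a ?u" for a
    using i rangeI[of "\<lambda>a. vscale a v" a] unfolding h_def L(1) by simp
  have g: "g (vscale a ?u) = vscale a v" for a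
    using u rangeI[of "\<lambda>a. vscale a ?u" a] unfolding g_def U(1) by simp
  have h0: "h x = 0" if "x \<notin> total V" for x using that by (simp add: h_def)
  have g0: "g x = 0" if "x \<notin> total sspace_unit" for x using that by (simp add: g_def)
  have hz: "h 0 = 0" "g 0 = 0"
    using h[of 0] g[of 0] by simp_all
  have "h \<in> even_maps V sspace_unit"
    unfolding even_maps_def linear_on_def
  proof (intro CollectI conjI allI ballI impI)
    fix p show "h ` V p \<subseteq> sspace_unit p"
      by (cases p) (auto simp: L U h hz)
  qed (auto simp: L(1) h h0[unfolded L(1)] simp flip: vec.scale_left_distrib)
  moreover have "g \<in> even_maps sspace_unit V"
    unfolding even_maps_def linear_on_def
  proof (intro CollectI conjI allI ballI impI)
    fix p show "g ` sspace_unit p \<subseteq> V p"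
      by (cases p) (auto simp: L U g hz)
  qed (auto simp: U(1) g g0[unfolded U(1)] simp flip: vec.scale_left_distrib)
  moreover have "g \<circ> h = (\<lambda>x. if x \<in> total V then x else 0)"
    by (intro ext) (auto simp: L(1) h g h0[unfolded L(1)] hz)
  moreover have "h \<circ> g = (\<lambda>x. if x \<in> total sspace_unit then x else 0)"
    by (intro ext) (auto simp: U(1) h g g0[unfolded U(1)] hz)
  ultimately show ?thesis
    unfolding isomorphic_def isomorphism_sVect by blast
qed

text \<open>The braiding is a definite description. Negation satisfies it because vectors of a line
  commute under \<open>vtensor\<close>, and is the only solution because \<open>vtensor v v\<close>
  spans the tensor square.\<close>

lemma sVect_braiding_odd_line:
  fixes V :: "'k::field sspace"
  assumes V: "V \<in> superspaces" and v: "v \<in> V 1" "\<And>q w. w \<in> V q \<Longrightarrow> \<exists>a. w = vscale a v"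
    and T: "\<And>x. x \<in> total (sspace_tensor V V) \<Longrightarrow> \<exists>a. x = vscale a (vtensor v v)"
  shows "sVect_braiding V V = Arr (sspace_tensor V V) (sspace_tensor V V)
    (\<lambda>x. if x \<in> total (sspace_tensor V V) then - x else 0)" (is "_ = Arr ?T ?T ?n")
proof -
  let ?P = "\<lambda>h. \<forall>p q. \<forall>v \<in> V p. \<forall>w \<in> V q.
      h (vtensor v w) = (if p = 1 \<and> q = 1 then - vtensor w v else vtensor w v)"
  have L: "V 0 = {0}" "V 1 = range (\<lambda>a. vscale a v)"
    using total_line[OF V v] by simp_all
  note tot = superspace_total(2)[of ?T, OF sspace_tensor_subspace]
  have "?n ` ?T p \<subseteq> ?T p" for p
    using superspace_total(1)[of ?T p, OF sspace_tensor_subspace]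
      vec.subspace_neg[OF sspace_tensor_subspace, of _ V V p] by auto
  then have n: "?n \<in> even_maps ?T ?T"
    using vec.subspace_add[OF tot] vec.subspace_scale[OF tot]
    by (auto simp: even_maps_def linear_on_def)
  have comm: "vtensor x y = vtensor y x" if "x \<in> V p" "y \<in> V q" for x y p q
    using v(2)[OF that(1)] v(2)[OF that(2)] by (auto simp: vtensor_eq_iff)
  \<comment> \<open>The even part is 0, so both signs agree wherever the description has no
    minus.\<close>
  have zero: "vtensor x y = 0" if "x \<in> V p" "y \<in> V q" "\<not> (p = 1 \<and> q = 1)" for x y p q
  proof -
    have "x = 0 \<or> y = 0"
      using that L(1) by (cases p; cases q) auto
    then show ?thesis
      by (auto simp: vtensor_def fun_eq_iff split: ix.splits)
  qed
  have P: "?P ?n"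
  proof (intro allI ballI)
    fix p q x y assume xy: "x \<in> V p" "y \<in> V q"
    show "?n (vtensor x y) = (if p = 1 \<and> q = 1 then - vtensor y x else vtensor y x)"
      using vtensor_in_total[where V = V and W = V, OF xy] comm[OF xy] zero[OF xy] by auto
  qed
  have "h = ?n" if h: "h \<in> even_maps ?T ?T" "?P h" for h
  proof
    fix x
    note H = even_map_total[of h ?T, OF h(1) sspace_tensor_subspace]
    show "h x = ?n x"
    proof (cases "x \<in> total ?T")
      case True
      then obtain a where a: "x = vscale a (vtensor v v)"
        using T by blast
      have "h (vtensor v v) = - vtensor v v"
        using h(2) v(1) by simp
      then show ?thesis
        using H(3)[OF vtensor_in_total[where V = V and W = V, OF v(1) v(1)], of a] True a by simp
    qed (simp add: H(4))
  qed
  then have "(THE h. h \<in> even_maps ?T ?T \<and> ?P h) = ?n"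
    using n P by (intro the_equality) blast+
  then show ?thesis
    by (simp add: sVect_braiding_def the_even_map_def)
qed

section \<open>The self-braiding of the odd simple object\<close>

lemma symmetric_center_simps [simp]:
  "obj (symmetric_center C c) = {X \<in> obj C. \<forall>Y \<in> obj C. c Y X \<cdot>\<^bsub>C\<^esub> c X Y = idt C (X \<odot>\<^bsub>C\<^esub> Y)}"
  "idt (symmetric_center C c) = idt C" "cmp (symmetric_center C c) = cmp C"
  "tensor_obj (symmetric_center C c) = tensor_obj C" "tunit (symmetric_center C c) = tunit C"
  "scl (symmetric_center C c) = scl C" "homspace (symmetric_center C c) = homspace C"
  "Hom (symmetric_center C c) = Hom C"
  by (auto simp: symmetric_center_def full_subcategory_def Hom_def fun_eq_iff)

lemma sVect_simps [simp]:
  "obj sVect = superspaces" "cmp sVect g f = Arr (src f) (trg g) (val g \<circ> val f)"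
  "tensor_obj sVect = sspace_tensor" "tunit sVect = sspace_unit" "homspace sVect = even_maps"
  "idt sVect V = Arr V V (\<lambda>v. if v \<in> total V then v else 0)" "scl sVect = (\<lambda>a f v. vscale a (f v))"
  by (simp_all add: sVect_def)

lemma linear_on_scale: "linear_on s t V f \<Longrightarrow> v \<in> V \<Longrightarrow> f (s a v) = t a (f v)"
  by (simp add: linear_on_def)

text \<open>Fullness of \<open>F\<close> lifts an isomorphism with the unit back to C, which
  excludes an even line; faithfulness brings back the equation once it holds for
  superspaces.\<close>

lemma braiding_odd_object:
  fixes C :: "('o, 'v::ab_group_add, 'k::field, 'z) linear_monoidal_data_scheme" (structure)
  assumes C: "slightly_degenerate_braided_fusion_category C c"
    and eps: "simple_object (symmetric_center C c) \<epsilon>" and not_unit: "\<not> isomorphic C \<epsilon> \<one>\<^bsub>C\<^esub>"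
    and xi: "isomorphism C (Hom C) (\<epsilon> \<odot>\<^bsub>C\<^esub> \<epsilon>) \<one>\<^bsub>C\<^esub> \<xi>"
  shows "c \<epsilon> \<epsilon> = neg_arr (idt C (\<epsilon> \<odot>\<^bsub>C\<^esub> \<epsilon>))"
proof -
  interpret slightly_degenerate_braided_fusion_category C c
    by (rule C)
  interpret braided_linear_category C c
    by unfold_locales (use braiding_iso braiding_natural braiding_hexagons in auto)
  let ?Z = "symmetric_center C c"
  obtain F\<^sub>0 F J \<phi> where "braided_equivalence ?Z c sVect sVect_braiding F\<^sub>0 F J \<phi>"
    using center_equivalent_sVect by blast
  then interpret E: braided_equivalence ?Z c sVect sVect_braiding F\<^sub>0 F J \<phi> .
  have eps_Z: "\<epsilon> \<in> obj ?Z"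
    using eps by (simp add: simple_object_def)
  then have [simp]: "\<epsilon> \<in> obj C"
    by simp
  have unit_Z: "\<one> \<in> obj ?Z"
    by (simp add: tunit_transparent)
  note xi' = iso_of_isomorphism[OF _ _ xi, simplified]
  have eps2_Z: "\<epsilon> \<odot> \<epsilon> \<in> obj ?Z"
    using transparent_iso[OF xi'(1,3,4)] tunit_transparent by simp
  let ?V = "F\<^sub>0 \<epsilon>" and ?W = "F\<^sub>0 (\<epsilon> \<odot> \<epsilon>)" and ?U = "F\<^sub>0 \<one>"
  have V: "?V \<in> superspaces" and W: "?W \<in> superspaces" and U: "?U \<in> superspaces"
    using E.functor_obj[OF eps_Z] E.functor_obj[OF eps2_Z] E.functor_obj[OF unit_Z] by simp_all
  note sub = superspace_subspace[OF V] superspace_subspace[OF W] superspace_subspace[OF U]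
    sspace_tensor_subspace
  have subU: "vec.subspace (sspace_unit p)" for p
    by (simp add: sspace_unit_def)
  have J: "isomorphism sVect (Hom sVect) (sspace_tensor ?V ?V) ?W (J \<epsilon> \<epsilon>)"
    using E.J_iso[OF eps_Z eps_Z] by simp
  have \<phi>: "isomorphism sVect (Hom sVect) sspace_unit ?U \<phi>"
    using E.phi_iso by simp
  then obtain \<phi>' where \<phi>': "isomorphism sVect (Hom sVect) ?U sspace_unit \<phi>'"
    using isomorphism_sVect_sym by blast
  have Fxi: "isomorphism sVect (Hom sVect) ?W ?U (F \<xi>)"
  proof -
    obtain \<zeta> where z: "\<zeta> \<in> Hom C \<one> (\<epsilon> \<odot> \<epsilon>)" "\<zeta> \<cdot> \<xi> = idt C (\<epsilon> \<odot> \<epsilon>)" "\<xi> \<cdot> \<zeta> = idt C \<one>"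
        and x: "\<xi> \<in> Hom C (\<epsilon> \<odot> \<epsilon>) \<one>"
      using xi by (auto simp: isomorphism_def)
    show ?thesis
      unfolding isomorphism_def
      using E.functor_in_Hom[OF eps2_Z unit_Z, of \<xi>] E.functor_in_Hom[OF unit_Z eps2_Z, of \<zeta>]
        E.functor_cmp[OF eps2_Z unit_Z eps2_Z, of \<xi> \<zeta>] E.functor_cmp[OF unit_Z eps2_Z unit_Z, of \<zeta> \<xi>]
        E.functor_idt[OF eps2_Z] E.functor_idt[OF unit_Z] z x
      by (intro conjI bexI[of _ "F \<zeta>"]) simp_all
  qed
  obtain \<theta> where "isomorphism sVect (Hom sVect) (sspace_tensor ?V ?V) ?U \<theta>"
    using isomorphism_sVect_comp[OF J Fxi] sub by blast
  then obtain \<theta> where "isomorphism sVect (Hom sVect) (sspace_tensor ?V ?V) sspace_unit \<theta>"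
    using isomorphism_sVect_comp[OF _ \<phi>'] sub subU by blast
  from tensor_square_unit_line[OF V this] obtain p v where
    v: "v \<in> ?V p" "v \<noteq> 0" "\<And>q w. w \<in> ?V q \<Longrightarrow> \<exists>a. w = vscale a v"
    and T: "\<And>x. x \<in> total (sspace_tensor ?V ?V) \<Longrightarrow> \<exists>a. x = vscale a (vtensor v v)"
    by metis
  \<comment> \<open>An even line would give an isomorphism from \<open>F\<^sub>0 \<epsilon>\<close>
    through the unit superspace to \<open>F\<^sub>0 \<one>\<close>. Its preimages under
    \<open>F\<close> are mutually inverse by faithfulness, against the choice of \<epsilon>.\<close>
  have "p \<noteq> 0"
  proof
    assume "p = 0"
    with v have "isomorphic sVect ?V sspace_unit"
      by (intro even_line_isomorphic_unit[OF V]) auto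
    then obtain k where "isomorphism sVect (Hom sVect) ?V ?U k"
      using isomorphism_sVect_comp[OF _ \<phi>] sub subU unfolding isomorphic_def by blast
    then obtain k' where k: "k \<in> Hom sVect ?V ?U" "k' \<in> Hom sVect ?U ?V"
      "cmp sVect k' k = idt sVect ?V" "cmp sVect k k' = idt sVect ?U"
      unfolding isomorphism_def by blast
    have bij: "bij_betw F (Hom C X Y) (Hom sVect (F\<^sub>0 X) (F\<^sub>0 Y))" if "X \<in> obj ?Z" "Y \<in> obj ?Z" for X Y
      using E.fully_faithful[OF that] by simp
    have "k \<in> F ` Hom C \<epsilon> \<one>" "k' \<in> F ` Hom C \<one> \<epsilon>"
      using k(1,2) by (simp_all add: bij_betw_imp_surj_on[OF bij[OF eps_Z unit_Z]]
        bij_betw_imp_surj_on[OF bij[OF unit_Z eps_Z]])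
    then obtain f g where fg: "f \<in> Hom C \<epsilon> \<one>" "F f = k" "g \<in> Hom C \<one> \<epsilon>" "F g = k'"
      by auto
    have gf: "g \<cdot> f \<in> Hom C \<epsilon> \<epsilon>" "f \<cdot> g \<in> Hom C \<one> \<one>"
      using fg by (simp_all add: Hom_iff_arrow)
    have "F (g \<cdot> f) = F (idt C \<epsilon>)" "F (f \<cdot> g) = F (idt C \<one>)"
      using E.functor_cmp[OF eps_Z unit_Z eps_Z, of f g] E.functor_cmp[OF unit_Z eps_Z unit_Z, of g f]
        E.functor_idt[OF eps_Z] E.functor_idt[OF unit_Z] fg k by simp_all
    then have "g \<cdot> f = idt C \<epsilon>" "f \<cdot> g = idt C \<one>"
      using bij[OF eps_Z eps_Z] bij[OF unit_Z unit_Z] gf idt_in_Hom[of \<epsilon>] idt_in_Hom[of \<one>]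
      unfolding bij_betw_def by (auto dest: inj_onD)
    then show False
      using not_unit fg unfolding isomorphic_def isomorphism_def by blast
  qed
  then have p: "p = 1"
    by (cases p) auto
  let ?T = "sspace_tensor ?V ?V" and ?N = "neg_arr (idt C (\<epsilon> \<odot> \<epsilon>))"
  have br: "sVect_braiding ?V ?V = Arr ?T ?T (\<lambda>x. if x \<in> total ?T then - x else 0)"
    using sVect_braiding_odd_line[OF V] v T p by blast
  obtain j j' where j: "J \<epsilon> \<epsilon> = Arr ?T ?W j" "j \<in> even_maps ?T ?W" "j' \<in> even_maps ?W ?T"
    and jj: "j \<circ> j' = (\<lambda>x. if x \<in> total ?W then x else 0)"
    using J unfolding isomorphism_sVect by blast
  have c_Hom: "c \<epsilon> \<epsilon> \<in> Hom C (\<epsilon> \<odot> \<epsilon>) (\<epsilon> \<odot> \<epsilon>)" and N_Hom: "?N \<in> Hom C (\<epsilon> \<odot> \<epsilon>) (\<epsilon> \<odot> \<epsilon>)"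
    by (simp_all add: Hom_iff_arrow)
  obtain a where a: "F (c \<epsilon> \<epsilon>) = Arr ?W ?W a" "a \<in> even_maps ?W ?W"
    using E.functor_in_Hom[OF eps2_Z eps2_Z, of "c \<epsilon> \<epsilon>"] c_Hom by (auto simp: Hom_def)
  obtain b where b: "F ?N = Arr ?W ?W b" "b \<in> even_maps ?W ?W"
    using E.functor_in_Hom[OF eps2_Z eps2_Z, of ?N] N_Hom by (auto simp: Hom_def)
  \<comment> \<open>Negation is the multiple by -1, the form to which linearity of \<open>F\<close>
    applies; the image of the identity is the identity on \<open>total ?W\<close>.\<close>
  have b_eq: "b x = - x" if "x \<in> total ?W" for x
  proof -
    let ?i = "val (idt C (\<epsilon> \<odot> \<epsilon>))"
    have i: "?i \<in> homspace C (\<epsilon> \<odot> \<epsilon>) (\<epsilon> \<odot> \<epsilon>)" "Arr (\<epsilon> \<odot> \<epsilon>) (\<epsilon> \<odot> \<epsilon>) ?i = idt C (\<epsilon> \<odot> \<epsilon>)"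
      using arrow_val[of "idt C (\<epsilon> \<odot> \<epsilon>)"] by simp_all
    have N: "?N = Arr (\<epsilon> \<odot> \<epsilon>) (\<epsilon> \<odot> \<epsilon>) (scl C (- 1) ?i)"
      by (simp add: neg_arr_def)
    have "val (F (Arr (\<epsilon> \<odot> \<epsilon>) (\<epsilon> \<odot> \<epsilon>) (scl C (- 1) ?i)))
      = scl sVect (- 1) (val (F (Arr (\<epsilon> \<odot> \<epsilon>) (\<epsilon> \<odot> \<epsilon>) ?i)))"
      using linear_on_scale[OF E.functor_linear[OF eps2_Z eps2_Z], of ?i "- 1"] i(1) by simp
    then have "val (F ?N) = (\<lambda>y. vscale (- 1) (val (F (idt C (\<epsilon> \<odot> \<epsilon>))) y))"
      unfolding N i(2) by simp
    then show ?thesis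
      using E.functor_idt[OF eps2_Z] b(1) that by simp
  qed
  \<comment> \<open>The braiding square of \<open>F\<close> at \<epsilon> and \<epsilon>, with the
    braiding of the odd line inserted.\<close>
  have "a \<circ> j = j \<circ> (\<lambda>x. if x \<in> total ?T then - x else 0)"
    using E.functor_braiding[OF eps_Z eps_Z] by (simp add: a j br)
  then have aj: "a (j x) = j (- x)" if "x \<in> total ?T" for x
    using that by (simp add: fun_eq_iff)
  note A = even_map_total[of a ?W, OF a(2) sub(2)] and B = even_map_total[of b ?W, OF b(2) sub(2)]
    and j_lin = even_map_total[of j ?T, OF j(2) sub(4)] and j'_lin = even_map_total[of j' ?W, OF j(3) sub(2)]
  \<comment> \<open>The inverse \<open>j'\<close> of the monoidal structure shows that
    \<open>j\<close> reaches every vector of \<open>total ?W\<close>, so the sign found on the image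
    of \<open>j\<close> holds everywhere.\<close>
  have "a x = b x" for x
  proof (cases "x \<in> total ?W")
    case True
    then have t: "j' x \<in> total ?T" and jj: "j (j' x) = x"
      using j'_lin(1) fun_cong[OF jj, of x] by auto
    have "a (j (j' x)) = - j (j' x)"
      using aj[OF t] j_lin(3)[OF t, of "- 1"] by simp
    then show ?thesis
      using jj b_eq[OF True] by simp
  qed (simp add: A(4) B(4))
  then have "F (c \<epsilon> \<epsilon>) = F ?N"
    using a(1) b(1) by (simp add: fun_eq_iff)
  then show ?thesis
    using E.fully_faithful[OF eps2_Z eps2_Z] c_Hom N_Hom by (auto simp: bij_betw_def dest: inj_onD)
qed

theorem proposition4p2:
  fixes C :: "('o, 'v::ab_group_add, 'k::{alg_closed_field,field_char_0}) linear_monoidal_data"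
    and c :: "'o \<Rightarrow> 'o \<Rightarrow> ('o, 'v) arr"
    and \<epsilon> :: 'o
    and \<xi> :: "('o, 'v) arr"
  assumes "slightly_degenerate_braided_fusion_category C c"
    and "simple_object (symmetric_center C c) \<epsilon>" and "\<not> isomorphic C \<epsilon> \<one>\<^bsub>C\<^esub>"
    and "isomorphism C (Hom C) (\<epsilon> \<odot>\<^bsub>C\<^esub> \<epsilon>) \<one>\<^bsub>C\<^esub> \<xi>"
  shows "braided_monoidal_supercategory (hat C c \<epsilon> \<xi>) (\<lambda>X Y. even_arr (c X Y))"
proof -
  interpret slightly_degenerate_braided_fusion_category C c
    by (rule assms(1))
  interpret braided_linear_category C c
    by unfold_locales (use braiding_iso braiding_natural braiding_hexagons in auto)
  \<comment> \<open>Membership in the center is transparency of \<epsilon>; together with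
    \<open>braiding_odd_object\<close> it supplies the assumptions of
    \<open>fermion\<close>.\<close>
  have eps: "\<epsilon> \<in> obj (symmetric_center C c)"
    using assms(2) by (simp add: simple_object_def)
  then have "\<epsilon> \<in> obj C"
    by simp
  interpret finite_fermion C c \<epsilon> \<xi>
    using eps iso_of_isomorphism[OF _ _ assms(4)] braiding_odd_object[OF assms] finite_dimensional
    by unfold_locales auto
  show ?thesis
    by (rule braided_monoidal_supercategory_hat)
qed

end
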